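(* Let $c\in\mathbb{C}\setminus\{0\}$ and $n\geq 1$, and let $g=[g_{0}:\cdots:g_{n}]$ be a holomorphic curve of $\mathbb{C}$ into $\mathbb{P}^n(\mathbb{C})$ with $\varsigma(g)<1$, where $g_{0},\ldots,g_{n}$ are linearly independent over $\mathcal{P}_{c}^{1}$. Let $$\mathbf{a}_j(z)=(a_{j0}(z),\ldots,a_{jn}(z)),\qquad j\in\{0,\ldots,q\},$$ where $a_{jk}(z)$ are $c$-periodic entire functions satisfying $T(r,a_{jk})=o(T_{g}(r))$ for all $j\in\{0,\ldots,q\}$ and $k\in\{0,\ldots,n\}$. If the moving hyperplanes $$H_j(z)=\left\{[x_0:\cdots:x_n]: L_{H_j}(x,\mathbf{a}_j(z))=0\right\},\qquad j\in\{0,\ldots,q\},$$ are located in general position over $\mathcal{P}_c^1$, then $$\sum_{j=0}^{q}\delta^{[n,c]}_{g}(0,L_{H_j})\leq n+1,$$ where $$\delta^{[n,c]}_{g}(0,L_{H_j})=1-\limsup_{r\to\infty}\frac{\tilde{N}_g^{[n,c]}(r,L_{H_j})}{T_{g}(r)}.$$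
   Context: A holomorphic curve $g=[g_0:\cdots:g_n]:\mathbb{C}\to\mathbb{P}^n$ is given by a reduced representation, i.e. $g_0,\ldots,g_n$ are entire functions with no common zeros in $\mathbb{C}$. Its Cartan characteristic function is $$T_g(r)=\int_0^{2\pi}u(re^{i\theta})\frac{d\theta}{2\pi}-u(0),\qquad u(z)=\max_{0\le k\le n}\log|g_k(z)|,$$ and its hyper-order is $\varsigma(g)=\limsup_{r\to\infty}\frac{\log\log T_g(r)}{\log r}$. $\mathcal{P}_c^1$ is the field of meromorphic functions in $\mathbb{C}$ of period $c$ whose hyper-order (the same limsup with the Nevanlinna characteristic $T(r,f)$) is strictly less than one. For $x=[x_0:\cdots:x_n]$ write $L_{H_j}(x,\mathbf{a}_j(z))=a_{j0}(z)x_0+\cdots+a_{jn}(z)x_n$; thus $L_{H_j}(g,\mathbf{a}_j)=a_{j0}g_0+\cdots+a_{jn}g_n$ is an entire function. The hyperplanes $H_0,\ldots,H_q$ are in general position over $\mathcal{P}_c^1$ if $q\ge n$ and any $n+1$ of the vectors $\mathbf{a}_0(z),\ldots,\mathbf{a}_q(z)$ are linearly independent over $\mathcal{P}_c^1$. A zero $z_0$ of an entire function $h$ is called $n$-successive and $c$-separated if each of the $n$ functions $h(z+\nu c)$ $(\nu=1,\ldots,n)$ vanishes at $z=z_0$ with multiplicity not less than that of $h(z)$ there. All other zeros of $h$ are called $n$-aperiodic of pace $c$. $\tilde N_g^{[n,c]}(r,L_{H_j})$ denotes the (integrated) counting function of the $n$-aperiodic zeros of pace $c$ of the function $L_{H_j}(g,\mathbf{a}_j)$,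 counted with multiplicity. *)

theory Defs
  imports "HOL-Complex_Analysis.Complex_Analysis" "HOL-Library.Landau_Symbols"
begin

section \<open>Characteristic functions and hyper-order\<close>

definition circle_mean :: "(complex \<Rightarrow> real) \<Rightarrow> real \<Rightarrow> real" where
  "circle_mean u r = integral {0..2*pi} (\<lambda>\<theta>. u (rcis r \<theta>)) / (2*pi)"

text \<open>
  A multiplicity function \<open>\<mu>\<close> (with locally finite support) assigns to every point the
  multiplicity with which it is counted.  The integrated counting function is
  \<open>N(r) = \<integral>\<^sub>0\<^sup>r (n(t) - n(0))/t dt + n(0) log r\<close>.
\<close>

definition unint_counting :: "(complex \<Rightarrow> int) \<Rightarrow> real \<Rightarrow> real" where
  "unint_counting \<mu> t = (\<Sum>z | norm z \<le> t \<and> \<mu> z \<noteq> 0. real_of_int (\<mu> z))"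

definition counting :: "(complex \<Rightarrow> int) \<Rightarrow> real \<Rightarrow> real" where
  "counting \<mu> r =
     integral {0..r} (\<lambda>t. (unint_counting \<mu> t - unint_counting \<mu> 0) / t)
     + unint_counting \<mu> 0 * ln r"

definition pole_mult :: "(complex \<Rightarrow> complex) \<Rightarrow> complex \<Rightarrow> int" where
  "pole_mult f z = (if is_pole f z then - zorder f z else 0)"

text \<open>The positive part \<open>log\<^sup>+ x\<close> is \<open>ln (max 1 x)\<close>; for meromorphic \<open>f\<close> the value that
  \<open>f\<close> takes at a pole does not affect the integral.\<close>

definition nevanlinna_T :: "(complex \<Rightarrow> complex) \<Rightarrow> real \<Rightarrow> real" where
  "nevanlinna_T f r =
     circle_mean (\<lambda>z. ln (max 1 (norm (f z)))) r + counting (pole_mult f) r"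

definition entire_curve :: "nat \<Rightarrow> (nat \<Rightarrow> complex \<Rightarrow> complex) \<Rightarrow> bool" where
  "entire_curve n g \<longleftrightarrow>
     (\<forall>k\<le>n. g k holomorphic_on UNIV) \<and> (\<forall>z. \<exists>k\<le>n. g k z \<noteq> 0)"

text \<open>The indices with \<open>g k z = 0\<close>, where \<open>log |g k z| = -\<infinity>\<close>, are left out of the maximum,
  because \<open>ln 0 = 0\<close> in HOL.\<close>

definition cartan_u :: "nat \<Rightarrow> (nat \<Rightarrow> complex \<Rightarrow> complex) \<Rightarrow> complex \<Rightarrow> real" where
  "cartan_u n g z = Max ((\<lambda>k. ln (norm (g k z))) ` {k. k \<le> n \<and> g k z \<noteq> 0})"

definition cartan_T :: "nat \<Rightarrow> (nat \<Rightarrow> complex \<Rightarrow> complex) \<Rightarrow> real \<Rightarrow> real" where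
  "cartan_T n g r = circle_mean (cartan_u n g) r - cartan_u n g 0"

text \<open>If \<open>T\<close> is constant (the characteristic of a constant function), this is \<open>0\<close>; otherwise the
  characteristic functions used here tend to infinity, so the iterated logarithm is eventually
  a genuine one.\<close>

definition hyper_order :: "(real \<Rightarrow> real) \<Rightarrow> ereal" where
  "hyper_order T = Limsup at_top (\<lambda>r. ereal (ln (ln (T r)) / ln r))"


section \<open>Periodic functions of hyper-order less than one\<close>

text \<open>A meromorphic function on the plane is represented by its normalised version: removable
  singularities are removed and the value at a pole is \<open>0\<close>.\<close>

definition P1 :: "complex \<Rightarrow> (complex \<Rightarrow> complex) set" where
  "P1 c = {f. f nicely_meromorphic_on UNIV \<and> (\<forall>z. f (z + c) = f z) \<and>
              hyper_order (nevanlinna_T f) < 1}"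

text \<open>Relations between meromorphic functions are required off a closed discrete set, i.e.\ as
  identities of meromorphic functions.\<close>

definition P1_lin_indep :: "complex \<Rightarrow> nat set \<Rightarrow> (nat \<Rightarrow> complex \<Rightarrow> complex) \<Rightarrow> bool" where
  "P1_lin_indep c I g \<longleftrightarrow>
     (\<forall>\<phi>. (\<forall>i\<in>I. \<phi> i \<in> P1 c) \<and>
          eventually (\<lambda>z. (\<Sum>i\<in>I. \<phi> i z * g i z) = 0) (cosparse UNIV)
          \<longrightarrow> (\<forall>i\<in>I. \<phi> i = (\<lambda>z. 0)))"

text \<open>The same for vectors \<open>a j = (a j 0, \<dots>, a j n)\<close> of functions.\<close>

definition P1_lin_indep_vec ::
    "complex \<Rightarrow> nat \<Rightarrow> nat set \<Rightarrow> (nat \<Rightarrow> nat \<Rightarrow> complex \<Rightarrow> complex) \<Rightarrow> bool" where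
  "P1_lin_indep_vec c n J a \<longleftrightarrow>
     (\<forall>\<phi>. (\<forall>j\<in>J. \<phi> j \<in> P1 c) \<and>
          (\<forall>k\<le>n. eventually (\<lambda>z. (\<Sum>j\<in>J. \<phi> j z * a j k z) = 0) (cosparse UNIV))
          \<longrightarrow> (\<forall>j\<in>J. \<phi> j = (\<lambda>z. 0)))"

definition general_position ::
    "complex \<Rightarrow> nat \<Rightarrow> nat \<Rightarrow> (nat \<Rightarrow> nat \<Rightarrow> complex \<Rightarrow> complex) \<Rightarrow> bool" where
  "general_position c n q a \<longleftrightarrow>
     n \<le> q \<and> (\<forall>J. J \<subseteq> {0..q} \<and> card J = n + 1 \<longrightarrow> P1_lin_indep_vec c n J a)"


section \<open>Aperiodic zeros and the defect\<close>

definition hyperplane_form ::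
    "nat \<Rightarrow> (nat \<Rightarrow> complex \<Rightarrow> complex) \<Rightarrow> (nat \<Rightarrow> complex \<Rightarrow> complex) \<Rightarrow> complex \<Rightarrow> complex" where
  "hyperplane_form n b g z = (\<Sum>k\<le>n. b k z * g k z)"

text \<open>For an entire \<open>h\<close> that is not identically zero, \<open>zorder\<close> is the vanishing multiplicity (and
  \<open>0\<close> where \<open>h\<close> does not vanish).\<close>

definition successive_separated :: "nat \<Rightarrow> complex \<Rightarrow> (complex \<Rightarrow> complex) \<Rightarrow> complex \<Rightarrow> bool" where
  "successive_separated n c h z0 \<longleftrightarrow>
     h z0 = 0 \<and> (\<forall>\<nu>\<in>{1..n}. zorder h z0 \<le> zorder (\<lambda>z. h (z + of_nat \<nu> * c)) z0)"

definition aperiodic_mult :: "nat \<Rightarrow> complex \<Rightarrow> (complex \<Rightarrow> complex) \<Rightarrow> complex \<Rightarrow> int" where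
  "aperiodic_mult n c h z =
     (if h z = 0 \<and> \<not> successive_separated n c h z then zorder h z else 0)"

definition aperiodic_N ::
    "nat \<Rightarrow> complex \<Rightarrow> (nat \<Rightarrow> complex \<Rightarrow> complex) \<Rightarrow> (nat \<Rightarrow> complex \<Rightarrow> complex) \<Rightarrow> real \<Rightarrow> real"
  where
  "aperiodic_N n c g b = counting (aperiodic_mult n c (hyperplane_form n b g))"

definition aperiodic_defect ::
    "nat \<Rightarrow> complex \<Rightarrow> (nat \<Rightarrow> complex \<Rightarrow> complex) \<Rightarrow> (nat \<Rightarrow> complex \<Rightarrow> complex) \<Rightarrow> ereal" where
  "aperiodic_defect n c g b =
     1 - Limsup at_top (\<lambda>r. ereal (aperiodic_N n c g b r / cartan_T n g r))"

end

theory Submission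
  imports Defs "Jordan_Normal_Form.Determinant" "HOL-Real_Asymp.Real_Asymp"
begin

text \<open>
  A limsup is bounded below along any sequence of radii, so it suffices to prove the second main
  theorem \<open>(q - n) T(r) \<le> (\<Sum>j. N\<^sub>j(r)) + o(T(r))\<close> for arbitrarily large \<open>r\<close>. With
  \<open>L\<^sub>j = \<Sum>k. a\<^sub>j\<^sub>k g\<^sub>k\<close>, general position bounds \<open>max log |g\<^sub>k|\<close> by all but the \<open>n\<close>
  smallest \<open>log |L\<^sub>j|\<close>; the remaining forms are compared with the Casoratian \<open>C\<close> of \<open>g\<close>,
  since by periodicity the Casoratian of any \<open>n + 1\<close> of the \<open>L\<^sub>j\<close> is \<open>C\<close> times a determinant
  of the \<open>a\<^sub>j\<^sub>k\<close>. After division by \<open>\<Prod>L\<^sub>j\<close> the Casoratian consists of quotients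
  \<open>\<ell>(z + \<nu>c) / \<ell>(z)\<close> with \<open>\<ell> = L\<^sub>j / g\<^sub>0\<close>. The Poisson--Jensen formula bounds the
  logarithmic means of these by \<open>o(T(r))\<close> whenever \<open>T(r + r\<^sup>1\<^sup>-\<^sup>t) \<le> 2 T(r)\<close>, and this
  holds for arbitrarily large \<open>r\<close> because the hyper-order is less than one. Jensen's formula turns
  means into counting functions, and an \<open>n\<close>-successive zero of \<open>L\<^sub>j\<close> is a zero of a whole
  column of the Casoratian, so only the aperiodic zeros survive.
\<close>

text \<open>\<open>T\<close> is unchanged when all \<open>g k\<close> are multiplied by the
  exponential of one entire function, so it bounds neither the mean of |u| nor that of |ln |L j||;
  only quotients such as \<open>L j / g 0\<close> are under control. Hence Poisson-Jensen is always
  applied to quotients. The row factors g 0 (z + \<nu> c) / g 0 z that remain need only a signed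
  mean, which Jensen's formula turns into a difference of log counts; a bounded shift changes it by
  an arbitrarily small multiple of \<open>T\<close>. The exponents satisfy s < t < d < 1.
  \<open>T r\<close> is at most exp (r^s); \<open>T\<close> at most doubles on a window of length
  about r^(1-t); O(r^t T(r)) zeros then matter, each costing O(r^(-d)). So d > t makes their total
  small, while d < 1 keeps |z - p|^(-d) integrable on circles. The Casoratian does not vanish
  identically, since otherwise ratios of its minors would be periodic coefficients of a linear
  relation between the \<open>g k\<close>. Placing these ratios in \<open>P1 c\<close> is what
  requires a growth bound for the shifted mean of \<open>u\<close>.\<close>

section \<open>Means over circles and their integrability\<close>

text \<open>A relation rather than a value: \<open>circle_mean\<close> is 0 on non-integrable
  functions, so additivity and monotonicity need integrability to travel together with the
  mean.\<close>

definition has_circle_mean :: "(complex \<Rightarrow> real) \<Rightarrow> real \<Rightarrow> real \<Rightarrow> bool" where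
  "has_circle_mean u r m \<longleftrightarrow> ((\<lambda>\<theta>. u (rcis r \<theta>)) has_integral (2 * pi * m)) {0..2*pi}"

lemma circle_mean_eq: "has_circle_mean u r m \<Longrightarrow> circle_mean u r = m"
  unfolding has_circle_mean_def circle_mean_def by (simp add: integral_unique)

lemma has_circle_mean_circle_mean_iff:
  "has_circle_mean u r (circle_mean u r) \<longleftrightarrow> (\<lambda>\<theta>. u (rcis r \<theta>)) integrable_on {0..2*pi}"
  unfolding has_circle_mean_def circle_mean_def
  by (auto simp: has_integral_integral)

lemma continuous_on_rcis [continuous_intros]:
  "continuous_on A f \<Longrightarrow> continuous_on A (\<lambda>x. rcis r (f x))"
  unfolding rcis_def cis_conv_exp by (intro continuous_intros)

lemma has_circle_mean_continuous:
  assumes "continuous_on (sphere 0 r) u" "r \<ge> 0"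
  shows "has_circle_mean u r (circle_mean u r)"
  unfolding has_circle_mean_circle_mean_iff
  by (rule integrable_continuous_real, rule continuous_on_compose2[OF assms(1)])
     (use assms(2) in \<open>auto intro!: continuous_intros\<close>)

lemma has_circle_mean_const: "has_circle_mean (\<lambda>z. k) r k"
  unfolding has_circle_mean_def using has_integral_const_real[of k 0 "2*pi"] by simp

lemma has_circle_mean_add:
  "has_circle_mean u r m \<Longrightarrow> has_circle_mean v r k \<Longrightarrow> has_circle_mean (\<lambda>z. u z + v z) r (m + k)"
  unfolding has_circle_mean_def by (auto simp: distrib_left intro: has_integral_add)

lemma has_circle_mean_diff:
  "has_circle_mean u r m \<Longrightarrow> has_circle_mean v r k \<Longrightarrow> has_circle_mean (\<lambda>z. u z - v z) r (m - k)"
  unfolding has_circle_mean_def by (auto simp: right_diff_distrib intro: has_integral_diff)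

lemma has_circle_mean_cmult:
  "has_circle_mean u r m \<Longrightarrow> has_circle_mean (\<lambda>z. k * u z) r (k * m)"
  unfolding has_circle_mean_def using has_integral_mult_right[of _ "2*pi*m" _ k]
  by (simp add: mult_ac)

lemma has_circle_mean_sum:
  assumes "\<And>i. i \<in> I \<Longrightarrow> has_circle_mean (u i) r (m i)"
  shows "has_circle_mean (\<lambda>z. \<Sum>i\<in>I. u i z) r (\<Sum>i\<in>I. m i)"
  using assms
proof (induction I rule: infinite_finite_induct)
  case (insert i I)
  then show ?case using has_circle_mean_add[of "u i" r "m i"] by simp
qed (auto intro: has_circle_mean_const)

lemma finite_rcis_vimage:
  assumes "r > 0" "finite S"
  shows "finite {\<theta>\<in>{0..2*pi}. rcis r \<theta> \<in> S}"
proof -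
  have "{\<theta>\<in>{0..2*pi}. rcis r \<theta> \<in> S} \<subseteq> insert (2*pi) (Arg2pi ` S)"
  proof
    fix \<theta> assume t: "\<theta> \<in> {\<theta>\<in>{0..2*pi}. rcis r \<theta> \<in> S}"
    show "\<theta> \<in> insert (2*pi) (Arg2pi ` S)"
    proof (cases "\<theta> = 2 * pi")
      case False
      have "Arg2pi (rcis r \<theta>) = \<theta>"
        by (rule Arg2pi_unique[of r]) (use t False assms in \<open>auto simp: rcis_def cis_conv_exp\<close>)
      then show ?thesis using t by force
    qed auto
  qed
  then show ?thesis using assms(2) by (meson finite_imageI finite_insert finite_subset)
qed

lemma has_circle_mean_spike:
  assumes "has_circle_mean u r m" "r > 0" "finite S"
    and "\<And>z. norm z = r \<Longrightarrow> z \<notin> S \<Longrightarrow> u z = v z"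
  shows "has_circle_mean v r m"
  unfolding has_circle_mean_def
proof (rule has_integral_spike_finite)
  show "finite {\<theta>\<in>{0..2*pi}. rcis r \<theta> \<in> S}" by (rule finite_rcis_vimage[OF assms(2,3)])
  show "((\<lambda>\<theta>. u (rcis r \<theta>)) has_integral 2 * pi * m) {0..2 * pi}"
    using assms(1) unfolding has_circle_mean_def .
qed (use assms in auto)

lemma has_circle_mean_cong:
  assumes "has_circle_mean u r m" "r > 0" and "\<And>z. norm z = r \<Longrightarrow> u z = v z"
  shows "has_circle_mean v r m"
  using has_circle_mean_spike[of u r m "{}" v] assms by auto

lemma has_circle_mean_le:
  assumes "has_circle_mean u r m" "has_circle_mean v r k" "r > 0"
    and "\<And>z. norm z = r \<Longrightarrow> u z \<le> v z"
  shows "m \<le> k"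
proof -
  have "2 * pi * m \<le> 2 * pi * k"
    by (rule has_integral_le[OF assms(1,2)[unfolded has_circle_mean_def]]) (use assms in auto)
  then show ?thesis by simp
qed

lemma has_circle_mean_le_except:
  assumes "has_circle_mean u r m" "has_circle_mean v r k" "r > 0" "finite S"
    and "\<And>z. norm z = r \<Longrightarrow> z \<notin> S \<Longrightarrow> u z \<le> v z"
  shows "m \<le> k"
proof -
  have "has_circle_mean (\<lambda>z. if z \<in> S then v z else u z) r m"
    by (rule has_circle_mean_spike[OF assms(1,3,4)]) auto
  then show ?thesis
    by (rule has_circle_mean_le[OF _ assms(2,3)]) (use assms in auto)
qed

text \<open>Without integrability the mean is the junk value \<open>0\<close>, so the bound persists.\<close>

lemma circle_mean_le_except:
  assumes "has_circle_mean v r k" "r > 0" "finite S"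
    and "\<And>z. norm z = r \<Longrightarrow> z \<notin> S \<Longrightarrow> u z \<le> v z"
    and "\<And>z. norm z = r \<Longrightarrow> z \<notin> S \<Longrightarrow> 0 \<le> v z"
  shows "circle_mean u r \<le> k"
proof (cases "(\<lambda>\<theta>. u (rcis r \<theta>)) integrable_on {0..2*pi}")
  case True
  then have "has_circle_mean u r (circle_mean u r)"
    by (simp add: has_circle_mean_circle_mean_iff)
  then show ?thesis
    by (rule has_circle_mean_le_except[OF _ assms(1,2,3)]) (use assms in auto)
next
  case False
  then have "circle_mean u r = 0"
    by (simp add: circle_mean_def not_integrable_integral)
  moreover have "0 \<le> k"
    by (rule has_circle_mean_le_except[OF has_circle_mean_const[of 0] assms(1,2,3)])
       (use assms in auto)
  ultimately show ?thesis by simp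
qed

lemma circle_mean_mono:
  assumes "continuous_on (sphere 0 r) u" "continuous_on (sphere 0 r) v" "r > 0"
    and "\<And>z. norm z = r \<Longrightarrow> u z \<le> v z"
  shows "circle_mean u r \<le> circle_mean v r"
  using has_circle_mean_le[OF has_circle_mean_continuous has_circle_mean_continuous] assms by simp

lemma circle_mean_nonneg:
  assumes "continuous_on (sphere 0 r) u" "r > 0" and "\<And>z. norm z = r \<Longrightarrow> 0 \<le> u z"
  shows "0 \<le> circle_mean u r"
  using has_circle_mean_le[OF has_circle_mean_const has_circle_mean_continuous, of r u 0] assms by simp

section \<open>The Poisson formula\<close>

text \<open>The Poisson kernel of the disc of radius \<open>R\<close>, without the factor 1/(2 pi),
  which \<open>circle_mean\<close> supplies.\<close>

definition poisson :: "real \<Rightarrow> complex \<Rightarrow> complex \<Rightarrow> real" where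
  "poisson R w z = (R\<^sup>2 - (norm w)\<^sup>2) / (norm (z - w))\<^sup>2"

text \<open>Cauchy's formula for \<open>H\<close> times A / (R^2 - cnj w z). This factor is
  holomorphic near the closed disc, equals 1 at \<open>w\<close>, and turns the Cauchy kernel into
  the Poisson kernel on the circle.\<close>

lemma poisson_holomorphic:
  assumes H: "H holomorphic_on ball 0 R'" and R: "0 < R" "R < R'" and w: "norm w < R"
  shows "has_circle_mean (\<lambda>z. poisson R w z * Re (H z)) R (Re (H w))"
proof -
  define A :: complex where "A = of_real (R\<^sup>2 - (norm w)\<^sup>2)"
  define K where "K = (\<lambda>z. H z * A / (of_real (R\<^sup>2) - cnj w * z))"
  have nz: "of_real (R\<^sup>2) - cnj w * z \<noteq> 0" if "norm z \<le> R" for z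
  proof
    assume "of_real (R\<^sup>2) - cnj w * z = 0"
    then have "norm (of_real (R\<^sup>2) :: complex) = norm (cnj w * z)" by simp
    then have "R\<^sup>2 = norm w * norm z" by (simp add: norm_mult norm_power)
    moreover have "norm w * norm z \<le> norm w * R" using that by (simp add: mult_left_mono)
    moreover have "norm w * R < R * R" using w R by simp
    ultimately show False by (simp add: power2_eq_square)
  qed
  have "K holomorphic_on cball 0 R" unfolding K_def
    by (intro holomorphic_intros holomorphic_on_subset[OF H]) (use R nz in auto)
  from Cauchy_integral_circlepath_simple[OF this, of w] w
  have "((\<lambda>u. K u / (u - w)) has_contour_integral 2 * of_real pi * \<i> * K w) (circlepath 0 R)"
    by simp
  then have "((\<lambda>t. K (0 + R * cis t) / (0 + R * cis t - w) * R * \<i> * cis t) has_integral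
      2 * of_real pi * \<i> * K w) {0..2*pi}"
    unfolding circlepath_def by (subst (asm) has_contour_integral_part_circlepath_iff) auto
  \<comment> \<open>The parametrised integrand is the imaginary unit times the Poisson kernel times
    \<open>H\<close>, so imaginary parts deliver the real part of \<open>H\<close>.\<close>
  then have 1: "((\<lambda>t. Im (K (0 + R * cis t) / (0 + R * cis t - w) * R * \<i> * cis t)) has_integral
      Im (2 * of_real pi * \<i> * K w)) {0..2*pi}"
    using has_integral_linear[OF _ bounded_linear_Im] unfolding o_def by blast
  have A0: "A \<noteq> 0" using w R unfolding A_def of_real_eq_0_iff
    using power_strict_mono[of "norm w" R 2] by simp
  have "K w = H w"
  proof -
    have "of_real (R\<^sup>2) - cnj w * w = A" unfolding A_def
      by (metis complex_norm_square mult.commute of_real_diff of_real_power)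
    then show ?thesis using A0 by (simp add: K_def)
  qed
  moreover have "Im (K (0 + R * cis t) / (0 + R * cis t - w) * R * \<i> * cis t)
      = poisson R w (rcis R t) * Re (H (rcis R t))" for t
  proof -
    define z where "z = rcis R t"
    have nz': "norm z = R" using R by (simp add: z_def)
    then have zw: "z \<noteq> w" using w by auto
    have zz: "of_real (R\<^sup>2) = z * cnj z" using nz' complex_norm_square[of z] by simp
    have "z \<noteq> 0" using nz' R by auto
    have "K z / (z - w) * z = H z * (A * z / ((of_real (R\<^sup>2) - cnj w * z) * (z - w)))"
      by (simp add: K_def)
    also have "(of_real (R\<^sup>2) - cnj w * z) * (z - w) = z * ((z - w) * cnj (z - w))"
      unfolding zz by (simp add: algebra_simps)
    also have "(z - w) * cnj (z - w) = of_real ((norm (z - w))\<^sup>2)"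
      using complex_norm_square[of "z - w"] by simp
    also have "A * z / (z * of_real ((norm (z - w))\<^sup>2)) = of_real (poisson R w z)"
      using \<open>z \<noteq> 0\<close> by (simp add: A_def poisson_def)
    finally have "K z / (z - w) * z = of_real (poisson R w z) * H z" by (simp add: mult.commute)
    then have "Im (\<i> * (K z / (z - w) * z)) = poisson R w z * Re (H z)" by simp
    then show ?thesis unfolding z_def rcis_def by (simp add: mult_ac)
  qed
  ultimately show ?thesis using 1 unfolding has_circle_mean_def by simp
qed

lemma poisson_0: "norm z = R \<Longrightarrow> R > 0 \<Longrightarrow> poisson R 0 z = 1"
  by (simp add: poisson_def)

lemma mean_value_holomorphic:
  assumes H: "H holomorphic_on ball 0 R'" and R: "0 < R" "R < R'"
  shows "has_circle_mean (\<lambda>z. Re (H z)) R (Re (H 0))"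
  by (rule has_circle_mean_cong[OF poisson_holomorphic[OF H R, of 0]])
     (use R poisson_0 in auto)

lemma poisson_const:
  assumes "0 < R" "norm w < R"
  shows "has_circle_mean (poisson R w) R 1"
  using poisson_holomorphic[of "\<lambda>_. 1" "R + 1" R w] assms by simp

lemma Ln_1_minus_holomorphic:
  fixes p :: complex
  shows "(\<lambda>z. Ln (1 - z / p)) holomorphic_on ball 0 (norm p)"
proof (intro holomorphic_intros)
  fix z :: complex assume z: "z \<in> ball 0 (norm p)"
  then have "norm (z / p) < 1" by (cases "p = 0") (auto simp: norm_divide)
  then have "Re (z / p) < 1" using complex_Re_le_cmod[of "z/p"] by linarith
  then show "1 - z / p \<notin> \<real>\<^sub>\<le>\<^sub>0" by (auto simp: complex_nonpos_Reals_iff)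
qed auto

text \<open>On the circle |z - b| equals |R^2 - cnj b z| / R, and the latter vanishes only at the
  reflection \<open>p\<close> of \<open>b\<close>, outside the disc. Its logarithm is therefore the
  real part of a holomorphic function, to be evaluated at \<open>w\<close>.\<close>

lemma poisson_ln_dist:
  assumes "0 < R" "norm w < R" "norm b < R"
  shows "has_circle_mean (\<lambda>z. poisson R w z * ln (norm (z - b))) R
           (ln (norm (of_real (R\<^sup>2) - cnj b * w) / R))"
proof (cases "b = 0")
  case True
  have *: "has_circle_mean (\<lambda>z. ln R * poisson R w z) R (ln R * 1)"
    by (intro has_circle_mean_cmult poisson_const assms)
  have "has_circle_mean (\<lambda>z. poisson R w z * ln (norm (z - b))) R (ln R * 1)"
    by (rule has_circle_mean_cong[OF * assms(1)]) (use True in auto)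
  then show ?thesis
    using True assms by (simp add: norm_power power2_eq_square norm_mult)
next
  case False
  define p where "p = of_real (R\<^sup>2) / cnj b"
  have np: "norm p = R\<^sup>2 / norm b" by (simp add: p_def norm_divide norm_power)
  have p: "norm p > R" using assms False by (simp add: np field_simps power2_eq_square)
  have p0: "p \<noteq> 0" using p assms by auto
  have *: "has_circle_mean (\<lambda>z. poisson R w z * Re (Ln (1 - z / p) + of_real (ln R))) R
       (Re (Ln (1 - w / p) + of_real (ln R)))"
    by (rule poisson_holomorphic[of _ "norm p"])
       (use assms p in \<open>auto intro!: holomorphic_intros Ln_1_minus_holomorphic\<close>)
  have key: "Re (Ln (1 - z / p) + of_real (ln R)) = ln (norm (of_real (R\<^sup>2) - cnj b * z) / R)"
    if "norm z \<le> R" for z :: complex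
  proof -
    have nz: "1 - z / p \<noteq> 0" using that p p0 by auto
    have "of_real (R\<^sup>2) - cnj b * z = of_real (R\<^sup>2) * (1 - z / p)"
      using assms False by (simp add: p_def field_simps)
    then have "norm (of_real (R\<^sup>2) - cnj b * z) = R\<^sup>2 * norm (1 - z / p)"
      by (metis abs_of_nonneg norm_mult norm_of_real zero_le_power2)
    then have "norm (of_real (R\<^sup>2) - cnj b * z) / R = R * norm (1 - z / p)"
      using assms by (simp add: power2_eq_square)
    then show ?thesis using nz assms by (simp add: ln_mult)
  qed
  have key2: "norm (of_real (R\<^sup>2) - cnj b * z) / R = norm (z - b)" if "norm z = R" for z
  proof -
    have "of_real (R\<^sup>2) - cnj b * z = z * cnj (z - b)"
      using complex_norm_square[of z] that by (simp add: algebra_simps)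
    then have "norm (of_real (R\<^sup>2) - cnj b * z) = R * norm (z - b)"
      using that by (metis complex_mod_cnj norm_mult)
    then show ?thesis using assms by simp
  qed
  have "has_circle_mean (\<lambda>z. poisson R w z * ln (norm (z - b))) R
       (Re (Ln (1 - w / p) + of_real (ln R)))"
    by (rule has_circle_mean_cong[OF *]) (use assms key key2 in auto)
  then show ?thesis using key[of w] assms by simp
qed

text \<open>Up to a constant, 1 / |z - p|^2 on the circle is the Poisson kernel at the reflection
  \<open>w\<close> of \<open>p\<close>, whose mean is 1.\<close>

lemma mean_inverse_dist_square:
  assumes "0 < r" "r < norm p"
  shows "has_circle_mean (\<lambda>z. 1 / (norm (z - p))\<^sup>2) r (1 / ((norm p)\<^sup>2 - r\<^sup>2))"
proof -
  define w where "w = of_real (r\<^sup>2) / cnj p"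
  have p0: "norm p > 0" using assms by linarith
  have nw: "norm w = r\<^sup>2 / norm p" by (simp add: w_def norm_divide norm_power)
  have wr: "norm w < r" using assms p0 by (simp add: nw field_simps power2_eq_square)
  have d: "(norm p)\<^sup>2 - r\<^sup>2 > 0" using assms by (simp add: power_strict_mono)
  have "has_circle_mean (\<lambda>z. 1 / ((norm p)\<^sup>2 - r\<^sup>2) * poisson r w z) r (1 / ((norm p)\<^sup>2 - r\<^sup>2) * 1)"
    by (intro has_circle_mean_cmult poisson_const assms wr)
  then have 1: "has_circle_mean (\<lambda>z. 1 / ((norm p)\<^sup>2 - r\<^sup>2) * poisson r w z) r (1 / ((norm p)\<^sup>2 - r\<^sup>2))"
    by simp
  show ?thesis
  proof (rule has_circle_mean_cong[OF 1 assms(1)])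
    fix z :: complex assume z: "norm z = r"
    have "z \<noteq> p" using z assms by auto
    have "(z - w) * cnj p = z * cnj (p - z)"
      using complex_norm_square[of z] z p0 by (simp add: w_def algebra_simps)
    then have "norm (z - w) * norm p = r * norm (p - z)"
      using z by (metis complex_mod_cnj norm_mult)
    then have nzw: "norm (z - w) = r * norm (z - p) / norm p"
      using p0 by (simp add: field_simps norm_minus_commute)
    have "poisson r w z = ((norm p)\<^sup>2 - r\<^sup>2) / (norm (z - p))\<^sup>2"
      unfolding poisson_def nzw nw using p0 assms(1) \<open>z \<noteq> p\<close>
      by (simp add: field_simps power2_eq_square)
    then show "1 / ((norm p)\<^sup>2 - r\<^sup>2) * poisson r w z = 1 / (norm (z - p))\<^sup>2"
      using d by simp
  qed
qed

section \<open>Means of logarithmic and power kernels\<close>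

lemma mean_ln_dist_outside:
  fixes p :: complex
  assumes "0 < r" "r < norm p"
  shows "has_circle_mean (\<lambda>z. ln (norm (z - p))) r (ln (norm p))"
proof -
  have p0: "p \<noteq> 0" using assms by auto
  have 1: "has_circle_mean (\<lambda>z. Re (Ln (1 - z / p) + of_real (ln (norm p)))) r
     (Re (Ln (1 - 0 / p) + of_real (ln (norm p))))"
    by (rule mean_value_holomorphic[of _ "norm p"])
       (use assms in \<open>auto intro!: holomorphic_intros Ln_1_minus_holomorphic\<close>)
  have 2: "Re (Ln (1 - z / p) + of_real (ln (norm p))) = ln (norm (z - p))" if "norm z = r" for z :: complex
  proof -
    have nz: "1 - z / p \<noteq> 0" using that assms p0 by auto
    have "norm (z - p) = norm p * norm (1 - z / p)"
      using p0 by (simp add: norm_mult[symmetric] right_diff_distrib norm_minus_commute)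
    then show ?thesis using nz p0 by (simp add: ln_mult)
  qed
  show ?thesis using has_circle_mean_cong[OF 1 assms(1) 2] by simp
qed

text \<open>The singularity lies on the circle. It is approached radially from outside by the points
  \<open>P k\<close>, for which the mean is known; the distances decrease with \<open>k\<close>, so
  monotone convergence passes to the limit.\<close>

lemma mean_ln_dist_on:
  fixes p :: complex
  assumes "0 < r" "norm p = r"
  shows "has_circle_mean (\<lambda>z. ln (norm (z - p))) r (ln r)"
proof -
  define s where "s = (\<lambda>k::nat. 1 + 1 / real (Suc k))"
  define P where "P = (\<lambda>k. of_real (s k) * p)"
  define u where "u = (\<lambda>z. ln (norm (z - p)))"
  \<comment> \<open>At z = p the logarithms tend to minus infinity; the value 0 there restores
    pointwise convergence and changes no integral.\<close>
  define v where "v = (\<lambda>k z. if z = p then 0 else ln (norm (z - P k)))"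
  have s1: "s k > 1" for k by (simp add: s_def)
  have sdec: "s (Suc k) \<le> s k" for k by (simp add: s_def field_simps)
  have nP: "norm (P k) = s k * r" for k using s1[of k] assms by (simp add: P_def norm_mult)
  have m: "has_circle_mean (v k) r (ln (s k * r))" for k
  proof (rule has_circle_mean_spike[of "\<lambda>z. ln (norm (z - P k))" _ _ "{p}"])
    show "has_circle_mean (\<lambda>z. ln (norm (z - P k))) r (ln (s k * r))"
      using mean_ln_dist_outside[of r "P k"] nP[of k] s1[of k] assms by simp
  qed (use assms in \<open>auto simp: v_def\<close>)
  \<comment> \<open>For x at least 1 the distance |z - x p| increases with x, because Re (z cnj p)
    is at most r^2 and any two of the numbers \<open>s k\<close> add up to more than 2.\<close>
  have mono: "norm (z - P (Suc k)) \<le> norm (z - P k)" if "norm z = r" for z :: complex and k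
  proof -
    have e: "(norm (z - of_real x * p))\<^sup>2 = r\<^sup>2 + x\<^sup>2 * r\<^sup>2 - 2 * x * Re (z * cnj p)" for x
    proof -
      have z2: "r\<^sup>2 = (Re z)\<^sup>2 + (Im z)\<^sup>2" using that cmod_power2[of z] by simp
      have p2: "r\<^sup>2 = (Re p)\<^sup>2 + (Im p)\<^sup>2" using assms(2) cmod_power2[of p] by simp
      have "(norm (z - of_real x * p))\<^sup>2 = ((Re z)\<^sup>2 + (Im z)\<^sup>2) + x\<^sup>2 * ((Re p)\<^sup>2 + (Im p)\<^sup>2)
          - 2 * x * Re (z * cnj p)"
        unfolding cmod_power2 by (simp add: power2_eq_square algebra_simps)
      then show ?thesis unfolding z2[symmetric] p2[symmetric] .
    qed
    have "Re (z * cnj p) \<le> r\<^sup>2"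
      using complex_Re_le_cmod[of "z * cnj p"] that assms by (simp add: norm_mult power2_eq_square)
    then have "2 * (s k - s (Suc k)) * Re (z * cnj p) \<le> 2 * (s k - s (Suc k)) * r\<^sup>2"
      using sdec[of k] by (intro mult_left_mono) auto
    also have "\<dots> \<le> (s k - s (Suc k)) * (s k + s (Suc k)) * r\<^sup>2"
      using sdec[of k] s1[of k] s1[of "Suc k"]
      by (intro mult_right_mono, subst mult.commute[of 2], intro mult_left_mono) auto
    finally have "(norm (z - P (Suc k)))\<^sup>2 \<le> (norm (z - P k))\<^sup>2"
      unfolding P_def e by (simp add: algebra_simps power2_eq_square)
    then show ?thesis by (simp add: power2_le_iff_abs_le)
  qed
  have zP: "z \<noteq> P k" if "norm z = r" for z :: complex and k
    using that nP[of k] s1[of k] assms by auto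
  have "(\<lambda>\<theta>. (if rcis r \<theta> = p then 0 else u (rcis r \<theta>))) integrable_on {0..2*pi} \<and>
    (\<lambda>k. integral {0..2*pi} (\<lambda>\<theta>. v k (rcis r \<theta>))) \<longlonglongrightarrow>
      integral {0..2*pi} (\<lambda>\<theta>. (if rcis r \<theta> = p then 0 else u (rcis r \<theta>)))"
  proof (rule monotone_convergence_decreasing)
    show "(\<lambda>\<theta>. v k (rcis r \<theta>)) integrable_on {0..2*pi}" for k
      using m[of k] unfolding has_circle_mean_def by blast
    show "v (Suc k) (rcis r \<theta>) \<le> v k (rcis r \<theta>)" for k \<theta>
      using mono[of "rcis r \<theta>" k] zP[of "rcis r \<theta>"] assms by (auto simp: v_def)
    show "(\<lambda>k. v k (rcis r \<theta>)) \<longlonglongrightarrow> (if rcis r \<theta> = p then 0 else u (rcis r \<theta>))" for \<theta>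
    proof (cases "rcis r \<theta> = p")
      case False
      have "s \<longlonglongrightarrow> 1 + 0"
        unfolding s_def by (intro tendsto_intros LIMSEQ_Suc[OF lim_1_over_n])
      then have "(\<lambda>k. ln (norm (rcis r \<theta> - P k))) \<longlonglongrightarrow> ln (norm (rcis r \<theta> - of_real 1 * p))"
        unfolding P_def using False by (intro tendsto_intros) auto
      then show ?thesis using False by (simp add: v_def u_def)
    qed (simp add: v_def)
    have "integral {0..2*pi} (\<lambda>\<theta>. v k (rcis r \<theta>)) = 2 * pi * ln (s k * r)" for k
      using m[of k] unfolding has_circle_mean_def by (rule integral_unique)
    moreover have "\<bar>2 * pi * ln (s k * r)\<bar> \<le> 2 * pi * (\<bar>ln r\<bar> + ln 2)" for k
    proof -
      have "ln (s k * r) = ln (s k) + ln r" using s1[of k] assms by (simp add: ln_mult)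
      moreover have "0 \<le> ln (s k)" using s1[of k] by (auto simp: s_def)
      moreover have "s k \<le> 2" by (simp add: s_def)
      then have "ln (s k) \<le> ln 2" using s1[of k] by (intro ln_mono) auto
      ultimately have "\<bar>ln (s k * r)\<bar> \<le> \<bar>ln r\<bar> + ln 2" using \<open>0 \<le> ln (s k)\<close> by linarith
      then show ?thesis by (simp add: abs_mult)
    qed
    ultimately show "bounded (range (\<lambda>k. integral {0..2*pi} (\<lambda>\<theta>. v k (rcis r \<theta>))))"
      by (intro boundedI[of _ "2 * pi * (\<bar>ln r\<bar> + ln 2)"]) auto
  qed
  then have i: "(\<lambda>\<theta>. (if rcis r \<theta> = p then 0 else u (rcis r \<theta>))) integrable_on {0..2*pi}"
    and l: "(\<lambda>k. integral {0..2*pi} (\<lambda>\<theta>. v k (rcis r \<theta>))) \<longlonglongrightarrow>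
      integral {0..2*pi} (\<lambda>\<theta>. (if rcis r \<theta> = p then 0 else u (rcis r \<theta>)))" by auto
  have "(\<lambda>k. integral {0..2*pi} (\<lambda>\<theta>. v k (rcis r \<theta>))) = (\<lambda>k. 2 * pi * ln (s k * r))"
    using m unfolding has_circle_mean_def by (intro ext integral_unique)
  moreover have "(\<lambda>k. 2 * pi * ln (s k * r)) \<longlonglongrightarrow> 2 * pi * ln ((1 + 0) * r)"
    unfolding s_def using assms by (intro tendsto_intros LIMSEQ_Suc[OF lim_1_over_n]) auto
  ultimately have "integral {0..2*pi} (\<lambda>\<theta>. (if rcis r \<theta> = p then 0 else u (rcis r \<theta>))) = 2 * pi * ln r"
    using LIMSEQ_unique[OF l] by simp
  then have "has_circle_mean (\<lambda>z. if z = p then 0 else u z) r (ln r)"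
    using i unfolding has_circle_mean_def by (simp add: has_integral_integrable_integral)
  then show ?thesis
    by (rule has_circle_mean_spike[of _ _ _ "{p}"]) (use assms in \<open>auto simp: u_def\<close>)
qed

lemma mean_ln_dist:
  fixes p :: complex
  assumes "0 < r"
  shows "has_circle_mean (\<lambda>z. ln (norm (z - p))) r (ln (max r (norm p)))"
proof -
  consider "norm p < r" | "norm p = r" | "r < norm p" by linarith
  then show ?thesis
  proof cases
    case 1
    have "has_circle_mean (\<lambda>z. ln (norm (z - p))) r (ln (norm (of_real (r\<^sup>2) - cnj p * 0) / r))"
      by (rule has_circle_mean_cong[OF poisson_ln_dist[of r 0 p]]) (use assms 1 poisson_0 in auto)
    moreover have "norm (of_real (r\<^sup>2) - cnj p * 0) / r = r"
      using assms by (simp add: norm_power) (simp add: power2_eq_square)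
    ultimately show ?thesis using 1 by (simp add: max_def)
  next
    case 2 then show ?thesis using mean_ln_dist_on[OF assms] by simp
  next
    case 3 then show ?thesis using mean_ln_dist_outside[OF assms] by (simp add: max_def)
  qed
qed

lemma sin_ge_div_pi:
  assumes "0 \<le> t" "t \<le> pi / 2" shows "sin t \<ge> t / pi"
proof (cases "t \<le> pi / 3")
  case True
  show ?thesis
  proof (cases "t = 0")
    case False
    then have "0 < t" using assms by simp
    then obtain x where x: "0 < x" "x < t" "sin t - sin 0 = (t - 0) * cos x"
      using MVT2[of 0 t sin cos] by (auto intro: DERIV_sin)
    have "cos (pi / 3) \<le> cos x" by (rule cos_monotone_0_pi_le) (use x True in auto)
    then have "t * (1/2) \<le> t * cos x" using \<open>0 < t\<close> by (intro mult_left_mono) (auto simp: cos_60)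
    moreover have "t / pi \<le> t * (1/2)" using \<open>0 < t\<close> pi_ge_two by (simp add: field_simps)
    moreover have "sin t = t * cos x" using x by simp
    ultimately show ?thesis by linarith
  qed simp
next
  case False
  have "sin (pi / 6) \<le> sin t" by (rule sin_monotone_2pi_le) (use False assms in auto)
  moreover have "t / pi \<le> 1 / 2" using assms by (simp add: field_simps)
  ultimately show ?thesis unfolding sin_30 by linarith
qed

text \<open>Up to pi/2 the vertical component r sin t suffices; beyond it cos t is not positive and
  the distance is at least r; angles above pi are conjugated. The bound is independent of
  \<open>q\<close>, so the kernel means below are uniform in the pole.\<close>

lemma dist_rcis_ge:
  assumes "0 < r" "0 \<le> t" "t \<le> 2 * pi" "0 \<le> q"
  shows "r * min t (2 * pi - t) / pi \<le> norm (rcis r t - of_real q)"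
proof -
  have A: "r * t / pi \<le> norm (rcis r t - of_real q)" if t: "0 \<le> t" "t \<le> pi" for t
  proof (cases "t \<le> pi / 2")
    case True
    have "r * t / pi \<le> r * sin t"
      using sin_ge_div_pi[OF t(1) True] assms(1) by (simp add: mult_left_mono flip: times_divide_eq_right)
    also have "\<dots> = Im (rcis r t - of_real q)" by simp
    also have "\<dots> \<le> norm (rcis r t - of_real q)"
      using abs_Im_le_cmod[of "rcis r t - of_real q"] by linarith
    finally show ?thesis .
  next
    case False
    have c: "cos t \<le> 0" using False t cos_monotone_0_pi_le[of "pi/2" t] by simp
    have expand: "(r * x - q)\<^sup>2 + (r * y - 0)\<^sup>2 = r\<^sup>2 * (x\<^sup>2 + y\<^sup>2) - 2 * r * q * x + q\<^sup>2" for x y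
      by (simp add: power2_eq_square algebra_simps)
    have "(norm (rcis r t - of_real q))\<^sup>2 = r\<^sup>2 * ((cos t)\<^sup>2 + (sin t)\<^sup>2) - 2 * r * q * cos t + q\<^sup>2"
      unfolding cmod_power2 Re_rcis Im_rcis minus_complex.sel Re_complex_of_real Im_complex_of_real
      by (rule expand)
    then have "(norm (rcis r t - of_real q))\<^sup>2 = r\<^sup>2 - 2 * r * q * cos t + q\<^sup>2"
      by (simp only: sin_cos_squared_add2 mult_1_right)
    moreover have "2 * r * q * cos t \<le> 0" using c assms by (simp add: mult_nonneg_nonpos)
    moreover have "0 \<le> q\<^sup>2" by simp
    ultimately have "r\<^sup>2 \<le> (norm (rcis r t - of_real q))\<^sup>2" by linarith
    then have "r \<le> norm (rcis r t - of_real q)" using assms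
      by (meson norm_ge_zero power2_le_imp_le)
    moreover have "r * t / pi \<le> r" using t assms by (simp add: field_simps)
    ultimately show ?thesis by linarith
  qed
  show ?thesis
  proof (cases "t \<le> pi")
    case True
    then show ?thesis using A[of t] assms by (simp add: min_def)
  next
    case False
    have "norm (rcis r t - of_real q) = norm (cnj (rcis r t - of_real q))"
      by (simp only: complex_mod_cnj)
    also have "cnj (rcis r t - of_real q) = rcis r (2 * pi - t) - of_real q"
      by (simp add: complex_eq_iff cos_diff sin_diff)
    finally show ?thesis using A[of "2*pi-t"] False assms by (simp add: min_def)
  qed
qed


lemma has_integral_reflect_interval:
  fixes f :: "real \<Rightarrow> real"
  assumes "(f has_integral I) {0..a}"
  shows "((\<lambda>x. f (a - x)) has_integral I) {0..a}"
proof -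
  have "((\<lambda>x. f (- 1 *\<^sub>R x + a)) has_integral (1 / \<bar>- 1\<bar> ^ DIM(real)) *\<^sub>R I)
     ((\<lambda>x. (1 / - 1) *\<^sub>R x + - ((1 / - 1) *\<^sub>R a)) ` cbox 0 a)"
    by (rule has_integral_affinity) (use assms in auto)
  moreover have "(\<lambda>x. (1 / - 1) *\<^sub>R x + - ((1 / - 1) *\<^sub>R a)) ` cbox 0 a = {0..a}"
    by (force simp: image_iff)
  ultimately show ?thesis by simp
qed

lemma has_integral_shift_interval:
  fixes f :: "real \<Rightarrow> real"
  assumes "(f has_integral I) {0..b - a}"
  shows "((\<lambda>x. f (x - a)) has_integral I) {a..b}"
proof -
  have "((\<lambda>x. f (1 *\<^sub>R x + - a)) has_integral (1 / \<bar>1\<bar> ^ DIM(real)) *\<^sub>R I)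
     ((\<lambda>x. (1 / 1) *\<^sub>R x + - ((1 / 1) *\<^sub>R - a)) ` cbox 0 (b - a))"
    by (rule has_integral_affinity) (use assms in auto)
  moreover have "(\<lambda>x. (1 / 1) *\<^sub>R x + - ((1 / 1) *\<^sub>R - a)) ` cbox 0 (b - a) = {a..b}"
    by (auto simp: image_add_atLeastAtMost)
  ultimately show ?thesis by simp
qed

text \<open>The distance from a point of the circle to \<open>p\<close> is at least of the order of
  \<open>r\<close> times the angle between them, and t^(-d) is integrable at 0 because d < 1. One
  constant serves for all radii and poles.\<close>

lemma mean_dist_powr_le:
  assumes d: "0 < d" "d < 1"
  obtains C where "C > 0" "\<And>r p. 0 < r \<Longrightarrow> norm p \<noteq> r \<Longrightarrow>
     circle_mean (\<lambda>z. norm (z - p) powr (- d)) r \<le> C * r powr (- d)"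
proof
  define B where "B = (2 * pi) powr (1 - d) / (1 - d)"
  define g where "g = (\<lambda>t. t powr (- d) + (2 * pi - t) powr (- d))"
  have B: "B > 0" using d by (simp add: B_def)
  have hi: "((\<lambda>t. t powr (- d)) has_integral B) {0..2 * pi}"
    using has_integral_powr_from_0[of "- d" "2 * pi"] d by (simp add: B_def)
  have "((\<lambda>t. (2 * pi - t) powr (- d)) has_integral B) {0..2 * pi}"
    by (rule has_integral_reflect_interval[OF hi])
  then have g: "(g has_integral (B + B)) {0..2*pi}"
    unfolding g_def by (intro has_integral_add hi)
  have g0: "g t \<ge> 0" for t by (simp add: g_def)
  define C where "C = pi powr d * (2 * (B + B)) / (2 * pi)"
  show "C > 0" using B by (simp add: C_def)
  fix r :: real and p :: complex assume r: "0 < r" and p: "norm p \<noteq> r"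
  define a where "a = Arg2pi p"
  have a: "0 \<le> a" "a < 2 * pi" using Arg2pi[of p] by (auto simp: a_def)
  have pa: "p = rcis (norm p) a" unfolding a_def rcis_def cis_conv_exp by (rule Arg2pi_eq)
  have key: "norm (rcis r \<theta> - p) powr (- d) \<le> (r / pi) powr (- d) * g \<bar>\<theta> - a\<bar>"
    if t: "\<theta> \<in> {0..2*pi}" and ne: "\<theta> \<noteq> a" "\<theta> \<noteq> a + 2 * pi" for \<theta>
  proof -
    define t where "t = \<bar>\<theta> - a\<bar>"
    have t1: "0 < t" "t < 2 * pi" using t a ne by (auto simp: t_def)
    have "rcis r \<theta> - p = cis a * (rcis r (\<theta> - a) - of_real (norm p))"
      by (subst pa) (simp add: rcis_def right_diff_distrib cis_mult mult.left_commute mult.commute)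
    then have e: "norm (rcis r \<theta> - p) = norm (rcis r (\<theta> - a) - of_real (norm p))"
      by (simp add: norm_mult)
    have "\<dots> = norm (rcis r t - of_real (norm p))"
    proof (cases "\<theta> \<ge> a")
      case False
      have "rcis r t - of_real (norm p) = cnj (rcis r (\<theta> - a) - of_real (norm p))"
        using False by (simp add: t_def complex_eq_iff cos_diff sin_diff algebra_simps)
      then show ?thesis by (simp only: complex_mod_cnj)
    qed (simp add: t_def)
    with e dist_rcis_ge[OF r, of t "norm p"] t1
    have l: "r * min t (2 * pi - t) / pi \<le> norm (rcis r \<theta> - p)" by simp
    have m0: "0 < min t (2 * pi - t)" using t1 by simp
    have "norm (rcis r \<theta> - p) powr (- d) \<le> (r * min t (2 * pi - t) / pi) powr (- d)"
      by (rule powr_mono2') (use l m0 r d in auto)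
    also have "\<dots> = (r / pi) powr (- d) * min t (2 * pi - t) powr (- d)"
      using m0 r by (simp add: powr_mult[symmetric])
    also have "\<dots> \<le> (r / pi) powr (- d) * g t"
      by (intro mult_left_mono) (auto simp: g_def min_def)
    finally show ?thesis unfolding t_def .
  qed
  have gi: "g integrable_on {0..x}" "integral {0..x} g \<le> B + B" if "0 \<le> x" "x \<le> 2 * pi" for x
  proof -
    show *: "g integrable_on {0..x}"
      by (rule integrable_subinterval_real[OF has_integral_integrable[OF g]]) (use that in auto)
    have "integral {0..x} g \<le> integral {0..2*pi} g"
      by (rule integral_subset_le) (use that * g g0 in auto)
    then show "integral {0..x} g \<le> B + B" using g by (simp add: integral_unique)
  qed
  define G where "G = (\<lambda>\<theta>. g \<bar>\<theta> - a\<bar>)"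
  have "((\<lambda>\<theta>. g (a - \<theta>)) has_integral integral {0..a} g) {0..a}"
    by (rule has_integral_reflect_interval) (use gi(1)[of a] a in auto)
  then have G1: "(G has_integral integral {0..a} g) {0..a}"
    by (rule has_integral_eq[rotated]) (auto simp: G_def)
  have "((\<lambda>\<theta>. g (\<theta> - a)) has_integral integral {0..2*pi-a} g) {a..2*pi}"
    by (rule has_integral_shift_interval) (use gi(1)[of "2*pi-a"] a in auto)
  then have G2: "(G has_integral integral {0..2*pi-a} g) {a..2*pi}"
    by (rule has_integral_eq[rotated]) (auto simp: G_def)
  have G: "(G has_integral (integral {0..a} g + integral {0..2*pi-a} g)) {0..2*pi}"
    by (rule has_integral_combine[OF _ _ G1 G2]) (use a in auto)
  have F: "has_circle_mean (\<lambda>z. norm (z - p) powr (- d)) r (circle_mean (\<lambda>z. norm (z - p) powr (- d)) r)"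
    by (rule has_circle_mean_continuous) (use r p in \<open>auto intro!: continuous_intros\<close>)
  \<comment> \<open>Since \<open>0 powr (- d)\<close> is 0 in HOL, the majorant \<open>G\<close> is
    too small at the angles whose distance from \<open>a\<close> is 0 or 2 pi; \<open>f\<close>
    vanishes there.\<close>
  define f where "f = (\<lambda>\<theta>. if \<theta> \<in> {a, a + 2 * pi} then 0 else norm (rcis r \<theta> - p) powr (- d))"
  have "(f has_integral 2 * pi * circle_mean (\<lambda>z. norm (z - p) powr (- d)) r) {0..2*pi}"
    by (rule has_integral_spike_finite[OF _ _ F[unfolded has_circle_mean_def], of "{a, a + 2*pi}"])
       (auto simp: f_def)
  then have "2 * pi * circle_mean (\<lambda>z. norm (z - p) powr (- d)) r
     \<le> (r / pi) powr (- d) * (integral {0..a} g + integral {0..2*pi-a} g)"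
  proof (rule has_integral_le)
    show "((\<lambda>\<theta>. (r / pi) powr (- d) * G \<theta>) has_integral
        (r / pi) powr (- d) * (integral {0..a} g + integral {0..2*pi-a} g)) {0..2*pi}"
      by (intro has_integral_mult_right G)
    show "f \<theta> \<le> (r / pi) powr (- d) * G \<theta>" if "\<theta> \<in> {0..2*pi}" for \<theta>
      using key[OF that] g0 that a by (auto simp: f_def G_def)
  qed
  also have "\<dots> \<le> (r / pi) powr (- d) * ((B + B) + (B + B))"
    by (intro mult_left_mono add_mono gi(2)) (use a in auto)
  also have "(r / pi) powr (- d) = r powr (- d) * pi powr d"
    using r by (simp add: powr_divide powr_minus field_simps)
  finally show "circle_mean (\<lambda>z. norm (z - p) powr (- d)) r \<le> C * r powr (- d)"
    by (simp add: C_def field_simps)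
qed

section \<open>Iterated circle means of continuous kernels\<close>

lemma circle_mean_swap:
  assumes c: "continuous_on (sphere 0 r \<times> sphere 0 R) (\<lambda>x. F (fst x) (snd x))" and "r \<ge> 0" "R \<ge> 0"
  shows "circle_mean (\<lambda>z. circle_mean (F z) R) r = circle_mean (\<lambda>w. circle_mean (\<lambda>z. F z w) r) R"
proof -
  have "continuous_on (cbox (0, 0) (2*pi, 2*pi))
      (\<lambda>x. F (fst (rcis r (fst x), rcis R (snd x))) (snd (rcis r (fst x), rcis R (snd x))))"
    by (rule continuous_on_compose2[OF c])
       (use assms(2,3) in \<open>auto intro!: continuous_intros simp del: cbox_interval\<close>)
  then have "continuous_on (cbox (0, 0) (2*pi, 2*pi)) (\<lambda>(s, t). F (rcis r s) (rcis R t))"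
    by (simp add: case_prod_unfold)
  from integral_swap_continuous[OF this] show ?thesis
    unfolding circle_mean_def by (simp add: mult.commute)
qed

lemma continuous_on_circle_mean:
  assumes c: "continuous_on (A \<times> sphere 0 R) (\<lambda>x. F (fst x) (snd x))" and "R \<ge> 0"
  shows "continuous_on A (\<lambda>z. circle_mean (F z) R)"
proof -
  have "continuous_on (A \<times> cbox 0 (2*pi)) (\<lambda>x. F (fst (fst x, rcis R (snd x))) (snd (fst x, rcis R (snd x))))"
    by (rule continuous_on_compose2[OF c])
       (use assms(2) in \<open>auto intro!: continuous_intros simp del: cbox_interval\<close>)
  then have c': "continuous_on (A \<times> cbox 0 (2*pi)) (\<lambda>(z, t). F z (rcis R t))"
    by (simp add: case_prod_unfold)
  have "continuous_on A (\<lambda>z. integral (cbox 0 (2*pi)) (\<lambda>t. F z (rcis R t)))"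
    by (rule integral_continuous_on_param[OF c'])
  then show ?thesis unfolding circle_mean_def
    by (intro continuous_intros) auto
qed

section \<open>Nonzero entire functions\<close>

text \<open>The zero function is excluded because \<open>zorder\<close> is the vanishing order only
  for functions that do not vanish identically.\<close>

definition nz_entire :: "(complex \<Rightarrow> complex) \<Rightarrow> bool" where
  "nz_entire h \<longleftrightarrow> h holomorphic_on UNIV \<and> (\<exists>z. h z \<noteq> 0)"

definition nonzero_locus_finite :: "(complex \<Rightarrow> int) \<Rightarrow> bool" where
  "nonzero_locus_finite \<mu> \<longleftrightarrow> (\<forall>r. finite {z. norm z \<le> r \<and> \<mu> z \<noteq> 0})"

lemma nz_entire_holomorphic: "nz_entire h \<Longrightarrow> h holomorphic_on S"
  unfolding nz_entire_def using holomorphic_on_subset by blast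

lemma nz_entire_analytic: "nz_entire h \<Longrightarrow> h analytic_on S"
  unfolding nz_entire_def using analytic_on_open analytic_on_subset by blast

lemma nz_entire_continuous: "nz_entire h \<Longrightarrow> continuous_on S h"
  using nz_entire_holomorphic holomorphic_on_imp_continuous_on by blast

lemma nz_entire_eventually: "nz_entire h \<Longrightarrow> eventually (\<lambda>w. h w \<noteq> 0) (at z)"
  using non_zero_neighbour_alt[of h UNIV z] unfolding nz_entire_def by auto

lemma nz_entire_frequently: "nz_entire h \<Longrightarrow> frequently (\<lambda>w. h w \<noteq> 0) (at z)"
  by (intro eventually_frequently nz_entire_eventually) auto

lemma nz_entire_mult: "nz_entire f \<Longrightarrow> nz_entire h \<Longrightarrow> nz_entire (\<lambda>z. f z * h z)"
proof -
  assume a: "nz_entire f" "nz_entire h"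
  have "eventually (\<lambda>w. f w * h w \<noteq> 0) (at 0)"
    using nz_entire_eventually[OF a(1), of 0] nz_entire_eventually[OF a(2), of 0] by eventually_elim auto
  then have "\<exists>w. f w * h w \<noteq> 0" using eventually_happens[of _ "at (0::complex)"] by auto
  then show ?thesis using a unfolding nz_entire_def by (auto intro!: holomorphic_intros)
qed

lemma nz_entire_prod: "(\<And>i. i \<in> I \<Longrightarrow> nz_entire (f i)) \<Longrightarrow> nz_entire (\<lambda>z. \<Prod>i\<in>I. f i z)"
proof (induction I rule: infinite_finite_induct)
  case (insert i I)
  then show ?case by (auto intro: nz_entire_mult)
qed (auto simp: nz_entire_def)

lemma nz_entire_shift: "nz_entire h \<Longrightarrow> nz_entire (\<lambda>z. h (z + a))"
proof -
  assume h: "nz_entire h"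
  then obtain z where "h z \<noteq> 0" by (auto simp: nz_entire_def)
  then have "h ((z - a) + a) \<noteq> 0" by simp
  moreover have "(h \<circ> (\<lambda>z. z + a)) holomorphic_on UNIV"
    by (rule holomorphic_on_compose) (auto intro!: holomorphic_intros nz_entire_holomorphic[OF h])
  ultimately show ?thesis unfolding nz_entire_def o_def by blast
qed

lemma zorder_nonneg: "nz_entire h \<Longrightarrow> 0 \<le> zorder h z"
  by (rule zorder_ge_0[OF nz_entire_analytic nz_entire_frequently])

lemma zorder_nonzero_iff: "nz_entire h \<Longrightarrow> zorder h z \<noteq> 0 \<longleftrightarrow> h z = 0"
  using zorder_eq_0_iff[OF nz_entire_analytic nz_entire_frequently] by blast

lemma zorder_mult_entire:
  "nz_entire f \<Longrightarrow> nz_entire h \<Longrightarrow> zorder (\<lambda>z. f z * h z) z = zorder f z + zorder h z"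
  by (rule zorder_times_analytic[OF nz_entire_analytic nz_entire_analytic
        nz_entire_eventually[OF nz_entire_mult]])

lemma zorder_shift_arg: "zorder (\<lambda>z. h (z + a)) z = zorder h (z + a)"
  using zorder_shift[of "\<lambda>z. h (z + a)" z] zorder_shift[of h "z + a"] by (simp add: add.assoc)

lemma finite_zeros_cball:
  assumes "nz_entire h" shows "finite {z. norm z \<le> r \<and> h z = 0}"
proof (cases "\<exists>z. h z = 0")
  case True
  have "\<not> h constant_on UNIV"
    using True assms unfolding constant_on_def nz_entire_def by (metis UNIV_I)
  from holomorphic_compact_finite_zeros[OF nz_entire_holomorphic[OF assms] _ _ compact_cball[of 0 r] _ this]
  have "finite {z \<in> cball 0 r. h z = 0}" by auto
  then show ?thesis by (rule rev_finite_subset) auto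
qed auto

lemma zorder_locus_finite: "nz_entire h \<Longrightarrow> nonzero_locus_finite (zorder h)"
  unfolding nonzero_locus_finite_def using finite_zeros_cball by (simp add: zorder_nonzero_iff)

lemma nz_entire_linear_power: "nz_entire (\<lambda>z. (z - b) ^ m)"
  unfolding nz_entire_def by (intro conjI exI[of _ "b + 1"] holomorphic_intros) simp

lemma zorder_linear_power: "zorder (\<lambda>z. (z - b) ^ m) z = (if z = b then int m else 0)"
proof (cases "z = b")
  case True
  show ?thesis unfolding True
    using zorder_eqI[of UNIV b "\<lambda>_. 1" "\<lambda>z. (z - b) ^ m" "int m"] by simp
next
  case False
  have "zorder (\<lambda>z. (z - b) ^ m) z = 0"
    by (rule zorder_eq_0I[OF nz_entire_analytic[OF nz_entire_linear_power]]) (use False in auto)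
  then show ?thesis using False by simp
qed

text \<open>Dividing out the zeros in the closed disc leaves a function without zeros on a slightly
  larger disc, which has a holomorphic logarithm. The larger disc is needed since the mean value
  formulas require holomorphy beyond the circle.\<close>

lemma entire_factorization:
  assumes h: "nz_entire h" and R: "0 < R"
  obtains R' H where "R < R'" "H holomorphic_on ball 0 R'"
    "\<And>z. z \<in> ball 0 R' \<Longrightarrow> h z = exp (H z) * (\<Prod>b | norm b \<le> R \<and> h b = 0. (z - b) ^ nat (zorder h b))"
proof -
  define Z where "Z = {b. norm b \<le> R \<and> h b = 0}"
  have fZ: "finite Z" unfolding Z_def by (rule finite_zeros_cball[OF h])
  define Y where "Y = {b. norm b \<le> R + 1 \<and> h b = 0} - Z"
  have fY: "finite Y" unfolding Y_def using finite_zeros_cball[OF h] by auto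
  \<comment> \<open>Only finitely many zeros have modulus in (R, R + 1], so the open disc reaching
    to the nearest of them contains no zero outside \<open>Z\<close>.\<close>
  define R' where "R' = Min (insert (R + 1) (norm ` Y))"
  have "R < R'" unfolding R'_def using fY by (auto simp: Y_def Z_def)
  have R'1: "R' \<le> R + 1" unfolding R'_def using fY by auto
  have R'2: "R' \<le> norm b" if "b \<in> Y" for b unfolding R'_def using fY that by auto
  have zin: "b \<in> Z" if "h b = 0" "norm b < R'" for b
    using that R'1 R'2[of b] unfolding Y_def by fastforce
  define f where "f = (\<lambda>z. \<Prod>b\<in>Z. (z - b) ^ nat (zorder h b))"
  have ef: "nz_entire f" unfolding f_def by (intro nz_entire_prod nz_entire_linear_power)
  have zf: "zorder f z = (if z \<in> Z then zorder h z else 0)" for z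
  proof -
    have "zorder f z = (\<Sum>b\<in>Z. zorder (\<lambda>z. (z - b) ^ nat (zorder h b)) z)"
      unfolding f_def
      by (rule zorder_prod_analytic[OF nz_entire_analytic[OF nz_entire_linear_power]])
         (rule nz_entire_eventually[OF ef, unfolded f_def])
    also have "\<dots> = (\<Sum>b\<in>Z. if z = b then zorder h b else 0)"
      by (intro sum.cong) (auto simp: zorder_linear_power zorder_nonneg[OF h])
    also have "\<dots> = (if z \<in> Z then zorder h z else 0)" using fZ by simp
    finally show ?thesis .
  qed
  have zz: "zorder f z = zorder h z" if "z \<in> ball 0 R'" for z
    using zf[of z] zin[of z] that zorder_nonzero_iff[OF h, of z] by auto
  have iff: "f z = 0 \<longleftrightarrow> h z = 0" if "z \<in> ball 0 R'" for z
    using zz[OF that] zorder_nonzero_iff[OF h, of z] zorder_nonzero_iff[OF ef, of z] by auto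
  obtain k where k: "k holomorphic_on ball 0 R'" "\<And>z. z \<in> ball 0 R' \<Longrightarrow> k z \<noteq> 0"
    "\<And>z. z \<in> ball 0 R' \<Longrightarrow> h z = k z * f z"
    using holomorphic_zorder_factorization[OF nz_entire_holomorphic[OF h] open_ball connected_ball
        nz_entire_holomorphic[OF ef] iff zz] by metis
  obtain H where H: "H holomorphic_on ball 0 R'" "\<And>z. z \<in> ball 0 R' \<Longrightarrow> k z = exp (H z)"
    using contractible_imp_holomorphic_log[OF k(1) convex_imp_contractible[OF convex_ball] k(2)] by metis
  show ?thesis
    by (rule that[OF \<open>R < R'\<close> H(1)]) (use k(3) H(2) in \<open>auto simp: f_def Z_def\<close>)
qed

lemma ln_norm_factorization:
  assumes h: "nz_entire h" and R: "0 < R"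
  obtains R' H where "R < R'" "H holomorphic_on ball 0 R'"
    "\<And>z. norm z < R' \<Longrightarrow> h z \<noteq> 0 \<Longrightarrow> ln (norm (h z)) =
       Re (H z) + (\<Sum>b | norm b \<le> R \<and> h b = 0. real_of_int (zorder h b) * ln (norm (z - b)))"
proof -
  obtain R' H where *: "R < R'" "H holomorphic_on ball 0 R'"
    "\<And>z. z \<in> ball 0 R' \<Longrightarrow> h z = exp (H z) * (\<Prod>b | norm b \<le> R \<and> h b = 0. (z - b) ^ nat (zorder h b))"
    using entire_factorization[OF assms] by blast
  show ?thesis
  proof (rule that[OF *(1,2)])
    fix z assume z: "norm z < R'" "h z \<noteq> 0"
    define Z where "Z = {b. norm b \<le> R \<and> h b = 0}"
    have fZ: "finite Z" unfolding Z_def by (rule finite_zeros_cball[OF h])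
    have zb: "z \<noteq> b" if "b \<in> Z" for b using that z by (auto simp: Z_def)
    have "norm (h z) = exp (Re (H z)) * (\<Prod>b\<in>Z. norm (z - b) ^ nat (zorder h b))"
      using *(3)[of z] z by (simp add: norm_mult Z_def prod_norm[symmetric] norm_power)
    moreover have "(\<Prod>b\<in>Z. norm (z - b) ^ nat (zorder h b)) > 0"
      using zb by (auto intro!: prod_pos)
    ultimately have "ln (norm (h z)) = Re (H z) + ln (\<Prod>b\<in>Z. norm (z - b) ^ nat (zorder h b))"
      by (simp add: ln_mult)
    also have "ln (\<Prod>b\<in>Z. norm (z - b) ^ nat (zorder h b)) = (\<Sum>b\<in>Z. ln (norm (z - b) ^ nat (zorder h b)))"
      by (rule ln_prod[OF fZ]) (use zb in auto)
    also have "\<dots> = (\<Sum>b\<in>Z. real_of_int (zorder h b) * ln (norm (z - b)))"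
      using zorder_nonneg[OF h] zb by (intro sum.cong) (auto simp: ln_realpow of_nat_nat)
    finally show "ln (norm (h z)) =
       Re (H z) + (\<Sum>b | norm b \<le> R \<and> h b = 0. real_of_int (zorder h b) * ln (norm (z - b)))"
      by (simp add: Z_def)
  qed
qed

section \<open>Counting functions\<close>

text \<open>Modulo a constant, \<open>counting \<mu> r\<close> is this sum for \<open>r \<ge> 1\<close>; the cut-off at \<open>1\<close> avoids a
  special role of the origin.\<close>

definition log_count :: "(complex \<Rightarrow> int) \<Rightarrow> real \<Rightarrow> real" where
  "log_count \<mu> r = (\<Sum>z | norm z \<le> r \<and> \<mu> z \<noteq> 0. real_of_int (\<mu> z) * ln (r / max 1 (norm z)))"

text \<open>The weight of a zero of modulus \<open>x\<close> in \<open>log_count\<close>. For r at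
  least 1 it vanishes when x is at least r, so sums may run over any larger finite set; it is also
  the difference of the means of ln |z - b| at radii \<open>r\<close> and 1, where |b| = x.\<close>

definition log_ratio :: "real \<Rightarrow> real \<Rightarrow> real" where
  "log_ratio r x = ln (max r x / max 1 x)"

lemma log_ratio_nonneg: "1 \<le> r \<Longrightarrow> 0 \<le> log_ratio r x"
  unfolding log_ratio_def by (auto simp: max_def)

lemma log_ratio_outside: "1 \<le> r \<Longrightarrow> r \<le> x \<Longrightarrow> log_ratio r x = 0"
  unfolding log_ratio_def by (auto simp: max_def)

lemma log_ratio_inside: "x \<le> r \<Longrightarrow> log_ratio r x = ln (r / max 1 x)"
  unfolding log_ratio_def by (auto simp: max_def)

lemma log_count_eq:
  assumes "finite S" "{z. norm z \<le> r \<and> \<mu> z \<noteq> 0} \<subseteq> S" "1 \<le> r"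
  shows "log_count \<mu> r = (\<Sum>z\<in>S. real_of_int (\<mu> z) * log_ratio r (norm z))"
proof -
  have "log_count \<mu> r = (\<Sum>z | norm z \<le> r \<and> \<mu> z \<noteq> 0. real_of_int (\<mu> z) * log_ratio r (norm z))"
    unfolding log_count_def by (intro sum.cong) (auto simp: log_ratio_inside)
  also have "\<dots> = (\<Sum>z\<in>S. real_of_int (\<mu> z) * log_ratio r (norm z))"
  proof (rule sum.mono_neutral_left[OF assms(1,2)], rule ballI)
    fix z assume "z \<in> S - {z. norm z \<le> r \<and> \<mu> z \<noteq> 0}"
    then have "\<mu> z = 0 \<or> r \<le> norm z" by auto
    then show "real_of_int (\<mu> z) * log_ratio r (norm z) = 0"
      using log_ratio_outside[OF assms(3)] by auto
  qed
  finally show ?thesis .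
qed

lemma log_count_nonneg: "1 \<le> r \<Longrightarrow> (\<And>z. 0 \<le> \<mu> z) \<Longrightarrow> 0 \<le> log_count \<mu> r"
  unfolding log_count_def
  by (intro sum_nonneg mult_nonneg_nonneg) (auto intro!: ln_ge_zero simp: le_divide_eq)

lemma log_count_mono:
  assumes "nonzero_locus_finite \<mu>" "nonzero_locus_finite \<nu>" "1 \<le> r" "\<And>z. \<mu> z \<le> \<nu> z"
  shows "log_count \<mu> r \<le> log_count \<nu> r"
proof -
  define S where "S = {z. norm z \<le> r \<and> \<mu> z \<noteq> 0} \<union> {z. norm z \<le> r \<and> \<nu> z \<noteq> 0}"
  have S: "finite S" using assms(1,2) by (auto simp: S_def nonzero_locus_finite_def)
  show ?thesis
    using log_count_eq[OF S, of r \<mu>] log_count_eq[OF S, of r \<nu>] assms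
    by (auto simp: S_def intro!: sum_mono mult_right_mono log_ratio_nonneg)
qed

lemma log_count_sum:
  assumes "finite I" "\<And>i. i \<in> I \<Longrightarrow> nonzero_locus_finite (\<mu> i)" "1 \<le> r"
  shows "log_count (\<lambda>z. \<Sum>i\<in>I. \<mu> i z) r = (\<Sum>i\<in>I. log_count (\<mu> i) r)"
proof -
  define S where "S = (\<Union>i\<in>I. {z. norm z \<le> r \<and> \<mu> i z \<noteq> 0})"
  have S: "finite S" using assms(1,2) by (auto simp: S_def nonzero_locus_finite_def)
  have 1: "{z. norm z \<le> r \<and> (\<Sum>i\<in>I. \<mu> i z) \<noteq> 0} \<subseteq> S"
    by (auto simp: S_def dest: sum.not_neutral_contains_not_neutral)
  have "(\<Sum>i\<in>I. log_count (\<mu> i) r) = (\<Sum>i\<in>I. \<Sum>z\<in>S. real_of_int (\<mu> i z) * log_ratio r (norm z))"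
    by (intro sum.cong refl log_count_eq S assms) (auto simp: S_def)
  also have "\<dots> = (\<Sum>z\<in>S. real_of_int (\<Sum>i\<in>I. \<mu> i z) * log_ratio r (norm z))"
    by (subst sum.swap) (simp add: sum_distrib_right)
  also have "\<dots> = log_count (\<lambda>z. \<Sum>i\<in>I. \<mu> i z) r"
    by (rule log_count_eq[OF S 1 assms(3), symmetric])
  finally show ?thesis by simp
qed

lemma log_count_cmult:
  "log_count (\<lambda>z. k * \<mu> z) r = real_of_int k * log_count \<mu> r"
  unfolding log_count_def by (cases "k = 0") (auto simp: sum_distrib_left mult.assoc)

text \<open>Each zero of modulus at most \<open>r\<close> enters the log count at \<open>R\<close>
  with weight at least ln (R / r).\<close>

lemma unint_counting_le_log_count:
  assumes "nonzero_locus_finite \<mu>" "\<And>z. 0 \<le> \<mu> z" "1 \<le> r" "r < R"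
  shows "unint_counting \<mu> r * ln (R / r) \<le> log_count \<mu> R"
proof -
  have "unint_counting \<mu> r * ln (R / r) = (\<Sum>z | norm z \<le> r \<and> \<mu> z \<noteq> 0. real_of_int (\<mu> z) * ln (R / r))"
    unfolding unint_counting_def by (simp add: sum_distrib_right)
  also have "\<dots> \<le> (\<Sum>z | norm z \<le> r \<and> \<mu> z \<noteq> 0. real_of_int (\<mu> z) * ln (R / max 1 (norm z)))"
  proof (intro sum_mono mult_left_mono ln_mono)
    fix z assume "z \<in> {z. norm z \<le> r \<and> \<mu> z \<noteq> 0}"
    then have "max 1 (norm z) \<le> r" using assms(3) by simp
    then show "R / r \<le> R / max 1 (norm z)" using assms(3,4) by (intro divide_left_mono) auto
    show "0 \<le> real_of_int (\<mu> z)" using assms(2)[of z] by simp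
  qed (use assms(3,4) in auto)
  also have "\<dots> \<le> log_count \<mu> R"
    unfolding log_count_def
    by (intro sum_mono2) (use assms in \<open>auto simp: nonzero_locus_finite_def intro!: mult_nonneg_nonneg\<close>)
  finally show ?thesis .
qed

lemma unint_counting_nonneg: "(\<And>z. 0 \<le> \<mu> z) \<Longrightarrow> 0 \<le> unint_counting \<mu> r"
  unfolding unint_counting_def by (auto intro!: sum_nonneg)

lemma counting_eq_log_count:
  assumes fin: "nonzero_locus_finite \<mu>"
  obtains K where "\<And>r. 1 \<le> r \<Longrightarrow> counting \<mu> r = log_count \<mu> r + K"
proof
  \<comment> \<open>A zero with 0 < |z| \<le> 1 contributes ln (r / |z|) to \<open>counting\<close>
    but only ln r to \<open>log_count\<close>; \<open>K\<close> collects these differences.\<close>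
  define K where "K = (\<Sum>z | norm z \<le> 1 \<and> \<mu> z \<noteq> 0 \<and> z \<noteq> 0. real_of_int (\<mu> z) * (- ln (norm z)))"
  fix r :: real assume r: "1 \<le> r"
  define S where "S = {z. norm z \<le> r \<and> \<mu> z \<noteq> 0 \<and> z \<noteq> 0}"
  have fS: "finite S" using fin unfolding S_def nonzero_locus_finite_def
    by (rule_tac finite_subset[OF _ spec[of _ r]]) auto
  have u0: "unint_counting \<mu> 0 = real_of_int (\<mu> 0)"
  proof -
    have "{z. norm z \<le> 0 \<and> \<mu> z \<noteq> 0} = (if \<mu> 0 = 0 then {} else {0})" by auto
    then show ?thesis unfolding unint_counting_def by auto
  qed
  have u: "(unint_counting \<mu> t - unint_counting \<mu> 0) / t
      = (\<Sum>z\<in>S. real_of_int (\<mu> z) * (if norm z \<le> t then 1 / t else 0))"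
    if t: "t \<in> {0..r}" for t
  proof -
    have "{z. norm z \<le> t \<and> \<mu> z \<noteq> 0} = {z\<in>S. norm z \<le> t} \<union> {z. norm z \<le> 0 \<and> \<mu> z \<noteq> 0}"
      using t by (auto simp: S_def)
    note split = this
    have "{z\<in>S. norm z \<le> t} \<inter> {z. norm z \<le> 0 \<and> \<mu> z \<noteq> 0} = {}" by (auto simp: S_def)
    moreover have "finite {z::complex. norm z \<le> 0 \<and> \<mu> z \<noteq> 0}"
      using fin unfolding nonzero_locus_finite_def by blast
    moreover have "finite {z\<in>S. norm z \<le> t}" using fS by simp
    ultimately have "unint_counting \<mu> t = (\<Sum>z\<in>{z\<in>S. norm z \<le> t}. real_of_int (\<mu> z)) + unint_counting \<mu> 0"
      unfolding unint_counting_def split by (intro sum.union_disjoint)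
    then have "(unint_counting \<mu> t - unint_counting \<mu> 0) / t = (\<Sum>z\<in>{z\<in>S. norm z \<le> t}. real_of_int (\<mu> z) * (1 / t))"
      by (simp add: sum_divide_distrib)
    also have "\<dots> = (\<Sum>z\<in>S. real_of_int (\<mu> z) * (if norm z \<le> t then 1 / t else 0))"
      using fS by (simp add: sum.inter_filter if_distrib[of "\<lambda>x. _ * x"] cong: if_cong)
    finally show ?thesis .
  qed
  have int1: "((\<lambda>t. if x \<le> t then 1 / t else 0) has_integral (ln r - ln x)) {0..r}"
    if x: "0 < x" "x \<le> r" for x
  proof -
    have "((\<lambda>t. 1 / t) has_integral (ln r - ln x)) {x..r}"
    proof (rule fundamental_theorem_of_calculus[OF x(2)])
      fix t assume "t \<in> {x..r}"
      then show "(ln has_vector_derivative 1 / t) (at t within {x..r})"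
        using x by (auto intro!: derivative_eq_intros simp flip: has_real_derivative_iff_has_vector_derivative)
    qed
    then have "((\<lambda>t. if t \<in> {x..r} then 1 / t else 0) has_integral (ln r - ln x)) {0..r}"
      by (subst has_integral_restrict) (use x in auto)
    then show ?thesis by (rule has_integral_eq[rotated]) auto
  qed
  have "((\<lambda>t. \<Sum>z\<in>S. real_of_int (\<mu> z) * (if norm z \<le> t then 1 / t else 0)) has_integral
      (\<Sum>z\<in>S. real_of_int (\<mu> z) * (ln r - ln (norm z)))) {0..r}"
    by (intro has_integral_sum has_integral_mult_right int1 fS) (auto simp: S_def)
  then have "((\<lambda>t. (unint_counting \<mu> t - unint_counting \<mu> 0) / t) has_integral
      (\<Sum>z\<in>S. real_of_int (\<mu> z) * (ln r - ln (norm z)))) {0..r}"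
    by (rule has_integral_eq[rotated]) (use u in auto)
  then have c: "counting \<mu> r = (\<Sum>z\<in>S. real_of_int (\<mu> z) * (ln r - ln (norm z))) + real_of_int (\<mu> 0) * ln r"
    unfolding counting_def u0 by (simp add: integral_unique)
  have "log_count \<mu> r = (\<Sum>z\<in>insert 0 S. real_of_int (\<mu> z) * log_ratio r (norm z))"
    by (rule log_count_eq) (use fS r in \<open>auto simp: S_def\<close>)
  also have "\<dots> = real_of_int (\<mu> 0) * ln r + (\<Sum>z\<in>S. real_of_int (\<mu> z) * log_ratio r (norm z))"
    using fS r by (subst sum.insert) (auto simp: S_def log_ratio_inside)
  finally have l: "log_count \<mu> r = real_of_int (\<mu> 0) * ln r + (\<Sum>z\<in>S. real_of_int (\<mu> z) * log_ratio r (norm z))" .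
  have "K = (\<Sum>z\<in>S. if norm z \<le> 1 then real_of_int (\<mu> z) * (- ln (norm z)) else 0)"
    unfolding K_def using fS r by (subst sum.inter_filter[symmetric]) (auto simp: S_def intro!: sum.cong)
  then have "log_count \<mu> r + K = real_of_int (\<mu> 0) * ln r + (\<Sum>z\<in>S. real_of_int (\<mu> z) * log_ratio r (norm z)
      + (if norm z \<le> 1 then real_of_int (\<mu> z) * (- ln (norm z)) else 0))"
    unfolding l by (simp add: sum.distrib)
  also have "(\<Sum>z\<in>S. real_of_int (\<mu> z) * log_ratio r (norm z)
      + (if norm z \<le> 1 then real_of_int (\<mu> z) * (- ln (norm z)) else 0))
     = (\<Sum>z\<in>S. real_of_int (\<mu> z) * (ln r - ln (norm z)))"
  proof (intro sum.cong refl)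
    fix z assume z: "z \<in> S"
    then have "log_ratio r (norm z) = ln r - ln (max 1 (norm z))"
      using r by (subst log_ratio_inside) (auto simp: S_def ln_div)
    then show "real_of_int (\<mu> z) * log_ratio r (norm z)
      + (if norm z \<le> 1 then real_of_int (\<mu> z) * (- ln (norm z)) else 0) = real_of_int (\<mu> z) * (ln r - ln (norm z))"
      by (cases "norm z \<le> 1") (simp_all add: max_def right_diff_distrib)
  qed
  finally show "counting \<mu> r = log_count \<mu> r + K" using c by simp
qed

section \<open>Jensen's formula\<close>

text \<open>Normalising at radius 1 instead of at the origin avoids any assumption on h 0.\<close>

lemma jensen:
  assumes h: "nz_entire h" and r: "1 \<le> r"
  shows "has_circle_mean (\<lambda>z. ln (norm (h z))) r
           (circle_mean (\<lambda>z. ln (norm (h z))) 1 + log_count (zorder h) r)"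
proof -
  obtain R' H where H: "r < R'" "H holomorphic_on ball 0 R'" and
    eq: "\<And>z. norm z < R' \<Longrightarrow> h z \<noteq> 0 \<Longrightarrow> ln (norm (h z)) =
       Re (H z) + (\<Sum>b | norm b \<le> r \<and> h b = 0. real_of_int (zorder h b) * ln (norm (z - b)))"
    using ln_norm_factorization[OF h, of r] r by auto
  define Z where "Z = {b. norm b \<le> r \<and> h b = 0}"
  have fZ: "finite Z" unfolding Z_def by (rule finite_zeros_cball[OF h])
  \<comment> \<open>The same factorization is used at every radius up to \<open>r\<close>; comparing
    radii \<open>r\<close> and 1 cancels Re (H 0).\<close>
  have m: "has_circle_mean (\<lambda>z. ln (norm (h z))) s
      (Re (H 0) + (\<Sum>b\<in>Z. real_of_int (zorder h b) * ln (max s (norm b))))" if s: "0 < s" "s \<le> r" for s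
  proof (rule has_circle_mean_spike)
    show "has_circle_mean (\<lambda>z. Re (H z) + (\<Sum>b\<in>Z. real_of_int (zorder h b) * ln (norm (z - b)))) s
       (Re (H 0) + (\<Sum>b\<in>Z. real_of_int (zorder h b) * ln (max s (norm b))))"
      by (intro has_circle_mean_add mean_value_holomorphic[OF H(2)] has_circle_mean_sum
           has_circle_mean_cmult mean_ln_dist) (use s H in auto)
    show "finite Z" by fact
  qed (use s H eq in \<open>auto simp: Z_def\<close>)
  have "log_count (zorder h) r = (\<Sum>b\<in>Z. real_of_int (zorder h b) * log_ratio r (norm b))"
    by (rule log_count_eq[OF fZ _ r]) (auto simp: Z_def zorder_nonzero_iff[OF h])
  also have "\<dots> = (\<Sum>b\<in>Z. real_of_int (zorder h b) * (ln (max r (norm b)) - ln (max 1 (norm b))))"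
    using r by (intro sum.cong) (auto simp: log_ratio_def ln_div)
  also have "\<dots> = (\<Sum>b\<in>Z. real_of_int (zorder h b) * ln (max r (norm b)))
     - (\<Sum>b\<in>Z. real_of_int (zorder h b) * ln (max 1 (norm b)))"
    by (simp add: right_diff_distrib sum_subtractf)
  finally show ?thesis
    using m[of r] circle_mean_eq[OF m[of 1]] r by simp
qed

section \<open>The Poisson--Jensen formula\<close>

text \<open>Green's function of the disc of radius \<open>R\<close> with pole at
  \<open>b\<close>.\<close>

definition green :: "real \<Rightarrow> complex \<Rightarrow> complex \<Rightarrow> real" where
  "green R w b = ln (norm (of_real (R\<^sup>2) - cnj b * w) / (R * norm (w - b)))"

lemma unint_counting_zorder:
  "nz_entire h \<Longrightarrow> unint_counting (zorder h) R = (\<Sum>b | norm b \<le> R \<and> h b = 0. real_of_int (zorder h b))"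
  unfolding unint_counting_def by (simp add: zorder_nonzero_iff)

lemma reflection_nonzero:
  assumes "0 < R" "norm w < R" "norm b \<le> R"
  shows "of_real (R\<^sup>2) - cnj b * w \<noteq> 0"
proof
  assume "of_real (R\<^sup>2) - cnj b * w = 0"
  then have "norm (of_real (R\<^sup>2) :: complex) = norm (cnj b * w)" by simp
  then have "R\<^sup>2 = norm b * norm w" by (simp add: norm_mult norm_power)
  moreover have "norm b * norm w \<le> R * norm w" using assms by (intro mult_right_mono) auto
  moreover have "R * norm w < R * R" using assms by simp
  ultimately show False by (simp add: power2_eq_square)
qed

text \<open>|R^2 - cnj b w|^2 - R^2 |w - b|^2 factors as (R^2 - |w|^2)(R^2 - |b|^2), which is
  nonnegative in the disc.\<close>

lemma green_nonneg:
  assumes "0 < R" "norm w < R" "norm b \<le> R" "w \<noteq> b"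
  shows "0 \<le> green R w b"
proof -
  have "(norm (of_real (R\<^sup>2) - cnj b * w))\<^sup>2 - (R * norm (w - b))\<^sup>2
     = (R\<^sup>2 - (norm w)\<^sup>2) * (R\<^sup>2 - (norm b)\<^sup>2)"
    unfolding power_mult_distrib cmod_power2 by (simp add: power2_eq_square algebra_simps)
  moreover have "0 \<le> (R\<^sup>2 - (norm w)\<^sup>2) * (R\<^sup>2 - (norm b)\<^sup>2)"
    using assms power_mono[of "norm w" R 2] power_mono[of "norm b" R 2] by (intro mult_nonneg_nonneg) auto
  ultimately have "(R * norm (w - b))\<^sup>2 \<le> (norm (of_real (R\<^sup>2) - cnj b * w))\<^sup>2"
    by (metis diff_ge_0_iff_ge)
  then have "R * norm (w - b) \<le> norm (of_real (R\<^sup>2) - cnj b * w)"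
    by (rule power2_le_imp_le) (rule norm_ge_zero)
  moreover have "0 < R * norm (w - b)" using assms by simp
  ultimately show ?thesis unfolding green_def by (intro ln_ge_zero) (simp add: le_divide_eq)
qed

text \<open>Poisson's formula holds exactly for the zero-free part of \<open>h\<close>; for each
  factor z - b the Poisson mean exceeds ln |w - b| by the Green function.\<close>

lemma poisson_jensen:
  assumes h: "nz_entire h" and R: "0 < R" and w: "norm w < R" "h w \<noteq> 0"
    and nz: "\<And>z. norm z = R \<Longrightarrow> h z \<noteq> 0"
  shows "has_circle_mean (\<lambda>z. poisson R w z * ln (norm (h z))) R
    (ln (norm (h w)) + (\<Sum>b | norm b \<le> R \<and> h b = 0. real_of_int (zorder h b) * green R w b))"
proof -
  obtain R' H where H: "R < R'" "H holomorphic_on ball 0 R'" and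
    eq: "\<And>z. norm z < R' \<Longrightarrow> h z \<noteq> 0 \<Longrightarrow> ln (norm (h z)) =
       Re (H z) + (\<Sum>b | norm b \<le> R \<and> h b = 0. real_of_int (zorder h b) * ln (norm (z - b)))"
    using ln_norm_factorization[OF h R] by auto
  define Z where "Z = {b. norm b \<le> R \<and> h b = 0}"
  have Zb: "norm b < R" if "b \<in> Z" for b using that nz[of b] by (auto simp: Z_def less_le)
  have "has_circle_mean (\<lambda>z. poisson R w z * Re (H z) +
      (\<Sum>b\<in>Z. real_of_int (zorder h b) * (poisson R w z * ln (norm (z - b))))) R
     (Re (H w) + (\<Sum>b\<in>Z. real_of_int (zorder h b) * ln (norm (of_real (R\<^sup>2) - cnj b * w) / R)))"
    by (intro has_circle_mean_add poisson_holomorphic[OF H(2)] has_circle_mean_sum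
        has_circle_mean_cmult poisson_ln_dist) (use R H w Zb in auto)
  then have 1: "has_circle_mean (\<lambda>z. poisson R w z * ln (norm (h z))) R
     (Re (H w) + (\<Sum>b\<in>Z. real_of_int (zorder h b) * ln (norm (of_real (R\<^sup>2) - cnj b * w) / R)))"
    by (rule has_circle_mean_cong[OF _ R])
       (use eq nz H in \<open>auto simp: Z_def distrib_left sum_distrib_left mult_ac\<close>)
  have g: "green R w b = ln (norm (of_real (R\<^sup>2) - cnj b * w) / R) - ln (norm (w - b))" if "b \<in> Z" for b
  proof -
    have "of_real (R\<^sup>2) - cnj b * w \<noteq> 0" by (rule reflection_nonzero) (use R w that in \<open>auto simp: Z_def\<close>)
    moreover have "w \<noteq> b" using that w by (auto simp: Z_def)
    ultimately show ?thesis using R unfolding green_def by (simp add: ln_div ln_mult)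
  qed
  have "ln (norm (h w)) + (\<Sum>b\<in>Z. real_of_int (zorder h b) * green R w b)
     = Re (H w) + (\<Sum>b\<in>Z. real_of_int (zorder h b) * (ln (norm (w - b)) + green R w b))"
    using eq[of w] H w by (simp add: Z_def distrib_left sum.distrib)
  also have "\<dots> = Re (H w) + (\<Sum>b\<in>Z. real_of_int (zorder h b) * ln (norm (of_real (R\<^sup>2) - cnj b * w) / R))"
    using g by simp
  finally show ?thesis using 1 by (simp add: Z_def)
qed

lemma poisson_bounds:
  assumes "norm w < R" "norm z = R"
  shows "0 \<le> poisson R w z" "poisson R w z \<le> (R + norm w) / (R - norm w)"
proof -
  have d: "R - norm w \<le> norm (z - w)" using assms norm_triangle_ineq2[of z w] by simp
  have p: "(norm w)\<^sup>2 \<le> R\<^sup>2" using assms by (intro power_mono) auto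
  then show "0 \<le> poisson R w z" by (simp add: poisson_def)
  have "poisson R w z \<le> (R\<^sup>2 - (norm w)\<^sup>2) / (R - norm w)\<^sup>2"
    unfolding poisson_def
    by (intro divide_left_mono power_mono mult_pos_pos zero_less_power) (use p d assms in auto)
  also have "\<dots> = (R + norm w) / (R - norm w)"
  proof -
    have "R\<^sup>2 - (norm w)\<^sup>2 = (R + norm w) * (R - norm w)" by (simp add: algebra_simps power2_eq_square)
    then show ?thesis using assms by (simp add: power2_eq_square)
  qed
  finally show "poisson R w z \<le> (R + norm w) / (R - norm w)" .
qed

text \<open>The zeros of \<open>A\<close> enter the Poisson-Jensen formula for A / B with a
  favourable sign and are dropped; the kernel is replaced by its maximum on the circle, which is
  allowed because \<open>v\<close> is nonnegative.\<close>

lemma quotient_le_poisson_mean: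
  assumes A: "nz_entire A" and B: "nz_entire B" and R: "0 < R" and w: "norm w < R" "A w \<noteq> 0" "B w \<noteq> 0"
    and nz: "\<And>z. norm z = R \<Longrightarrow> A z \<noteq> 0 \<and> B z \<noteq> 0"
    and v: "continuous_on (sphere 0 R) v" "\<And>z. norm z = R \<Longrightarrow> 0 \<le> v z"
       "\<And>z. norm z = R \<Longrightarrow> ln (norm (A z)) - ln (norm (B z)) \<le> v z"
  shows "ln (norm (A w)) - ln (norm (B w)) \<le> (R + norm w) / (R - norm w) * circle_mean v R
     + (\<Sum>b | norm b \<le> R \<and> B b = 0. real_of_int (zorder B b) * green R w b)"
proof -
  have 1: "has_circle_mean (\<lambda>z. poisson R w z * ln (norm (A z)) - poisson R w z * ln (norm (B z))) R
    (ln (norm (A w)) + (\<Sum>b | norm b \<le> R \<and> A b = 0. real_of_int (zorder A b) * green R w b)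
     - (ln (norm (B w)) + (\<Sum>b | norm b \<le> R \<and> B b = 0. real_of_int (zorder B b) * green R w b)))"
    by (intro has_circle_mean_diff poisson_jensen A B R w) (use nz in auto)
  have 2: "has_circle_mean (\<lambda>z. (R + norm w) / (R - norm w) * v z) R ((R + norm w) / (R - norm w) * circle_mean v R)"
    by (intro has_circle_mean_cmult has_circle_mean_continuous v) (use R in auto)
  have "ln (norm (A w)) + (\<Sum>b | norm b \<le> R \<and> A b = 0. real_of_int (zorder A b) * green R w b)
     - (ln (norm (B w)) + (\<Sum>b | norm b \<le> R \<and> B b = 0. real_of_int (zorder B b) * green R w b))
     \<le> (R + norm w) / (R - norm w) * circle_mean v R"
  proof (rule has_circle_mean_le[OF 1 2 R])
    fix z :: complex assume z: "norm z = R"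
    have "poisson R w z * ln (norm (A z)) - poisson R w z * ln (norm (B z))
       = poisson R w z * (ln (norm (A z)) - ln (norm (B z)))" by (simp add: right_diff_distrib)
    also have "\<dots> \<le> poisson R w z * v z"
      by (intro mult_left_mono v z poisson_bounds w)
    also have "\<dots> \<le> (R + norm w) / (R - norm w) * v z"
      by (intro mult_right_mono v z poisson_bounds w)
    finally show "poisson R w z * ln (norm (A z)) - poisson R w z * ln (norm (B z))
       \<le> (R + norm w) / (R - norm w) * v z" .
  qed
  moreover have "0 \<le> (\<Sum>b | norm b \<le> R \<and> A b = 0. real_of_int (zorder A b) * green R w b)"
    by (intro sum_nonneg mult_nonneg_nonneg green_nonneg) (use R w zorder_nonneg[OF A] in auto)
  ultimately show ?thesis by linarith
qed

section \<open>Logarithms of difference quotients\<close>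

text \<open>Trades the logarithm for a power below 1, so that a small relative shift yields a small
  factor s^d and a kernel that is still integrable on circles.\<close>

lemma ln_one_plus_le_powr:
  fixes x d :: real
  assumes "0 \<le> x" "0 < d" "d < 1"
  shows "ln (1 + x) \<le> x powr d / d"
proof (cases "x \<le> 1")
  case True
  have "ln (1 + x) \<le> x" using assms by (simp add: ln_add_one_self_le_self)
  also have "x \<le> x powr d"
  proof (cases "x = 0")
    case False
    then have "x powr 1 \<le> x powr d" using True assms by (intro powr_mono') auto
    then show ?thesis using False assms by simp
  qed auto
  also have "\<dots> \<le> x powr d / d" using assms mult_right_mono[of d 1 "x powr d"] by (simp add: field_simps)
  finally show ?thesis .
next
  case False
  have "ln (1 + x) \<le> ln (2 * x)" using False by (intro ln_mono) auto
  also have "\<dots> = ln 2 + ln x" using False by (simp add: ln_mult)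
  also have "ln x = ln (x powr d) / d" using False assms by (simp add: ln_powr)
  also have "\<dots> \<le> (x powr d - 1) / d" using False assms by (intro divide_right_mono ln_le_minus_one) auto
  also have "ln 2 + (x powr d - 1) / d \<le> 1 / d + (x powr d - 1) / d"
    using assms ln_2_less_1 less_imp_le[of "1::real" "1 / d"]
    by (intro add_right_mono) (auto intro: order_trans[of _ 1])
  also have "\<dots> = x powr d / d" by (simp add: diff_divide_distrib)
  finally show ?thesis by simp
qed

lemma abs_ln_norm_diff_le:
  fixes u v :: complex
  assumes "u \<noteq> 0" "v \<noteq> 0" "norm (u - v) \<le> s" "0 < d" "d < 1"
  shows "\<bar>ln (norm u) - ln (norm v)\<bar> \<le> s powr d / d * (norm u powr (- d) + norm v powr (- d))"
proof -
  have *: "ln (norm u) - ln (norm v) \<le> s powr d / d * norm v powr (- d)"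
    if "u \<noteq> 0" "v \<noteq> 0" "norm (u - v) \<le> s" for u v :: complex
  proof -
    have s: "0 \<le> s" using that(3) norm_ge_zero order_trans by blast
    have "norm u \<le> norm v + s" using that norm_triangle_sub[of u v] by linarith
    then have "norm u / norm v \<le> 1 + s / norm v" using that by (simp add: field_simps)
    then have "ln (norm u / norm v) \<le> ln (1 + s / norm v)"
      using that by (intro ln_mono) auto
    also have "\<dots> \<le> (s / norm v) powr d / d" using s assms by (intro ln_one_plus_le_powr) auto
    also have "\<dots> = s powr d / d * norm v powr (- d)"
      using s that by (simp add: powr_divide powr_minus field_simps)
    finally show ?thesis using that by (simp add: ln_div)
  qed
  have s: "0 \<le> s powr d / d * norm u powr (- d)" "0 \<le> s powr d / d * norm v powr (- d)" using assms by auto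
  have "ln (norm u) - ln (norm v) \<le> s powr d / d * norm v powr (- d)"
    by (rule *) (use assms in auto)
  moreover have "ln (norm v) - ln (norm u) \<le> s powr d / d * norm u powr (- d)"
    by (rule *) (use assms in \<open>auto simp: norm_minus_commute\<close>)
  ultimately show ?thesis using s unfolding distrib_left by linarith
qed

text \<open>The kernel is the real part of (\<zeta> + w) / (\<zeta> - w), so its difference is
  bounded by a product of two reciprocal distances; the inequality 2xy \<le> x^2 + y^2 splits it
  into squares whose circle means are explicit.\<close>

lemma poisson_diff_le:
  assumes "norm z < R" "norm (z + a) < R" "norm \<zeta> = R" "norm a \<le> s"
  shows "\<bar>poisson R (z + a) \<zeta> - poisson R z \<zeta>\<bar> \<le>
     s * R * (1 / (norm (z - \<zeta>))\<^sup>2 + 1 / (norm (z - (\<zeta> - a)))\<^sup>2)"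
proof -
  have P: "poisson R w \<zeta> = Re ((\<zeta> + w) / (\<zeta> - w))" if "norm w < R" for w
  proof -
    have ne: "\<zeta> \<noteq> w" using that assms by auto
    have "(\<zeta> + w) / (\<zeta> - w) = (\<zeta> + w) * cnj (\<zeta> - w) / of_real ((norm (\<zeta> - w))\<^sup>2)"
      using ne unfolding complex_norm_square by (intro mult_divide_mult_cancel_right[symmetric]) auto
    then have "Re ((\<zeta> + w) / (\<zeta> - w)) = Re ((\<zeta> + w) * cnj (\<zeta> - w)) / (norm (\<zeta> - w))\<^sup>2"
      by (simp only: Re_divide_of_real)
    also have "Re ((\<zeta> + w) * cnj (\<zeta> - w)) = R\<^sup>2 - (norm w)\<^sup>2"
      unfolding assms(3)[symmetric] cmod_power2 by (simp add: algebra_simps power2_eq_square)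
    finally show ?thesis by (simp add: poisson_def)
  qed
  have ne: "\<zeta> \<noteq> z" "\<zeta> \<noteq> z + a" using assms by auto
  have "poisson R (z + a) \<zeta> - poisson R z \<zeta> = Re ((\<zeta> + (z + a)) / (\<zeta> - (z + a)) - (\<zeta> + z) / (\<zeta> - z))"
    using P assms by simp
  also have "(\<zeta> + (z + a)) / (\<zeta> - (z + a)) - (\<zeta> + z) / (\<zeta> - z) = 2 * a * \<zeta> / ((\<zeta> - (z + a)) * (\<zeta> - z))"
    using ne by (simp add: field_simps)
  also have "\<bar>Re \<dots>\<bar> \<le> norm (2 * a * \<zeta> / ((\<zeta> - (z + a)) * (\<zeta> - z)))" by (rule abs_Re_le_cmod)
  also have "\<dots> = norm a * R * (2 * (1 / norm (z - \<zeta>)) * (1 / norm (z - (\<zeta> - a))))"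
  proof -
    have "norm (\<zeta> - (z + a)) = norm (z - (\<zeta> - a))"
      by (metis diff_diff_eq2 norm_minus_commute add.commute)
    then show ?thesis using assms by (simp add: norm_divide norm_mult norm_minus_commute mult_ac)
  qed
  also have "\<dots> \<le> s * R * ((1 / norm (z - \<zeta>))\<^sup>2 + (1 / norm (z - (\<zeta> - a)))\<^sup>2)"
  proof (rule mult_mono)
    show "2 * (1 / norm (z - \<zeta>)) * (1 / norm (z - (\<zeta> - a))) \<le> (1 / norm (z - \<zeta>))\<^sup>2 + (1 / norm (z - (\<zeta> - a)))\<^sup>2"
      by (rule sum_squares_bound)
    show "norm a * R \<le> s * R" using assms norm_ge_zero[of \<zeta>] by (intro mult_right_mono) auto
    show "0 \<le> s * R"
      using assms norm_ge_zero[of \<zeta>] order_trans[OF norm_ge_zero assms(4)] by (intro mult_nonneg_nonneg) auto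
  qed auto
  finally show ?thesis by (simp add: power_divide)
qed

lemma mean_poisson_diff_le:
  assumes "0 < r" "s \<le> r" "r + s < R" "norm \<zeta> = R" "norm a \<le> s"
  shows "circle_mean (\<lambda>z. \<bar>poisson R (z + a) \<zeta> - poisson R z \<zeta>\<bar>) r \<le> 2 * s / (R - s - r)"
proof -
  have s0: "0 \<le> s" using assms(5) norm_ge_zero order_trans by blast
  have na: "R - s \<le> norm (\<zeta> - a)" using assms norm_triangle_ineq2[of \<zeta> a] by linarith
  have hm: "has_circle_mean (\<lambda>z. s * R * (1 / (norm (z - \<zeta>))\<^sup>2 + 1 / (norm (z - (\<zeta> - a)))\<^sup>2)) r
     (s * R * (1 / ((norm \<zeta>)\<^sup>2 - r\<^sup>2) + 1 / ((norm (\<zeta> - a))\<^sup>2 - r\<^sup>2)))"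
    by (intro has_circle_mean_cmult has_circle_mean_add mean_inverse_dist_square) (use assms na s0 in auto)
  have "circle_mean (\<lambda>z. \<bar>poisson R (z + a) \<zeta> - poisson R z \<zeta>\<bar>) r \<le>
     s * R * (1 / ((norm \<zeta>)\<^sup>2 - r\<^sup>2) + 1 / ((norm (\<zeta> - a))\<^sup>2 - r\<^sup>2))"
  proof (rule circle_mean_le_except[OF hm assms(1), of "{}"])
    fix z :: complex assume z: "norm z = r"
    have "norm (z + a) < R" using z assms norm_triangle_ineq[of z a] by linarith
    then show 1: "\<bar>poisson R (z + a) \<zeta> - poisson R z \<zeta>\<bar> \<le> s * R * (1 / (norm (z - \<zeta>))\<^sup>2 + 1 / (norm (z - (\<zeta> - a)))\<^sup>2)"
      by (intro poisson_diff_le) (use z assms s0 in auto)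
    then show "0 \<le> s * R * (1 / (norm (z - \<zeta>))\<^sup>2 + 1 / (norm (z - (\<zeta> - a)))\<^sup>2)" by linarith
  qed simp
  also have "\<dots> \<le> s * R * (1 / ((R - s - r) * R) + 1 / ((R - s - r) * R))"
  proof -
    \<comment> \<open>Here s \<le> r is used in the form R \<le> R - s + r. The factor
      \<open>R\<close> gained cancels the one in the numerator.\<close>
    have k: "(R - s - r) * R \<le> x\<^sup>2 - r\<^sup>2" if "R - s \<le> x" for x
    proof -
      have "(R - s - r) * R \<le> (R - s - r) * (R - s + r)" using assms by (intro mult_left_mono) auto
      also have "\<dots> = (R - s)\<^sup>2 - r\<^sup>2" by (simp add: algebra_simps power2_eq_square)
      also have "\<dots> \<le> x\<^sup>2 - r\<^sup>2" using that assms by (simp add: power_mono)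
      finally show ?thesis .
    qed
    have p: "0 < (R - s - r) * R" using assms s0 by (intro mult_pos_pos) auto
    have l: "1 / (x\<^sup>2 - r\<^sup>2) \<le> 1 / ((R - s - r) * R)" if "R - s \<le> x" for x
      using k[OF that] p by (intro divide_left_mono) (auto intro: mult_pos_pos)
    show ?thesis
      by (intro mult_left_mono add_mono l) (use assms na s0 in auto)
  qed
  also have "\<dots> = 2 * s / (R - s - r)" using assms s0 by simp
  finally show ?thesis .
qed

text \<open>As a function of \<open>w\<close> the Green function is ln |w - p| - ln |w - b| plus a
  constant, with \<open>p\<close> the reflection of \<open>b\<close>. Each logarithm contributes two
  kernels, one at \<open>z\<close> and one at z + a.\<close>

lemma green_diff_le:
  assumes "0 < R" "norm z < R" "norm (z + a) < R" "norm b < R" "b \<noteq> 0" "z \<noteq> b" "z + a \<noteq> b"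
    "norm a \<le> s" "0 < d" "d < 1"
  shows "\<bar>green R (z + a) b - green R z b\<bar> \<le> s powr d / d *
    ((norm (z - b) powr (- d) + norm (z - (b - a)) powr (- d)) +
     (norm (z - of_real (R\<^sup>2) / cnj b) powr (- d) + norm (z - (of_real (R\<^sup>2) / cnj b - a)) powr (- d)))"
proof -
  define p where "p = of_real (R\<^sup>2) / cnj b"
  have g: "green R w b = ln (norm b / R) + ln (norm (w - p)) - ln (norm (w - b))" and pw: "w \<noteq> p"
    if "norm w < R" "w \<noteq> b" for w
  proof -
    have nz: "of_real (R\<^sup>2) - cnj b * w \<noteq> 0" by (rule reflection_nonzero) (use assms that in auto)
    have e: "of_real (R\<^sup>2) - cnj b * w = - cnj b * (w - p)"
      using assms by (simp add: p_def field_simps)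
    then show "w \<noteq> p" using nz by auto
    have "norm (of_real (R\<^sup>2) - cnj b * w) = norm b * norm (w - p)"
      unfolding e by (simp add: norm_mult)
    then show "green R w b = ln (norm b / R) + ln (norm (w - p)) - ln (norm (w - b))"
      unfolding green_def using assms that \<open>w \<noteq> p\<close> by (simp add: ln_div ln_mult)
  qed
  have e1: "\<bar>ln (norm (z + a - p)) - ln (norm (z - p))\<bar>
     \<le> s powr d / d * (norm (z + a - p) powr (- d) + norm (z - p) powr (- d))"
    by (rule abs_ln_norm_diff_le) (use pw[of z] pw[of "z + a"] assms in auto)
  have e2: "\<bar>ln (norm (z + a - b)) - ln (norm (z - b))\<bar>
     \<le> s powr d / d * (norm (z + a - b) powr (- d) + norm (z - b) powr (- d))"
    by (rule abs_ln_norm_diff_le) (use assms in auto)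
  have "\<bar>green R (z + a) b - green R z b\<bar> \<le>
    \<bar>ln (norm (z + a - p)) - ln (norm (z - p))\<bar> + \<bar>ln (norm (z + a - b)) - ln (norm (z - b))\<bar>"
    using g[of z] g[of "z + a"] assms by simp
  also have "\<dots> \<le> s powr d / d * (norm (z + a - p) powr (- d) + norm (z - p) powr (- d))
    + s powr d / d * (norm (z + a - b) powr (- d) + norm (z - b) powr (- d))"
    using e1 e2 by linarith
  finally show ?thesis unfolding p_def by (simp add: algebra_simps)
qed

text \<open>The reflection of 0 is at infinity, so only the kernels of the pole itself
  remain.\<close>

lemma green_diff_le_0:
  assumes "0 < R" "z \<noteq> 0" "z + a \<noteq> 0" "norm a \<le> s" "0 < d" "d < 1"
  shows "\<bar>green R (z + a) 0 - green R z 0\<bar> \<le> s powr d / d *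
    (norm (z - 0) powr (- d) + norm (z - (0 - a)) powr (- d))"
proof -
  have "green R w 0 = ln R - ln (norm w)" if "w \<noteq> 0" for w
    using that assms(1) by (simp add: green_def norm_power ln_div ln_mult ln_realpow)
  then have "\<bar>green R (z + a) 0 - green R z 0\<bar> = \<bar>ln (norm (z + a)) - ln (norm z)\<bar>"
    using assms by simp
  also have "\<dots> \<le> s powr d / d * (norm (z + a) powr (- d) + norm z powr (- d))"
    by (rule abs_ln_norm_diff_le) (use assms in auto)
  finally show ?thesis by (simp add: add.commute)
qed


text \<open>The second summand is the kernel of the shifted point: |z + a - p| = |z - (p -
  a)|.\<close>

definition dist_kernel :: "real \<Rightarrow> complex \<Rightarrow> complex \<Rightarrow> complex \<Rightarrow> real" where
  "dist_kernel d a p z = norm (z - p) powr (- d) + norm (z - (p - a)) powr (- d)"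

text \<open>A difference analogue of the lemma on the logarithmic derivative, for A / B:
  Poisson-Jensen at z + a minus Poisson-Jensen at \<open>z\<close>. The boundary integral gives the
  first term, the Green functions of zeros and poles the second. \<open>K\<close> depends on
  \<open>d\<close> only.\<close>

lemma log_difference_mean:
  assumes d: "0 < d" "d < 1"
  obtains K where "K > 0" and "\<And>A B a s r R. nz_entire A \<Longrightarrow> nz_entire B \<Longrightarrow> norm a \<le> s \<Longrightarrow> 0 < r \<Longrightarrow> s \<le> r \<Longrightarrow>
     r + s < R \<Longrightarrow> (\<And>z. norm z = R \<Longrightarrow> A z \<noteq> 0 \<and> B z \<noteq> 0) \<Longrightarrow>
     (\<And>z. norm z = r \<Longrightarrow> A z \<noteq> 0 \<and> B z \<noteq> 0 \<and> A (z + a) \<noteq> 0 \<and> B (z + a) \<noteq> 0) \<Longrightarrow>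
     circle_mean (\<lambda>z. max 0 ((ln (norm (A (z + a))) - ln (norm (B (z + a)))) - (ln (norm (A z)) - ln (norm (B z))))) r
     \<le> 2 * s / (R - s - r) * circle_mean (\<lambda>z. \<bar>ln (norm (A z)) - ln (norm (B z))\<bar>) R
        + K * s powr d * r powr (- d) * (unint_counting (zorder A) R + unint_counting (zorder B) R)"
proof -
  obtain C where C: "C > 0" "\<And>r p. 0 < r \<Longrightarrow> norm p \<noteq> r \<Longrightarrow>
     circle_mean (\<lambda>z. norm (z - p) powr (- d)) r \<le> C * r powr (- d)"
    using mean_dist_powr_le[OF d] by metis
  \<comment> \<open>At most four kernels arise for each zero, two for the zero and two for its
    reflection, each of mean at most C r^(-d); 1/d comes from
    \<open>ln_one_plus_le_powr\<close>.\<close>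
  define K where "K = 4 * C / d"
  show ?thesis
  proof (rule that[of K])
    show "K > 0" using C d by (simp add: K_def)
    fix A B :: "complex \<Rightarrow> complex" and a :: complex and s r R :: real
    assume A: "nz_entire A" and B: "nz_entire B" and a: "norm a \<le> s" and r: "0 < r" and sr: "s \<le> r"
      and R: "r + s < R" and nzR: "\<And>z. norm z = R \<Longrightarrow> A z \<noteq> 0 \<and> B z \<noteq> 0"
      and nzr: "\<And>z. norm z = r \<Longrightarrow> A z \<noteq> 0 \<and> B z \<noteq> 0 \<and> A (z + a) \<noteq> 0 \<and> B (z + a) \<noteq> 0"
    have s0: "0 \<le> s" using a norm_ge_zero order_trans by blast
    have R0: "0 < R" "r < R" using R r s0 by auto
    have zR: "norm z < R" "norm (z + a) < R" if "norm z = r" for z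
      using that R a R0 norm_triangle_ineq[of z a] by auto
    define ZA where "ZA = {b. norm b \<le> R \<and> A b = 0}"
    define ZB where "ZB = {b. norm b \<le> R \<and> B b = 0}"
    define f where "f = (\<lambda>z. ln (norm (A z)) - ln (norm (B z)))"
    define Q where "Q = (\<lambda>b z. dist_kernel d a b z + (if b = 0 then 0 else dist_kernel d a (of_real (R\<^sup>2) / cnj b) z))"
    define k where "k = s powr d / d"
    have k0: "0 \<le> k" using d by (simp add: k_def)
    have Zr: "norm b < R" "norm b \<noteq> r" "norm (b - a) \<noteq> r" if "b \<in> ZA \<union> ZB" for b
    proof -
      show "norm b < R" using that nzR[of b] by (auto simp: ZA_def ZB_def less_le)
      show "norm b \<noteq> r" using that nzr[of b] by (auto simp: ZA_def ZB_def)
      show "norm (b - a) \<noteq> r" using that nzr[of "b - a"] by (auto simp: ZA_def ZB_def)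
    qed
    have star: "norm (of_real (R\<^sup>2) / cnj b) > R" if "b \<noteq> 0" "norm b < R" for b
      using that R0 by (simp add: norm_divide norm_power) (simp add: power2_eq_square field_simps)
    have ker: "continuous_on (sphere 0 r) (dist_kernel d a p) \<and> circle_mean (dist_kernel d a p) r \<le> 2 * C * r powr (- d)"
      if "norm p \<noteq> r" "norm (p - a) \<noteq> r" for p
    proof -
      have c: "continuous_on (sphere 0 r) (\<lambda>z. norm (z - p') powr (- d))" if "norm p' \<noteq> r" for p'
        using that by (auto intro!: continuous_intros)
      have "has_circle_mean (dist_kernel d a p) r (circle_mean (\<lambda>z. norm (z - p) powr (- d)) r
           + circle_mean (\<lambda>z. norm (z - (p - a)) powr (- d)) r)"
        unfolding dist_kernel_def
        by (intro has_circle_mean_add has_circle_mean_continuous c that) (use r in auto)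
      from circle_mean_eq[OF this] C(2)[OF r that(1)] C(2)[OF r that(2)]
      have "circle_mean (dist_kernel d a p) r \<le> 2 * C * r powr (- d)" by linarith
      then show ?thesis unfolding dist_kernel_def using c that by (auto intro!: continuous_on_add)
    qed
    have Qm: "has_circle_mean (Q b) r (circle_mean (Q b) r)" "circle_mean (Q b) r \<le> 4 * C * r powr (- d)"
      if b: "b \<in> ZA \<union> ZB" for b
    proof -
      note k1 = ker[OF Zr(2,3)[OF b]]
      have h1: "has_circle_mean (dist_kernel d a b) r (circle_mean (dist_kernel d a b) r)"
        using has_circle_mean_continuous k1 r by auto
      have "\<exists>m. has_circle_mean (Q b) r m \<and> m \<le> 4 * C * r powr (- d)"
      proof (cases "b = 0")
        case True
        have "2 * C * r powr (- d) \<le> 4 * C * r powr (- d)" using C(1) by simp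
        then have "circle_mean (dist_kernel d a b) r \<le> 4 * C * r powr (- d)" using k1 by linarith
        then show ?thesis using h1 True by (auto simp: Q_def)
      next
        case False
        define p where "p = of_real (R\<^sup>2) / cnj b"
        have p: "norm p > R" using star[OF False Zr(1)[OF b]] by (simp add: p_def)
        have "norm p \<noteq> r" "norm (p - a) \<noteq> r"
          using p R0 R a norm_triangle_ineq2[of p a] by auto
        note k2 = ker[OF this]
        have h2: "has_circle_mean (dist_kernel d a p) r (circle_mean (dist_kernel d a p) r)"
          using has_circle_mean_continuous k2 r by auto
        show ?thesis using has_circle_mean_add[OF h1 h2] k1 k2 False
          by (intro exI[of _ "circle_mean (dist_kernel d a b) r + circle_mean (dist_kernel d a p) r"])
             (auto simp: Q_def p_def)
      qed
      then show "has_circle_mean (Q b) r (circle_mean (Q b) r)" "circle_mean (Q b) r \<le> 4 * C * r powr (- d)"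
        using circle_mean_eq by auto
    qed
    have gd: "\<bar>green R (z + a) b - green R z b\<bar> \<le> k * Q b z" if b: "b \<in> ZA \<union> ZB" and z: "norm z = r" for b z
    proof -
      have zb: "z \<noteq> b" "z + a \<noteq> b" using nzr[OF z] b by (auto simp: ZA_def ZB_def)
      show ?thesis
      proof (cases "b = 0")
        case True
        then show ?thesis using green_diff_le_0[OF R0(1) _ _ a d, of z] zb
          by (simp add: Q_def k_def dist_kernel_def)
      next
        case False
        then show ?thesis using green_diff_le[OF R0(1) zR[OF z] Zr(1)[OF b] False zb a d]
          by (simp add: Q_def k_def dist_kernel_def)
      qed
    qed
    define F where "F = (\<lambda>z w. \<bar>poisson R (z + a) w - poisson R z w\<bar> * \<bar>f w\<bar>)"
    have fc: "continuous_on (sphere 0 R) f" unfolding f_def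
      using nzR by (auto intro!: continuous_intros nz_entire_continuous A B)
    have Pc: "continuous_on (sphere 0 r \<times> sphere 0 R) (\<lambda>x. F (fst x) (snd x))"
    proof -
      have ne: "w \<noteq> z" "w \<noteq> z + a" if "norm z = r" "norm w = R" for z w using zR[OF that(1)] that(2) by auto
      show ?thesis unfolding F_def poisson_def
        using ne by (auto intro!: continuous_intros continuous_on_compose2[OF fc])
    qed
    have Pc1: "continuous_on (sphere 0 R) (F z)" if "norm z = r" for z
    proof -
      have "continuous_on (sphere 0 R) (\<lambda>w. F (fst (z, w)) (snd (z, w)))"
        by (rule continuous_on_compose2[OF Pc], intro continuous_intros) (use that in auto)
      then show ?thesis by simp
    qed
    define E where "E = (\<lambda>z. circle_mean (F z) R)"
    have Ec: "continuous_on (sphere 0 r) E" unfolding E_def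
      by (rule continuous_on_circle_mean[OF Pc]) (use R0 in auto)
    \<comment> \<open>After interchanging the two means, the inner one is over \<open>z\<close> for
      a fixed boundary point, where the difference of Poisson kernels is small on average although
      not pointwise.\<close>
    have Em: "circle_mean E r \<le> 2 * s / (R - s - r) * circle_mean (\<lambda>w. \<bar>f w\<bar>) R"
    proof -
      have "circle_mean E r = circle_mean (\<lambda>w. circle_mean (\<lambda>z. F z w) r) R"
        unfolding E_def by (rule circle_mean_swap[OF Pc]) (use R0 r in auto)
      also have "\<dots> \<le> circle_mean (\<lambda>w. 2 * s / (R - s - r) * \<bar>f w\<bar>) R"
      proof (rule circle_mean_mono)
        have "continuous_on (sphere 0 R \<times> sphere 0 r) (\<lambda>x. F (snd x) (fst x))"
        proof -
          have "continuous_on (sphere 0 R \<times> sphere 0 r) (\<lambda>x. F (fst (snd x, fst x)) (snd (snd x, fst x)))"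
            by (rule continuous_on_compose2[OF Pc], intro continuous_intros) auto
          then show ?thesis by simp
        qed
        from continuous_on_circle_mean[OF this]
        show "continuous_on (sphere 0 R) (\<lambda>w. circle_mean (\<lambda>z. F z w) r)" using r by auto
        fix w :: complex assume w: "norm w = R"
        have "circle_mean (\<lambda>z. F z w) r = \<bar>f w\<bar> * circle_mean (\<lambda>z. \<bar>poisson R (z + a) w - poisson R z w\<bar>) r"
          unfolding F_def circle_mean_def by (simp add: mult.commute)
        also have "\<dots> \<le> \<bar>f w\<bar> * (2 * s / (R - s - r))"
          by (intro mult_left_mono mean_poisson_diff_le r sr R w a) auto
        finally show "circle_mean (\<lambda>z. F z w) r \<le> 2 * s / (R - s - r) * \<bar>f w\<bar>" by (simp add: mult.commute)
      qed (use R R0 fc in \<open>auto intro!: continuous_intros\<close>)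
      also have "\<dots> = 2 * s / (R - s - r) * circle_mean (\<lambda>w. \<bar>f w\<bar>) R"
        unfolding circle_mean_def by simp
      finally show ?thesis .
    qed
    define V where "V = (\<lambda>z. E z + ((\<Sum>b\<in>ZA. real_of_int (zorder A b) * (k * Q b z))
       + (\<Sum>b\<in>ZB. real_of_int (zorder B b) * (k * Q b z))))"
    have Vm: "has_circle_mean V r (circle_mean E r + ((\<Sum>b\<in>ZA. real_of_int (zorder A b) * (k * circle_mean (Q b) r))
       + (\<Sum>b\<in>ZB. real_of_int (zorder B b) * (k * circle_mean (Q b) r))))"
      unfolding V_def
      by (intro has_circle_mean_add has_circle_mean_sum has_circle_mean_cmult has_circle_mean_continuous Ec Qm)
         (use r in auto)
    have "circle_mean (\<lambda>z. max 0 (f (z + a) - f z)) r \<le> circle_mean E r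
       + ((\<Sum>b\<in>ZA. real_of_int (zorder A b) * (k * circle_mean (Q b) r))
       + (\<Sum>b\<in>ZB. real_of_int (zorder B b) * (k * circle_mean (Q b) r)))"
    proof (rule circle_mean_le_except[OF Vm r, of "{}"])
      fix z :: complex assume z: "norm z = r"
      define SA where "SA = (\<lambda>w. \<Sum>b\<in>ZA. real_of_int (zorder A b) * green R w b)"
      define SB where "SB = (\<lambda>w. \<Sum>b\<in>ZB. real_of_int (zorder B b) * green R w b)"
      have P: "has_circle_mean (\<lambda>w. poisson R u w * f w) R (f u + (SA u - SB u))"
        if "norm u < R" "A u \<noteq> 0" "B u \<noteq> 0" for u
        using has_circle_mean_diff[OF poisson_jensen[OF A R0(1) that(1,2)] poisson_jensen[OF B R0(1) that(1,3)]] nzR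
        by (simp add: f_def SA_def SB_def ZA_def ZB_def algebra_simps)
      note nz = nzr[OF z]
      have D: "has_circle_mean (\<lambda>w. poisson R (z + a) w * f w - poisson R z w * f w) R
         ((f (z + a) + (SA (z + a) - SB (z + a))) - (f z + (SA z - SB z)))"
        by (intro has_circle_mean_diff P) (use zR[OF z] nz in auto)
      have FE: "has_circle_mean (F z) R (E z)" unfolding E_def
        by (rule has_circle_mean_continuous[OF Pc1[OF z]]) (use R0 in auto)
      have "((f (z + a) + (SA (z + a) - SB (z + a))) - (f z + (SA z - SB z))) \<le> E z"
      proof (rule has_circle_mean_le[OF D FE R0(1)])
        fix w :: complex assume "norm w = R"
        have "poisson R (z + a) w * f w - poisson R z w * f w = (poisson R (z + a) w - poisson R z w) * f w"
          by (simp add: algebra_simps)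
        also have "\<dots> \<le> \<bar>(poisson R (z + a) w - poisson R z w) * f w\<bar>" by simp
        finally show "poisson R (z + a) w * f w - poisson R z w * f w \<le> F z w"
          unfolding F_def by (simp add: abs_mult)
      qed
      moreover have "SA z - SA (z + a) \<le> (\<Sum>b\<in>ZA. real_of_int (zorder A b) * (k * Q b z))"
        unfolding SA_def sum_subtractf[symmetric] right_diff_distrib[symmetric]
      proof (intro sum_mono mult_left_mono)
        fix b assume "b \<in> ZA"
        then have "\<bar>green R (z + a) b - green R z b\<bar> \<le> k * Q b z" by (intro gd z) auto
        then show "green R z b - green R (z + a) b \<le> k * Q b z" by linarith
      qed (use zorder_nonneg[OF A] in auto)
      moreover have "SB (z + a) - SB z \<le> (\<Sum>b\<in>ZB. real_of_int (zorder B b) * (k * Q b z))"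
        unfolding SB_def sum_subtractf[symmetric] right_diff_distrib[symmetric]
      proof (intro sum_mono mult_left_mono)
        fix b assume "b \<in> ZB"
        then have "\<bar>green R (z + a) b - green R z b\<bar> \<le> k * Q b z" by (intro gd z) auto
        then show "green R (z + a) b - green R z b \<le> k * Q b z" by linarith
      qed (use zorder_nonneg[OF B] in auto)
      ultimately have "f (z + a) - f z \<le> V z" unfolding V_def by linarith
      moreover have V0: "0 \<le> V z" unfolding V_def E_def Q_def dist_kernel_def
        by (intro add_nonneg_nonneg sum_nonneg mult_nonneg_nonneg circle_mean_nonneg Pc1 z k0)
           (use R0 zorder_nonneg[OF A] zorder_nonneg[OF B] in \<open>auto simp: F_def\<close>)
      ultimately show "max 0 (f (z + a) - f z) \<le> V z" by simp
      show "0 \<le> V z" by (rule V0)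
    qed simp
    also have "\<dots> \<le> 2 * s / (R - s - r) * circle_mean (\<lambda>w. \<bar>f w\<bar>) R
       + ((\<Sum>b\<in>ZA. real_of_int (zorder A b) * (k * (4 * C * r powr (- d))))
       + (\<Sum>b\<in>ZB. real_of_int (zorder B b) * (k * (4 * C * r powr (- d)))))"
      by (intro add_mono Em sum_mono mult_left_mono Qm k0) (use zorder_nonneg[OF A] zorder_nonneg[OF B] in auto)
    also have "(\<Sum>b\<in>ZA. real_of_int (zorder A b) * (k * (4 * C * r powr (- d))))
       + (\<Sum>b\<in>ZB. real_of_int (zorder B b) * (k * (4 * C * r powr (- d))))
       = K * s powr d * r powr (- d) * (unint_counting (zorder A) R + unint_counting (zorder B) R)"
      unfolding unint_counting_zorder[OF A] unint_counting_zorder[OF B] ZA_def[symmetric] ZB_def[symmetric]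
        sum_distrib_right[symmetric] by (simp add: K_def k_def algebra_simps add_divide_distrib)
    finally show "circle_mean (\<lambda>z. max 0 ((ln (norm (A (z + a))) - ln (norm (B (z + a)))) - (ln (norm (A z)) - ln (norm (B z))))) r
     \<le> 2 * s / (R - s - r) * circle_mean (\<lambda>z. \<bar>ln (norm (A z)) - ln (norm (B z))\<bar>) R
        + K * s powr d * r powr (- d) * (unint_counting (zorder A) R + unint_counting (zorder B) R)"
      by (simp add: f_def)
  qed
qed

section \<open>Jensen's formula for shifted functions\<close>

text \<open>Three ranges of the modulus x: up to \<open>M\<close> the crude loss ln M; beyond
  \<open>M\<close> a loss of at most 2s/x, which is at most 2s/M when x \<le> r/2 and at most 4s/r
  otherwise.\<close>

lemma log_ratio_shift_le:
  assumes s: "0 \<le> s" and M: "2 * s + 2 \<le> M" and r: "2 * M \<le> r"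
    and xy: "x - s \<le> y" "0 \<le> x" "0 \<le> y"
  shows "log_ratio r y - log_ratio r x \<le> (if x \<le> M then ln M else 0) + (if x \<le> r / 2 then 2 * s / M else 0) + 4 * s / r"
proof (cases "x \<le> M")
  case True
  have r1: "1 \<le> r" "M \<le> r" using assms by auto
  have "log_ratio r y \<le> ln r"
  proof -
    have "max r y / max 1 y \<le> r"
      using r1 by (auto simp: max_def divide_le_eq mult_left_le)
    then show ?thesis unfolding log_ratio_def using r1 by (intro ln_mono) auto
  qed
  moreover have "ln r - ln M \<le> log_ratio r x"
  proof -
    have "r / M \<le> r / max 1 x" using True M s r1 by (intro divide_left_mono) auto
    then have "ln (r / M) \<le> ln (r / max 1 x)" using r1 M s by (intro ln_mono) auto
    then show ?thesis using log_ratio_inside[of x r] True r1 M s by (simp add: ln_div)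
  qed
  moreover have "0 \<le> (if x \<le> r / 2 then 2 * s / M else 0) + 4 * s / r" using s M r1 by auto
  ultimately show ?thesis using True by simp
next
  case False
  have x: "2 * s \<le> x" "2 \<le> x" "1 \<le> x - s" using False M s by auto
  have r1: "1 \<le> r" using assms by auto
  have "log_ratio r y \<le> ln (max r x / (x - s))"
  proof -
    have "max r y / max 1 y \<le> max r (x - s) / (x - s)"
    proof (cases "r \<le> max 1 y")
      case True
      then have "max r y = max 1 y" using r1 by (auto simp: max_def)
      then show ?thesis using x by (simp add: le_divide_eq)
    next
      case False
      then have "max r y = r" by (simp add: not_le)
      then have "max r y / max 1 y = r / max 1 y" by simp
      also have "\<dots> \<le> r / (x - s)" using x xy r1 by (intro divide_left_mono) auto
      also have "\<dots> \<le> max r (x - s) / (x - s)" using x by (intro divide_right_mono) auto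
      finally show ?thesis .
    qed
    also have "\<dots> \<le> max r x / (x - s)" using x s by (intro divide_right_mono) auto
    finally show ?thesis unfolding log_ratio_def using r1 x xy by (intro ln_mono) (auto simp: max_def)
  qed
  moreover have "log_ratio r x = ln (max r x / x)" using x by (simp add: log_ratio_def max_def)
  moreover have "ln (max r x / (x - s)) - ln (max r x / x) = ln (x / (x - s))"
    using x r1 by (simp add: ln_div max_def)
  moreover have "ln (x / (x - s)) \<le> 2 * s / x"
  proof -
    have "x / (x - s) = 1 + s / (x - s)" using x by (simp add: field_simps)
    then have "ln (x / (x - s)) \<le> s / (x - s)" using x s ln_add_one_self_le_self[of "s / (x - s)"] by simp
    also have "\<dots> \<le> s / (x / 2)" using x s by (intro divide_left_mono) auto
    finally show ?thesis by (simp add: mult.commute)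
  qed
  moreover have "2 * s / x \<le> (if x \<le> r / 2 then 2 * s / M else 0) + 4 * s / r"
  proof (cases "x \<le> r / 2")
    case True
    have "2 * s / x \<le> 2 * s / M" using False M s by (intro divide_left_mono) auto
    moreover have "0 \<le> 4 * s / r" using s r1 by simp
    ultimately show ?thesis using True by simp
  next
    case F: False
    have "2 * s / x \<le> 2 * s / (r / 2)" using F s r1 x by (intro divide_left_mono) auto
    then show ?thesis using F by simp
  qed
  ultimately show ?thesis using False by simp
qed

text \<open>By Jensen's formula the signed mean of the shift only sees how far zeros move.
  \<open>M\<close> is free: enlarging it worsens the constant \<open>K\<close> but makes the
  coefficient of the zeros up to r/2 as small as desired.\<close>

lemma jensen_shift:
  assumes h: "nz_entire h" and a: "norm a \<le> s" and M: "2 * s + 2 \<le> M"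
  obtains K where "\<And>r. 2 * M \<le> r \<Longrightarrow>
    circle_mean (\<lambda>z. ln (norm (h (z + a)))) r - circle_mean (\<lambda>z. ln (norm (h z))) r
    \<le> K + 2 * s / M * unint_counting (zorder h) (r / 2) + 4 * s / r * unint_counting (zorder h) (r + s)"
proof
  define h' where "h' = (\<lambda>z. h (z + a))"
  have h': "nz_entire h'" unfolding h'_def by (rule nz_entire_shift[OF h])
  define K0 where "K0 = circle_mean (\<lambda>z. ln (norm (h' z))) 1 - circle_mean (\<lambda>z. ln (norm (h z))) 1"
  fix r assume r: "2 * M \<le> r"
  have s: "0 \<le> s" using a norm_ge_zero order_trans by blast
  have r1: "1 \<le> r" using r M s by auto
  \<comment> \<open>Radius r + s captures both the zeros of \<open>h\<close> up to \<open>r\<close>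
    and those whose translates by -a lie within \<open>r\<close>.\<close>
  define S where "S = {b. norm b \<le> r + s \<and> h b = 0}"
  have fS: "finite S" unfolding S_def by (rule finite_zeros_cball[OF h])
  have l0: "log_count (zorder h) r = (\<Sum>b\<in>S. real_of_int (zorder h b) * log_ratio r (norm b))"
    by (rule log_count_eq[OF fS _ r1]) (use s in \<open>auto simp: S_def zorder_nonzero_iff[OF h]\<close>)
  have "log_count (zorder h') r = (\<Sum>b\<in>(\<lambda>b. b - a) ` S. real_of_int (zorder h' b) * log_ratio r (norm b))"
  proof (rule log_count_eq[OF _ _ r1])
    show "{z. norm z \<le> r \<and> zorder h' z \<noteq> 0} \<subseteq> (\<lambda>b. b - a) ` S"
    proof
      fix z assume "z \<in> {z. norm z \<le> r \<and> zorder h' z \<noteq> 0}"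
      then have z: "norm z \<le> r" "h (z + a) = 0" by (auto simp: zorder_nonzero_iff[OF h']) (simp add: h'_def)
      then have "z + a \<in> S" using a norm_triangle_ineq[of z a] by (simp add: S_def)
      then show "z \<in> (\<lambda>b. b - a) ` S" by force
    qed
  qed (use fS in auto)
  also have "\<dots> = (\<Sum>b\<in>S. real_of_int (zorder h b) * log_ratio r (norm (b - a)))"
    by (subst sum.reindex) (auto simp: inj_on_def h'_def zorder_shift_arg)
  finally have l1: "log_count (zorder h') r = (\<Sum>b\<in>S. real_of_int (zorder h b) * log_ratio r (norm (b - a)))" .
  have "log_count (zorder h') r - log_count (zorder h) r
     = (\<Sum>b\<in>S. real_of_int (zorder h b) * (log_ratio r (norm (b - a)) - log_ratio r (norm b)))"
    unfolding l0 l1 by (simp add: right_diff_distrib sum_subtractf)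
  also have "\<dots> \<le> (\<Sum>b\<in>S. real_of_int (zorder h b) *
     ((if norm b \<le> M then ln M else 0) + (if norm b \<le> r / 2 then 2 * s / M else 0) + 4 * s / r))"
  proof (intro sum_mono mult_left_mono log_ratio_shift_le s M r)
    fix b show "norm b - s \<le> norm (b - a)" using a norm_triangle_ineq2[of b a] by linarith
  qed (use zorder_nonneg[OF h] in auto)
  also have "\<dots> = (\<Sum>b\<in>S. if norm b \<le> M then real_of_int (zorder h b) * ln M else 0)
    + (\<Sum>b\<in>S. if norm b \<le> r / 2 then real_of_int (zorder h b) * (2 * s / M) else 0)
    + (\<Sum>b\<in>S. real_of_int (zorder h b) * (4 * s / r))"
    unfolding sum.distrib[symmetric] by (intro sum.cong) (auto simp: distrib_left)
  also have "(\<Sum>b\<in>S. if norm b \<le> M then real_of_int (zorder h b) * ln M else 0) = ln M * unint_counting (zorder h) M"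
  proof -
    have "{b\<in>S. norm b \<le> M} = {b. norm b \<le> M \<and> h b = 0}" using r s M by (auto simp: S_def)
    then show ?thesis unfolding unint_counting_zorder[OF h] sum.inter_filter[OF fS, symmetric]
      by (simp add: sum_distrib_left mult.commute)
  qed
  also have "(\<Sum>b\<in>S. if norm b \<le> r / 2 then real_of_int (zorder h b) * (2 * s / M) else 0)
     = 2 * s / M * unint_counting (zorder h) (r / 2)"
  proof -
    have "{b\<in>S. norm b \<le> r / 2} = {b. norm b \<le> r / 2 \<and> h b = 0}" using r1 s by (auto simp: S_def)
    then show ?thesis unfolding unint_counting_zorder[OF h] sum.inter_filter[OF fS, symmetric]
      by (simp add: sum_distrib_left mult.commute)
  qed
  also have "(\<Sum>b\<in>S. real_of_int (zorder h b) * (4 * s / r)) = 4 * s / r * unint_counting (zorder h) (r + s)"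
    unfolding unint_counting_zorder[OF h] S_def by (simp add: sum_distrib_left mult.commute)
  finally show "circle_mean (\<lambda>z. ln (norm (h (z + a)))) r - circle_mean (\<lambda>z. ln (norm (h z))) r
    \<le> (K0 + ln M * unint_counting (zorder h) M) + 2 * s / M * unint_counting (zorder h) (r / 2)
      + 4 * s / r * unint_counting (zorder h) (r + s)"
    using circle_mean_eq[OF jensen[OF h r1]] circle_mean_eq[OF jensen[OF h' r1]]
    unfolding K0_def h'_def by linarith
qed

section \<open>Determinants of matrices given by functions\<close>

definition fdet :: "nat \<Rightarrow> (nat \<Rightarrow> nat \<Rightarrow> complex) \<Rightarrow> complex" where
  "fdet n M = det (mat n n (\<lambda>(i, j). M i j))"

text \<open>The entry (k, j) of the adjugate as an explicit signed minor, so that holomorphy, growth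
  and membership in a ring of functions are inherited from \<open>fdet\<close>.\<close>

definition fadj :: "nat \<Rightarrow> (nat \<Rightarrow> nat \<Rightarrow> complex) \<Rightarrow> nat \<Rightarrow> nat \<Rightarrow> complex" where
  "fadj n M k j = (-1) ^ (j + k) *
     fdet (n - 1) (\<lambda>i' j'. M (if i' < j then i' else Suc i') (if j' < k then j' else Suc j'))"

lemma fdet_expand:
  "fdet n M = (\<Sum>p | p permutes {0..<n}. signof p * (\<Prod>i\<in>{0..<n}. M i (p i)))"
proof -
  have "fdet n M = (\<Sum>p | p permutes {0..<n}. signof p * (\<Prod>i\<in>{0..<n}. mat n n (\<lambda>(i, j). M i j) $$ (i, p i)))"
    unfolding fdet_def by (rule det_def') auto
  also have "\<dots> = (\<Sum>p | p permutes {0..<n}. signof p * (\<Prod>i\<in>{0..<n}. M i (p i)))"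
  proof (intro sum.cong refl arg_cong2[where f = "(*)"] prod.cong)
    fix p i assume p: "p \<in> {p. p permutes {0..<n}}" "i \<in> {0..<n}"
    then have "p i < n" using permutes_in_image[of p "{0..<n}" i] by auto
    then show "mat n n (\<lambda>(i, j). M i j) $$ (i, p i) = M i (p i)" using p by simp
  qed
  finally show ?thesis .
qed

lemma fdet_cong: "(\<And>i j. i < n \<Longrightarrow> j < n \<Longrightarrow> M i j = N i j) \<Longrightarrow> fdet n M = fdet n N"
  unfolding fdet_def by (rule arg_cong[of _ _ det]) auto

lemma fdet_mult: "fdet n (\<lambda>i j. \<Sum>k<n. A i k * B k j) = fdet n A * fdet n B"
proof -
  have "mat n n (\<lambda>(i, j). \<Sum>k<n. A i k * B k j) = mat n n (\<lambda>(i, j). A i j) * mat n n (\<lambda>(i, j). B i j)"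
    by (rule eq_matI) (auto simp: scalar_prod_def atLeast0LessThan)
  then show ?thesis unfolding fdet_def by (simp add: det_mult[of _ n])
qed

lemma fdet_transpose: "fdet n (\<lambda>i j. M j i) = fdet n M"
proof -
  have "mat n n (\<lambda>(i, j). M j i) = transpose_mat (mat n n (\<lambda>(i, j). M i j))" by (rule eq_matI) auto
  then show ?thesis unfolding fdet_def by (simp add: det_transpose[of _ n])
qed

lemma fdet_scale_rows: "fdet n (\<lambda>i j. r i * M i j) = (\<Prod>i<n. r i) * fdet n M"
  unfolding fdet_expand by (simp add: prod.distrib sum_distrib_left mult_ac atLeast0LessThan)

lemma fdet_scale_cols: "fdet n (\<lambda>i j. r j * M i j) = (\<Prod>i<n. r i) * fdet n M"
  using fdet_scale_rows[of n r "\<lambda>i j. M j i"] fdet_transpose[of n M] fdet_transpose[of n "\<lambda>i j. r j * M i j"] by simp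

lemma fdet_diag: "fdet n (\<lambda>i j. if i = j then r i else 0) = (\<Prod>i<n. r i)"
proof -
  have "fdet n (\<lambda>i j. if i = j then r i else 0) = fdet n (\<lambda>i j. r i * (if i = j then 1 else 0))"
    by (rule fdet_cong) auto
  also have "\<dots> = (\<Prod>i<n. r i) * fdet n (\<lambda>i j. if i = j then 1 else 0)" by (rule fdet_scale_rows)
  also have "fdet n (\<lambda>i j. if i = j then 1 else 0) = 1"
  proof -
    have "mat n n (\<lambda>(i, j). if i = j then 1 else 0) = (1\<^sub>m n :: complex mat)" by (rule eq_matI) auto
    then show ?thesis unfolding fdet_def by simp
  qed
  finally show ?thesis by simp
qed

lemma fdet_zero_col: "j < n \<Longrightarrow> (\<And>i. i < n \<Longrightarrow> M i j = 0) \<Longrightarrow> fdet n M = 0"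
proof -
  assume j: "j < n" "\<And>i. i < n \<Longrightarrow> M i j = 0"
  have "fdet n M = fdet n (\<lambda>i k. (if k = j then 0 else 1) * M i k)"
    by (rule fdet_cong) (use j in auto)
  also have "\<dots> = 0" unfolding fdet_scale_cols using j by auto
  finally show ?thesis .
qed

text \<open>The bound is taken row by row because rows will correspond to the shifts \<nu>, each
  with its own factor.\<close>

lemma fdet_norm_le:
  assumes "\<And>i j. i < n \<Longrightarrow> j < n \<Longrightarrow> norm (M i j) \<le> X i"
  shows "norm (fdet n M) \<le> fact n * (\<Prod>i<n. X i)"
proof -
  have "norm (fdet n M) \<le> (\<Sum>p | p permutes {0..<n}. norm (signof p * (\<Prod>i\<in>{0..<n}. M i (p i))))"
    unfolding fdet_expand by (rule norm_sum)
  also have "\<dots> \<le> (\<Sum>p | p permutes {0..<n}. (\<Prod>i\<in>{0..<n}. X i))"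
  proof (rule sum_mono)
    fix p assume p: "p \<in> {p. p permutes {0..<n}}"
    have s: "\<bar>real_of_int (sign p)\<bar> = 1" by (simp add: sign_def)
    have "(\<Prod>i\<in>{0..<n}. norm (M i (p i))) \<le> (\<Prod>i\<in>{0..<n}. X i)"
    proof (rule prod_mono)
      fix i assume i: "i \<in> {0..<n}"
      then have "p i < n" using p permutes_in_image[of p "{0..<n}" i] by auto
      then show "0 \<le> norm (M i (p i)) \<and> norm (M i (p i)) \<le> X i" using assms i by auto
    qed
    then show "norm (signof p * (\<Prod>i\<in>{0..<n}. M i (p i))) \<le> (\<Prod>i\<in>{0..<n}. X i)"
      by (simp add: norm_mult s prod_norm[symmetric])
  qed
  also have "\<dots> = fact n * (\<Prod>i<n. X i)" by (simp add: card_permutations atLeast0LessThan)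
  finally show ?thesis .
qed

lemma fdet_holomorphic:
  assumes "\<And>i j. i < n \<Longrightarrow> j < n \<Longrightarrow> (\<lambda>z. M z i j) holomorphic_on S"
  shows "(\<lambda>z. fdet n (M z)) holomorphic_on S"
  unfolding fdet_expand
proof (intro holomorphic_intros)
  fix p i assume p: "p \<in> {p. p permutes {0..<n}}" "i \<in> {0..<n}"
  then have "p i < n" using permutes_in_image[of p "{0..<n}" i] by auto
  then show "(\<lambda>z. M z i (p i)) holomorphic_on S" using assms p by auto
qed

lemma fadj_eq: "k < n \<Longrightarrow> j < n \<Longrightarrow> fadj n M k j = adj_mat (mat n n (\<lambda>(i, j). M i j)) $$ (k, j)"
  unfolding adj_mat_def cofactor_def fadj_def fdet_def mat_delete_def
  by (auto intro!: arg_cong[of _ _ det])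

lemma fadj_right:
  assumes "i < n" "j < n"
  shows "(\<Sum>k<n. M i k * fadj n M k j) = (if i = j then fdet n M else 0)"
proof -
  define A where "A = mat n n (\<lambda>(i, j). M i j)"
  have A: "A \<in> carrier_mat n n" by (simp add: A_def)
  note adj = adj_mat[OF A]
  have "(\<Sum>k<n. M i k * fadj n M k j) = (A * adj_mat A) $$ (i, j)"
    using assms adj(1) A by (simp add: scalar_prod_def A_def fadj_eq atLeast0LessThan)
  then show ?thesis using adj(2) assms by (simp add: fdet_def A_def)
qed

lemma fadj_left:
  assumes "i < n" "j < n"
  shows "(\<Sum>k<n. fadj n M i k * M k j) = (if i = j then fdet n M else 0)"
proof -
  define A where "A = mat n n (\<lambda>(i, j). M i j)"
  have A: "A \<in> carrier_mat n n" by (simp add: A_def)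
  note adj = adj_mat[OF A]
  have "(\<Sum>k<n. fadj n M i k * M k j) = (adj_mat A * A) $$ (i, j)"
    using assms adj(1) A by (simp add: scalar_prod_def A_def fadj_eq atLeast0LessThan)
  then show ?thesis using adj(3) assms by (simp add: fdet_def A_def)
qed

lemma entire_divide_power:
  assumes "nz_entire h" "int m \<le> zorder h z0"
  shows "\<exists>k. k holomorphic_on UNIV \<and> (\<forall>z. h z = (z - z0) ^ m * k z)"
  using assms
proof (induction m arbitrary: h)
  case 0
  then show ?case by (intro exI[of _ h]) (auto simp: nz_entire_def)
next
  case (Suc m)
  have h0: "h z0 = 0" using Suc.prems zorder_nonzero_iff[of h z0] by auto
  define k where "k = (\<lambda>z. if z = z0 then deriv h z0 else (h z - h z0) / (z - z0))"
  have kh: "k holomorphic_on UNIV" unfolding k_def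
    by (rule pole_lemma) (use Suc.prems in \<open>auto simp: nz_entire_def\<close>)
  have e: "h z = (z - z0) * k z" for z using h0 by (simp add: k_def)
  then have k: "nz_entire k" using kh Suc.prems unfolding nz_entire_def by (metis mult_zero_right)
  have "h = (\<lambda>z. (z - z0) ^ 1 * k z)" using e by (intro ext) simp
  then have "zorder h z0 = zorder (\<lambda>z. (z - z0) ^ 1 * k z) z0" by (rule arg_cong)
  also have "\<dots> = 1 + zorder k z0"
    by (subst zorder_mult_entire[OF nz_entire_linear_power k]) (subst zorder_linear_power, simp)
  finally obtain l where "l holomorphic_on UNIV" "\<forall>z. k z = (z - z0) ^ m * l z"
    using Suc.IH[OF k] Suc.prems by auto
  then show ?case using e by (intro exI[of _ l]) (auto simp: mult_ac)
qed

text \<open>The power (z - z0)^(m j) divides every entry of column j and can be pulled out of the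
  determinant, leaving an entire cofactor.\<close>

lemma zorder_fdet_ge:
  assumes D: "nz_entire (\<lambda>z. fdet n (\<lambda>i j. M i j z))"
    and M: "\<And>i j. i < n \<Longrightarrow> j < n \<Longrightarrow> nz_entire (M i j)"
    and m: "\<And>i j. i < n \<Longrightarrow> j < n \<Longrightarrow> int (m j) \<le> zorder (M i j) z0"
  shows "int (\<Sum>j<n. m j) \<le> zorder (\<lambda>z. fdet n (\<lambda>i j. M i j z)) z0"
proof -
  have "\<exists>N. \<forall>i j. i < n \<longrightarrow> j < n \<longrightarrow> N i j holomorphic_on UNIV \<and> (\<forall>z. M i j z = (z - z0) ^ m j * N i j z)"
    using entire_divide_power[OF M m] by metis
  then obtain N where N: "\<And>i j. i < n \<Longrightarrow> j < n \<Longrightarrow> N i j holomorphic_on UNIV"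
    "\<And>i j z. i < n \<Longrightarrow> j < n \<Longrightarrow> M i j z = (z - z0) ^ m j * N i j z" by metis
  have e: "fdet n (\<lambda>i j. M i j z) = (z - z0) ^ (\<Sum>j<n. m j) * fdet n (\<lambda>i j. N i j z)" for z
  proof -
    have "fdet n (\<lambda>i j. M i j z) = fdet n (\<lambda>i j. (z - z0) ^ m j * N i j z)"
      by (rule fdet_cong) (use N in auto)
    then show ?thesis by (simp add: fdet_scale_cols power_sum)
  qed
  have "(\<lambda>z. fdet n (\<lambda>i j. N i j z)) holomorphic_on UNIV"
    by (rule fdet_holomorphic) (use N in auto)
  then have k: "nz_entire (\<lambda>z. fdet n (\<lambda>i j. N i j z))"
    using D e unfolding nz_entire_def by (metis mult_zero_right)
  have "zorder (\<lambda>z. fdet n (\<lambda>i j. M i j z)) z0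
     = int (\<Sum>j<n. m j) + zorder (\<lambda>z. fdet n (\<lambda>i j. N i j z)) z0"
    unfolding e by (subst zorder_mult_entire[OF nz_entire_linear_power k]) (subst zorder_linear_power, simp)
  then show ?thesis using zorder_nonneg[OF k, of z0] by simp
qed

section \<open>Linear systems over a domain of functions\<close>

text \<open>An integral domain under pointwise operations. No field of fractions is formed, so
  linear algebra over it proceeds by cross-multiplication.\<close>

definition function_domain :: "(complex \<Rightarrow> complex) set \<Rightarrow> bool" where
  "function_domain R \<longleftrightarrow> (\<lambda>z. 0) \<in> R \<and> (\<lambda>z. 1) \<in> R \<and>
     (\<forall>f\<in>R. \<forall>h\<in>R. (\<lambda>z. f z + h z) \<in> R \<and> (\<lambda>z. f z * h z) \<in> R \<and>
        ((\<forall>z. f z * h z = 0) \<longrightarrow> f = (\<lambda>z. 0) \<or> h = (\<lambda>z. 0))) \<and>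
     (\<forall>f\<in>R. (\<lambda>z. - f z) \<in> R)"

lemma function_domainD:
  assumes "function_domain R"
  shows "(\<lambda>z. 0) \<in> R" "(\<lambda>z. 1) \<in> R"
    "f \<in> R \<Longrightarrow> h \<in> R \<Longrightarrow> (\<lambda>z. f z + h z) \<in> R"
    "f \<in> R \<Longrightarrow> h \<in> R \<Longrightarrow> (\<lambda>z. f z * h z) \<in> R"
    "f \<in> R \<Longrightarrow> (\<lambda>z. - f z) \<in> R"
    "f \<in> R \<Longrightarrow> h \<in> R \<Longrightarrow> (\<And>z. f z * h z = 0) \<Longrightarrow> f = (\<lambda>z. 0) \<or> h = (\<lambda>z. 0)"
  using assms unfolding function_domain_def by blast+

lemma function_domain_sum:
  "function_domain R \<Longrightarrow> (\<And>i. i \<in> I \<Longrightarrow> f i \<in> R) \<Longrightarrow> (\<lambda>z. \<Sum>i\<in>I. f i z) \<in> R"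
  by (induction I rule: infinite_finite_induct) (simp_all add: function_domainD)

lemma function_domain_prod:
  "function_domain R \<Longrightarrow> (\<And>i. i \<in> I \<Longrightarrow> f i \<in> R) \<Longrightarrow> (\<lambda>z. \<Prod>i\<in>I. f i z) \<in> R"
  by (induction I rule: infinite_finite_induct) (simp_all add: function_domainD)

lemma function_domain_prod_nonzero:
  assumes R: "function_domain R" and "finite I" "\<And>i. i \<in> I \<Longrightarrow> f i \<in> R" "\<And>i. i \<in> I \<Longrightarrow> f i \<noteq> (\<lambda>z. 0)"
  shows "\<exists>z. (\<Prod>i\<in>I. f i z) \<noteq> 0"
  using assms(2-)
proof (induction I rule: finite_induct)
  case (insert i I)
  then obtain z where z: "(\<Prod>i\<in>I. f i z) \<noteq> 0" by blast
  have "(\<lambda>z. \<Prod>i\<in>I. f i z) \<noteq> (\<lambda>z. 0)"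
  proof
    assume "(\<lambda>z. \<Prod>i\<in>I. f i z) = (\<lambda>z. 0)"
    from fun_cong[OF this, of z] z show False by simp
  qed
  moreover have "(\<lambda>z. \<Prod>i\<in>I. f i z) \<in> R" by (rule function_domain_prod[OF R]) (use insert in auto)
  ultimately have "\<not> (\<forall>z. f i z * (\<Prod>i\<in>I. f i z) = 0)"
    using function_domainD(6)[OF R, of "f i"] insert.prems by blast
  then show ?case using insert by simp
qed auto

lemma function_domain_fdet:
  assumes R: "function_domain R" and "\<And>i j. i < n \<Longrightarrow> j < n \<Longrightarrow> M i j \<in> R"
  shows "(\<lambda>z. fdet n (\<lambda>i j. M i j z)) \<in> R"
  unfolding fdet_expand
proof (rule function_domain_sum[OF R])
  fix p assume p: "p \<in> {p. p permutes {0..<n}}"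
  have "(\<lambda>z. \<Prod>i\<in>{0..<n}. M i (p i) z) \<in> R"
  proof (rule function_domain_prod[OF R])
    fix i assume "i \<in> {0..<n}"
    then show "M i (p i) \<in> R" using p permutes_in_image[of p "{0..<n}" i] assms(2) by auto
  qed
  then show "(\<lambda>z. signof p * (\<Prod>i\<in>{0..<n}. M i (p i) z)) \<in> R"
    using function_domainD(5)[OF R] by (cases "evenperm p") (simp_all add: sign_def)
qed

text \<open>More vectors than coordinates are dependent. Fraction-free Gaussian elimination: a
  vector \<open>p\<close> with nonzero last coordinate serves as pivot, and the induction hypothesis
  applies to the remaining vectors.\<close>

lemma underdetermined_system:
  assumes R: "function_domain R"
  shows "finite J \<Longrightarrow> m < card J \<Longrightarrow> (\<And>j k. j \<in> J \<Longrightarrow> k < m \<Longrightarrow> V j k \<in> R) \<Longrightarrow>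
    \<exists>\<phi>. (\<forall>j\<in>J. \<phi> j \<in> R) \<and> (\<exists>j\<in>J. \<phi> j \<noteq> (\<lambda>z. 0)) \<and> (\<forall>k<m. \<forall>z. (\<Sum>j\<in>J. \<phi> j z * V j k z) = 0)"
proof (induction m arbitrary: J V)
  case 0
  then have "J \<noteq> {}" by auto
  moreover have "(\<lambda>z::complex. 1::complex) \<noteq> (\<lambda>z. 0)" by (auto simp: fun_eq_iff)
  ultimately show ?case by (intro exI[of _ "\<lambda>j z. 1"]) (auto simp: function_domainD[OF R])
next
  case (Suc m)
  show ?case
  proof (cases "\<forall>j\<in>J. V j m = (\<lambda>z. 0)")
    case True
    obtain \<phi> where "\<forall>j\<in>J. \<phi> j \<in> R" "\<exists>j\<in>J. \<phi> j \<noteq> (\<lambda>z. 0)" "\<forall>k<m. \<forall>z. (\<Sum>j\<in>J. \<phi> j z * V j k z) = 0"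
      using Suc.IH[of J V] Suc.prems by auto
    then show ?thesis using True by (intro exI[of _ \<phi>]) (auto simp: less_Suc_eq)
  next
    case False
    then obtain p where p: "p \<in> J" "V p m \<noteq> (\<lambda>z. 0)" by auto
    define J' where "J' = J - {p}"
    \<comment> \<open>Cross-multiplication with the pivot makes coordinate \<open>m\<close> vanish
      without division.\<close>
    define V' where "V' = (\<lambda>j k z. V p m z * V j k z + - (V j m z * V p k z))"
    have V'R: "V' j k \<in> R" if "j \<in> J'" "k < m" for j k
    proof -
      have "V p m \<in> R" "V j k \<in> R" "V j m \<in> R" "V p k \<in> R" using Suc.prems p that by (auto simp: J'_def)
      then show ?thesis unfolding V'_def by (intro function_domainD[OF R])
    qed
    have J': "finite J'" "m < card J'" using Suc.prems p by (auto simp: J'_def)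
    obtain \<phi> where \<phi>: "\<forall>j\<in>J'. \<phi> j \<in> R" "\<exists>j\<in>J'. \<phi> j \<noteq> (\<lambda>z. 0)"
      "\<And>k z. k < m \<Longrightarrow> (\<Sum>j\<in>J'. \<phi> j z * V' j k z) = 0"
    proof -
      have "\<exists>\<phi>. (\<forall>j\<in>J'. \<phi> j \<in> R) \<and> (\<exists>j\<in>J'. \<phi> j \<noteq> (\<lambda>z. 0)) \<and>
          (\<forall>k<m. \<forall>z. (\<Sum>j\<in>J'. \<phi> j z * V' j k z) = 0)"
        by (rule Suc.IH[OF J']) (rule V'R)
      then show ?thesis using that by blast
    qed
    \<comment> \<open>Undoing the elimination: the coefficients are multiplied by the pivot entry,
      and that of \<open>p\<close> is chosen to cancel coordinate \<open>m\<close>.\<close>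
    define \<psi> where "\<psi> = (\<lambda>j. if j = p then (\<lambda>z. - (\<Sum>j\<in>J'. \<phi> j z * V j m z)) else (\<lambda>z. \<phi> j z * V p m z))"
    have "\<psi> j \<in> R" if "j \<in> J" for j
    proof (cases "j = p")
      case True
      have "(\<lambda>z. \<Sum>j\<in>J'. \<phi> j z * V j m z) \<in> R"
      proof (rule function_domain_sum[OF R])
        fix j assume "j \<in> J'"
        then have "\<phi> j \<in> R" "V j m \<in> R" using \<phi>(1) Suc.prems by (auto simp: J'_def)
        then show "(\<lambda>z. \<phi> j z * V j m z) \<in> R" by (intro function_domainD[OF R])
      qed
      then show ?thesis using True function_domainD(5)[OF R] by (simp add: \<psi>_def)
    next
      case False
      then have "\<phi> j \<in> R" "V p m \<in> R" using \<phi>(1) Suc.prems p that by (auto simp: J'_def)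
      then show ?thesis using False function_domainD(4)[OF R] by (simp add: \<psi>_def)
    qed
    moreover have "\<exists>j\<in>J. \<psi> j \<noteq> (\<lambda>z. 0)"
    proof -
      obtain j where j: "j \<in> J'" "\<phi> j \<noteq> (\<lambda>z. 0)" using \<phi>(2) by auto
      moreover have "\<phi> j \<in> R" "V p m \<in> R" using j \<phi>(1) Suc.prems p by auto
      ultimately have "\<not> (\<forall>z. \<phi> j z * V p m z = 0)"
        using function_domainD(6)[OF R, of "\<phi> j" "V p m"] p(2) by blast
      then have "\<psi> j \<noteq> (\<lambda>z. 0)" using j by (auto simp: \<psi>_def J'_def fun_eq_iff)
      then show ?thesis using j by (auto simp: J'_def)
    qed
    moreover have "(\<Sum>j\<in>J. \<psi> j z * V j k z) = 0" if k: "k < Suc m" for k z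
    proof -
      have "(\<Sum>j\<in>J. \<psi> j z * V j k z) = \<psi> p z * V p k z + (\<Sum>j\<in>J'. \<psi> j z * V j k z)"
        using Suc.prems p by (simp add: J'_def sum.remove)
      also have "(\<Sum>j\<in>J'. \<psi> j z * V j k z) = (\<Sum>j\<in>J'. \<phi> j z * V p m z * V j k z)"
        by (intro sum.cong) (auto simp: \<psi>_def J'_def)
      also have "\<psi> p z * V p k z = - (\<Sum>j\<in>J'. \<phi> j z * V j m z * V p k z)"
        by (simp add: \<psi>_def sum_distrib_right)
      also have "\<dots> + (\<Sum>j\<in>J'. \<phi> j z * V p m z * V j k z) = (\<Sum>j\<in>J'. \<phi> j z * V' j k z)"
        unfolding sum_negf[symmetric] sum.distrib[symmetric] by (intro sum.cong) (auto simp: V'_def algebra_simps)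
      also have "\<dots> = 0"
      proof (cases "k = m")
        case True
        then show ?thesis by (simp add: V'_def mult.commute)
      next
        case False
        then show ?thesis using \<phi>(3) k by auto
      qed
      finally show ?thesis .
    qed
    ultimately show ?thesis by (intro exI[of _ \<psi>]) auto
  qed
qed

text \<open>Adding a unit vector to the n + 1 independent vectors forces a relation, whose
  coefficient at the unit vector cannot be zero. So a nonzero multiple of every unit vector is a
  combination of the rows, and the determinant divides a product of nonzero elements of a
  domain.\<close>

lemma independent_vectors_fdet_nonzero:
  assumes R: "function_domain R" "R \<subseteq> P1 c" and J: "finite J" "card J = n + 1"
    and a: "\<And>j k. j \<in> J \<Longrightarrow> k \<le> n \<Longrightarrow> a j k \<in> R"
    and ind: "P1_lin_indep_vec c n J a" and e: "bij_betw e {..<n+1} J"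
  shows "\<exists>z. fdet (n + 1) (\<lambda>i k. a (e i) k z) \<noteq> 0"
proof (rule ccontr)
  assume "\<not> ?thesis"
  then have z: "fdet (n + 1) (\<lambda>i k. a (e i) k z) = 0" for z by auto
  obtain N where N: "N \<notin> J" using J(1) infinite_UNIV_nat by (metis ex_new_if_finite)
  have "\<exists>d b. d \<in> R \<and> d \<noteq> (\<lambda>z. 0) \<and> (\<forall>k\<le>n. \<forall>z. (\<Sum>j\<in>J. b j z * a j k z) = (if k = k0 then d z else 0))" for k0
  proof -
    \<comment> \<open>The fresh index \<open>N\<close> carries the unit vector in direction
      \<open>k0\<close>.\<close>
    define V where "V = (\<lambda>j k. if j = N then (\<lambda>z::complex. if k = k0 then 1 else 0 :: complex) else a j k)"
    have "V j k \<in> R" if "j \<in> insert N J" "k < n + 1" for j k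
      using that a[of j k] function_domainD(1,2)[OF R(1)] by (auto simp: V_def)
    from underdetermined_system[OF R(1), of "insert N J" "n+1" V] this J N
    obtain \<phi> where \<phi>: "\<forall>j\<in>insert N J. \<phi> j \<in> R" "\<exists>j\<in>insert N J. \<phi> j \<noteq> (\<lambda>z. 0)"
      "\<forall>k<n+1. \<forall>z. (\<Sum>j\<in>insert N J. \<phi> j z * V j k z) = 0" by auto
    have s: "(\<Sum>j\<in>J. \<phi> j z * a j k z) = - (\<phi> N z * (if k = k0 then 1 else 0))" if "k \<le> n" for k z
    proof -
      have "(\<Sum>j\<in>insert N J. \<phi> j z * V j k z) = 0" using \<phi>(3) that by auto
      moreover have "(\<Sum>j\<in>insert N J. \<phi> j z * V j k z) = \<phi> N z * (if k = k0 then 1 else 0) + (\<Sum>j\<in>J. \<phi> j z * V j k z)"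
        using J N by (simp add: V_def)
      moreover have "(\<Sum>j\<in>J. \<phi> j z * V j k z) = (\<Sum>j\<in>J. \<phi> j z * a j k z)"
        using N by (intro sum.cong) (auto simp: V_def)
      ultimately show ?thesis by (metis add.commute eq_neg_iff_add_eq_0)
    qed
    have "\<phi> N \<noteq> (\<lambda>z. 0)"
    proof
      assume N0: "\<phi> N = (\<lambda>z. 0)"
      then have "\<forall>k\<le>n. eventually (\<lambda>z. (\<Sum>j\<in>J. \<phi> j z * a j k z) = 0) (cosparse UNIV)"
        using s by simp
      moreover have "\<forall>j\<in>J. \<phi> j \<in> P1 c" using \<phi>(1) R(2) by auto
      ultimately have "\<forall>j\<in>J. \<phi> j = (\<lambda>z. 0)"
        by (intro ind[unfolded P1_lin_indep_vec_def, THEN spec, of \<phi>, THEN mp] conjI)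
      then show False using \<phi>(2) N0 by auto
    qed
    moreover have "(\<Sum>j\<in>J. (- \<phi> j z) * a j k z) = (if k = k0 then \<phi> N z else 0)" if "k \<le> n" for k z
      using s[OF that, of z] by (simp add: sum_negf)
    moreover have "\<phi> N \<in> R" using \<phi>(1) by simp
    ultimately show ?thesis
      by (intro exI[of _ "\<phi> N"] exI[of _ "\<lambda>j z. - \<phi> j z"] conjI allI impI)
  qed
  then have "\<forall>k0. \<exists>d b. d \<in> R \<and> d \<noteq> (\<lambda>z. 0) \<and>
     (\<forall>k\<le>n. \<forall>z. (\<Sum>j\<in>J. b j z * a j k z) = (if k = k0 then d z else 0))" by blast
  from choice[OF this] obtain d where "\<forall>k0. \<exists>b. d k0 \<in> R \<and> d k0 \<noteq> (\<lambda>z. 0) \<and>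
     (\<forall>k\<le>n. \<forall>z. (\<Sum>j\<in>J. b j z * a j k z) = (if k = k0 then d k0 z else 0))" by blast
  from choice[OF this] obtain b where db: "\<And>k0. d k0 \<in> R" "\<And>k0. d k0 \<noteq> (\<lambda>z. 0)"
    "\<And>k0 k z. k \<le> n \<Longrightarrow> (\<Sum>j\<in>J. b k0 j z * a j k z) = (if k = k0 then d k0 z else 0)" by blast
  have "(\<Prod>k<n+1. d k z) = 0" for z
  proof -
    have "(\<Prod>k<n+1. d k z) = fdet (n + 1) (\<lambda>i k. if i = k then d i z else 0)" by (rule fdet_diag[symmetric])
    also have "\<dots> = fdet (n + 1) (\<lambda>i k. \<Sum>l<n+1. b i (e l) z * a (e l) k z)"
    proof (rule fdet_cong)
      fix i k assume k: "i < n + 1" "k < n + 1"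
      have "(\<Sum>l<n+1. b i (e l) z * a (e l) k z) = (\<Sum>j\<in>J. b i j z * a j k z)"
        by (rule sum.reindex_bij_betw[OF e])
      then show "(if i = k then d i z else 0) = (\<Sum>l<n+1. b i (e l) z * a (e l) k z)"
        using db(3)[of k i z] k by auto
    qed
    also have "\<dots> = fdet (n + 1) (\<lambda>i l. b i (e l) z) * fdet (n + 1) (\<lambda>l k. a (e l) k z)"
      by (rule fdet_mult)
    finally show ?thesis using z by simp
  qed
  moreover have "\<exists>z. (\<Prod>k<n+1. d k z) \<noteq> 0"
    by (rule function_domain_prod_nonzero[OF R(1)]) (use db in auto)
  ultimately show False by auto
qed

section \<open>A growth lemma of Borel type\<close>

text \<open>The increment x^(1-t) is, up to the factor t, the reciprocal of the derivative of x^t,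
  so each such step raises x^t by at most t.\<close>

lemma powr_add_le:
  fixes x t :: real
  assumes "0 < x" "0 < t" "t < 1"
  shows "(x + x powr (1 - t)) powr t \<le> x powr t + t"
proof -
  define y where "y = x + x powr (1 - t)"
  have y: "x < y" using assms by (simp add: y_def)
  obtain \<xi> where \<xi>: "x < \<xi>" "\<xi> < y" "y powr t - x powr t = (y - x) * (t * \<xi> powr (t - 1))"
  proof -
    have "\<exists>z>x. z < y \<and> y powr t - x powr t = (y - x) * (t * z powr (t - 1))"
      by (rule MVT2[OF y]) (use assms in \<open>auto intro!: has_real_derivative_powr\<close>)
    then show ?thesis using that by blast
  qed
  have "\<xi> powr (t - 1) \<le> x powr (t - 1)"
    using \<xi> assms by (intro powr_mono2') auto
  then have "(y - x) * (t * \<xi> powr (t - 1)) \<le> (y - x) * (t * x powr (t - 1))"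
    using y assms by (intro mult_left_mono) auto
  also have "\<dots> = t * (x powr (1 - t) * x powr (t - 1))" by (simp add: y_def)
  also have "x powr (1 - t) * x powr (t - 1) = 1" using assms by (simp add: powr_add[symmetric])
  finally show ?thesis using \<xi> by (simp add: y_def)
qed

text \<open>If doubling occurred within every window, iteration would give radii x_i with T(x_i)
  \<ge> 2^i, while x_i^t grows at most linearly in i. Then i ln 2 \<le> x_i^s = O(i^(s/t)),
  impossible as s < t. The predicate \<open>P\<close> keeps all radii in a prescribed dense
  set.\<close>

lemma growth_lemma:
  fixes T :: "real \<Rightarrow> real"
  assumes s: "0 < s" "s < t" "t < 1"
    and up: "eventually (\<lambda>r. T r \<le> exp (r powr s)) at_top"
    and low: "eventually (\<lambda>r. 1 \<le> T r) at_top"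
    and dense: "\<And>r::real. \<exists>r'\<ge>r. P r'"
  shows "\<exists>r\<ge>r0. P r \<and> (\<forall>R. P R \<and> r + r powr (1 - t) / 2 \<le> R \<and> R \<le> r + r powr (1 - t) \<longrightarrow> T R \<le> 2 * T r)"
proof (rule ccontr)
  assume neg: "\<not> ?thesis"
  obtain r1 where r1: "\<And>r. r \<ge> r1 \<Longrightarrow> T r \<le> exp (r powr s) \<and> 1 \<le> T r"
    using eventually_conj[OF up low] unfolding eventually_at_top_linorder by auto
  define B where "B = max 1 (max r0 r1)"
  obtain x0 where x0: "x0 \<ge> B" "P x0" using dense by auto
  have step: "\<exists>y. (P y \<and> B \<le> y) \<and> (y \<le> x + x powr (1 - t) \<and> 2 * T x \<le> T y)" if "P x \<and> B \<le> x" for x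
  proof -
    have "r0 \<le> x" using that by (simp add: B_def)
    then have "\<not> (\<forall>R. P R \<and> x + x powr (1 - t) / 2 \<le> R \<and> R \<le> x + x powr (1 - t) \<longrightarrow> T R \<le> 2 * T x)"
      using neg that by blast
    then obtain R where "P R" "x + x powr (1 - t) / 2 \<le> R" "R \<le> x + x powr (1 - t)" "\<not> T R \<le> 2 * T x"
      by blast
    moreover have "0 \<le> x powr (1 - t)" by simp
    ultimately show ?thesis using that by (intro exI[of _ R]) auto
  qed
  obtain x where x: "\<And>i. P (x i) \<and> B \<le> x i" "x 0 = x0"
    "\<And>i. x (Suc i) \<le> x i + x i powr (1 - t) \<and> 2 * T (x i) \<le> T (x (Suc i))"
  proof -
    have "\<exists>f. \<forall>n. ((P (f n) \<and> B \<le> f n) \<and> (n = 0 \<longrightarrow> f n = x0)) \<and>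
       (f (Suc n) \<le> f n + f n powr (1 - t) \<and> 2 * T (f n) \<le> T (f (Suc n)))"
      by (rule dependent_nat_choice) (use x0 step in auto)
    then show ?thesis using that by blast
  qed
  have xB: "1 \<le> x i" "T (x i) \<le> exp (x i powr s)" "1 \<le> T (x i)" for i
    using x(1)[of i] r1[of "x i"] by (auto simp: B_def)
  have Tl: "2 ^ i \<le> T (x i)" for i
  proof (induction i)
    case 0 show ?case using xB(3)[of 0] by simp
  next
    case (Suc i) then show ?case using x(3)[of i] by simp
  qed
  have xt: "x i powr t \<le> x0 powr t + t * real i" for i
  proof (induction i)
    case 0 show ?case using x(2) by simp
  next
    case (Suc i)
    have "x (Suc i) powr t \<le> (x i + x i powr (1 - t)) powr t"
      using x(3)[of i] xB(1)[of "Suc i"] s by (intro powr_mono2) auto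
    also have "\<dots> \<le> x i powr t + t" by (rule powr_add_le) (use xB(1)[of i] s in auto)
    finally show ?case using Suc.IH by (simp add: algebra_simps)
  qed
  define b where "b = s / t"
  have b: "0 < b" "b < 1" using s by (auto simp: b_def)
  define A where "A = x0 powr t"
  have A: "0 \<le> A" by (simp add: A_def)
  have bound: "real i * ln 2 \<le> (A + t * real i) powr b" for i
  proof -
    have "real i * ln 2 = ln (2 ^ i)" by (simp add: ln_realpow)
    also have "\<dots> \<le> ln (exp (x i powr s))" using order_trans[OF Tl xB(2)] by (intro ln_mono) auto
    also have "\<dots> = (x i powr t) powr b" using s by (simp add: powr_powr b_def)
    also have "\<dots> \<le> (A + t * real i) powr b" using xt b by (intro powr_mono2) (auto simp: A_def)
    finally show ?thesis .
  qed
  \<comment> \<open>With y = A + t i, an upper bound \<epsilon> y for y^b accounts for only half of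
    i ln 2, up to a constant; the other half gives the contradiction.\<close>
  define \<epsilon> where "\<epsilon> = ln 2 / (2 * t)"
  have e: "\<epsilon> > 0" using s by (simp add: \<epsilon>_def)
  have "((\<lambda>y. y powr (b - 1)) \<longlongrightarrow> 0) at_top"
    using b by (intro tendsto_neg_powr filterlim_ident) auto
  then have "eventually (\<lambda>y. y powr (b - 1) < \<epsilon>) at_top" using e by (rule order_tendstoD)
  moreover have "filterlim (\<lambda>i. A + t * real i) at_top sequentially"
    using s by (intro filterlim_tendsto_add_at_top[OF tendsto_const]
       filterlim_tendsto_pos_mult_at_top[OF tendsto_const] filterlim_real_sequentially) auto
  ultimately have "eventually (\<lambda>i. (A + t * real i) powr (b - 1) < \<epsilon>) sequentially"
    by (rule eventually_compose_filterlim)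
  moreover have "eventually (\<lambda>i. 2 * \<epsilon> * A / ln 2 < real i) sequentially"
    using filterlim_real_sequentially unfolding filterlim_at_top_dense by blast
  moreover have "eventually (\<lambda>i. 0 < i) sequentially" by (rule eventually_gt_at_top)
  ultimately have "eventually (\<lambda>i. False) sequentially"
  proof eventually_elim
    case (elim i)
    define y where "y = A + t * real i"
    have y: "0 < y" using A s elim by (simp add: y_def add_nonneg_pos)
    have "y powr b = y * y powr (b - 1)" using y by (simp add: powr_diff)
    also have "\<dots> \<le> y * \<epsilon>" using elim y by (intro mult_left_mono) (auto simp: y_def)
    finally have "real i * ln 2 \<le> y * \<epsilon>" using bound[of i] by (simp add: y_def)
    also have "y * \<epsilon> = A * \<epsilon> + real i * ln 2 / 2" using s by (simp add: y_def \<epsilon>_def field_simps)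
    finally have "real i * ln 2 \<le> 2 * (A * \<epsilon>)" by linarith
    then have "real i * ln 2 \<le> 2 * \<epsilon> * A" by (simp add: mult_ac)
    then show ?case using elim by (simp add: divide_less_eq)
  qed
  then show False by simp
qed

section \<open>Characteristic functions and the field of small periodic functions\<close>

lemma counting_zero: "counting (\<lambda>z. 0) r = 0"
  by (simp add: counting_def unint_counting_def)

lemma nevanlinna_T_entire:
  assumes "h holomorphic_on UNIV"
  shows "nevanlinna_T h r = circle_mean (\<lambda>z. ln (max 1 (norm (h z)))) r"
proof -
  have "\<not> is_pole h z" for z
    using assms by (metis UNIV_I analytic_at analytic_at_imp_isCont is_pole_def isCont_def
        not_tendsto_and_filterlim_at_infinity open_UNIV trivial_limit_at)
  then have "pole_mult h = (\<lambda>z. 0)" by (auto simp: pole_mult_def)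
  then show ?thesis by (simp add: nevanlinna_T_def counting_zero)
qed

lemma hyper_order_less_1I:
  assumes "filterlim T at_top at_top" "eventually (\<lambda>r. T r \<le> exp (r powr s)) at_top" "s < 1"
  shows "hyper_order T < 1"
proof -
  have "eventually (\<lambda>r. exp 1 \<le> T r) at_top" using assms(1) by (simp add: filterlim_at_top)
  with assms(2) eventually_gt_at_top[of "1::real"]
  have "eventually (\<lambda>r. ereal (ln (ln (T r)) / ln r) \<le> ereal s) at_top"
  proof eventually_elim
    case (elim r)
    have T0: "0 < T r" using elim(3) exp_gt_zero[of "1::real"] by linarith
    have l1: "1 \<le> ln (T r)" using elim(3) T0 by (metis ln_exp ln_le_cancel_iff exp_gt_zero)
    have "ln (T r) \<le> r powr s" using elim(1) T0 by (metis ln_exp ln_le_cancel_iff exp_gt_zero)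
    then have "ln (ln (T r)) \<le> ln (r powr s)" using l1 by (intro ln_mono) auto
    then have "ln (ln (T r)) \<le> s * ln r" using elim by (simp add: ln_powr)
    then show ?case using elim by (simp add: divide_le_eq)
  qed
  then have "hyper_order T \<le> ereal s" unfolding hyper_order_def by (rule Limsup_bounded)
  also have "\<dots> < 1" using assms(3) by simp
  finally show ?thesis .
qed

lemma hyper_order_less_1D:
  assumes "filterlim T at_top at_top" "hyper_order T < 1"
  obtains s where "0 < s" "s < 1" "eventually (\<lambda>r. T r \<le> exp (r powr s)) at_top"
proof -
  obtain s0 where s0: "hyper_order T < ereal s0" "ereal s0 < 1"
    using ereal_dense2[OF assms(2)] by auto
  \<comment> \<open>The maximum makes the exponent positive and keeps it below 1.\<close>
  define s where "s = max s0 (1/2)"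
  have s: "0 < s" "s < 1" "s0 \<le> s" using s0(2) by (auto simp: s_def)
  have "eventually (\<lambda>r. ereal (ln (ln (T r)) / ln r) < ereal s0) at_top"
    using s0(1) unfolding hyper_order_def by (rule Limsup_lessD)
  moreover have "eventually (\<lambda>r. exp 1 \<le> T r) at_top" using assms(1) by (simp add: filterlim_at_top)
  ultimately have "eventually (\<lambda>r. T r \<le> exp (r powr s)) at_top"
    using eventually_gt_at_top[of "1::real"]
  proof eventually_elim
    case (elim r)
    have T0: "0 < T r" using elim(2) exp_gt_zero[of "1::real"] by linarith
    have l1: "1 \<le> ln (T r)" using elim(2) T0 by (metis ln_exp ln_le_cancel_iff exp_gt_zero)
    have "ln (ln (T r)) \<le> s0 * ln r" using elim by (simp add: divide_less_eq less_imp_le)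
    also have "\<dots> \<le> s * ln r" using s elim by (intro mult_right_mono) auto
    also have "\<dots> = ln (r powr s)" using elim by (simp add: ln_powr)
    finally have "ln (T r) \<le> r powr s" using l1 elim by (subst (asm) ln_le_cancel_iff) auto
    then show ?case using T0 by (metis exp_le_cancel_iff exp_ln)
  qed
  then show ?thesis using that s by blast
qed

text \<open>Whatever value HOL assigns to ln (ln k), it is divided by ln r. This puts constants into
  \<open>P1 c\<close>.\<close>

lemma hyper_order_const: "hyper_order (\<lambda>r. k) < 1"
proof -
  have "((\<lambda>r::real. ln (ln k) / ln r) \<longlongrightarrow> 0) at_top"
    by (intro real_tendsto_divide_at_top[of _ "ln (ln k)"] tendsto_const ln_at_top)
  then have "((\<lambda>r::real. ereal (ln (ln k) / ln r)) \<longlongrightarrow> ereal 0) at_top" by simp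
  then have "hyper_order (\<lambda>r. k) = ereal 0"
    unfolding hyper_order_def by (intro lim_imp_Limsup) auto
  then show ?thesis by simp
qed

lemma const_in_P1: "(\<lambda>z. k) \<in> P1 c"
proof -
  have "circle_mean (\<lambda>z. ln (max 1 (norm k))) r = ln (max 1 (norm k))" for r
    by (rule circle_mean_eq[OF has_circle_mean_const])
  then have "nevanlinna_T (\<lambda>z. k) = (\<lambda>r. ln (max 1 (norm k)))"
    by (intro ext) (simp add: nevanlinna_T_entire)
  then show ?thesis using hyper_order_const by (auto simp: P1_def)
qed

lemma log_count_ge:
  assumes "nonzero_locus_finite \<mu>" "\<And>z. 0 \<le> \<mu> z" "\<mu> p \<noteq> 0" "1 \<le> r" "norm p \<le> r"
  shows "ln (r / max 1 (norm p)) \<le> log_count \<mu> r"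
proof -
  have fin: "finite {z. norm z \<le> r \<and> \<mu> z \<noteq> 0}" using assms(1) by (auto simp: nonzero_locus_finite_def)
  have nn: "0 \<le> ln (r / max 1 (norm z))" if "norm z \<le> r" for z :: complex
    using that assms(4) by (intro ln_ge_zero) (auto simp: le_divide_eq)
  have "ln (r / max 1 (norm p)) \<le> real_of_int (\<mu> p) * ln (r / max 1 (norm p))"
  proof -
    have "1 \<le> \<mu> p" using assms(2)[of p] assms(3) by linarith
    then have "1 * ln (r / max 1 (norm p)) \<le> real_of_int (\<mu> p) * ln (r / max 1 (norm p))"
      using nn[OF assms(5)] by (intro mult_right_mono) auto
    then show ?thesis by simp
  qed
  also have "\<dots> = (\<Sum>z\<in>{p}. real_of_int (\<mu> z) * ln (r / max 1 (norm z)))" by simp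
  also have "\<dots> \<le> log_count \<mu> r" unfolding log_count_def
    by (rule sum_mono2[OF fin]) (use assms nn in \<open>auto intro!: mult_nonneg_nonneg\<close>)
  finally show ?thesis .
qed

lemma ln_minus_const_at_top: "filterlim (\<lambda>r::real. ln (r / m) + k) at_top at_top" if "0 < m"
  using that by real_asymp

lemma log_count_at_top:
  assumes "nonzero_locus_finite \<mu>" "\<And>z. 0 \<le> \<mu> z" "\<mu> p \<noteq> 0"
  shows "filterlim (\<lambda>r. log_count \<mu> r + k) at_top at_top"
proof (rule filterlim_at_top_mono[OF ln_minus_const_at_top[of "max 1 (norm p)" k]])
  show "\<forall>\<^sub>F r in at_top. ln (r / max 1 (norm p)) + k \<le> log_count \<mu> r + k"
    using eventually_ge_at_top[of "max 1 (norm p)"]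
    by eventually_elim (use log_count_ge[OF assms] in auto)
qed auto

text \<open>Jensen's formula for h - h p: its zero at \<open>p\<close> alone makes the log count
  grow like ln r, and subtracting a constant changes the logarithmic mean by a bounded
  amount.\<close>

lemma entire_log_plus_mean_at_top:
  assumes h: "h holomorphic_on UNIV" and nc: "h p \<noteq> h q"
  shows "filterlim (\<lambda>r. circle_mean (\<lambda>z. ln (max 1 (norm (h z)))) r) at_top at_top"
proof -
  define f where "f = (\<lambda>z. h z - h p)"
  have f: "nz_entire f" unfolding nz_entire_def f_def
    using h nc by (auto intro!: holomorphic_intros exI[of _ q])
  have "f p = 0" by (simp add: f_def)
  define J where "J = circle_mean (\<lambda>z. ln (norm (f z))) 1"
  define k where "k = ln (1 + norm (h p))"
  have hc: "continuous_on S h" for S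
    using h holomorphic_on_imp_continuous_on holomorphic_on_subset by blast
  have "filterlim (\<lambda>r. log_count (zorder f) r + (J - k)) at_top at_top"
    by (rule log_count_at_top[OF zorder_locus_finite[OF f] zorder_nonneg[OF f], of p])
       (simp add: zorder_nonzero_iff[OF f] \<open>f p = 0\<close>)
  then show ?thesis
  proof (rule filterlim_at_top_mono)
    show "\<forall>\<^sub>F r in at_top. log_count (zorder f) r + (J - k) \<le> circle_mean (\<lambda>z. ln (max 1 (norm (h z)))) r"
      using eventually_ge_at_top[of 1]
    proof eventually_elim
      case (elim r)
      have m: "has_circle_mean (\<lambda>z. ln (max 1 (norm (h z))) + k) r (circle_mean (\<lambda>z. ln (max 1 (norm (h z)))) r + k)"
        by (intro has_circle_mean_add has_circle_mean_const has_circle_mean_continuous)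
           (use elim in \<open>auto intro!: continuous_intros hc\<close>)
      have "J + log_count (zorder f) r \<le> circle_mean (\<lambda>z. ln (max 1 (norm (h z)))) r + k"
      proof (rule has_circle_mean_le[OF jensen[OF f elim, folded J_def] m])
        fix z :: complex
        show "ln (norm (f z)) \<le> ln (max 1 (norm (h z))) + k"
        proof (cases "f z = 0")
          case False
          have "norm (f z) \<le> norm (h z) + norm (h p)" unfolding f_def by (rule norm_triangle_ineq4)
          also have "\<dots> \<le> max 1 (norm (h z)) * (1 + norm (h p))"
            unfolding distrib_left using mult_right_mono[of 1 "max 1 (norm (h z))" "norm (h p)"] by simp
          finally have "ln (norm (f z)) \<le> ln (max 1 (norm (h z)) * (1 + norm (h p)))"
            using False by (intro ln_mono) auto
          also have "\<dots> = ln (max 1 (norm (h z))) + k" unfolding k_def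
          proof (rule ln_mult_pos)
            show "0 < 1 + norm (h p)" by (rule add_pos_nonneg) auto
          qed auto
          finally show ?thesis .
        qed (simp add: k_def)
      qed (use elim in auto)
      then show ?case by linarith
    qed
  qed
qed

lemma circle_mean_log_plus_nonneg:
  assumes "0 < r" shows "0 \<le> circle_mean (\<lambda>z. ln (max 1 (norm (f z)))) r"
proof (cases "(\<lambda>\<theta>. ln (max 1 (norm (f (rcis r \<theta>))))) integrable_on {0..2*pi}")
  case True
  then have "has_circle_mean (\<lambda>z. ln (max 1 (norm (f z)))) r (circle_mean (\<lambda>z. ln (max 1 (norm (f z)))) r)"
    by (simp add: has_circle_mean_circle_mean_iff)
  from has_circle_mean_le[OF has_circle_mean_const this assms, of 0] show ?thesis by simp
qed (simp add: circle_mean_def not_integrable_integral)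

text \<open>An upper bound on the characteristic controls the iterated logarithm only where the
  characteristic is large. A pole or a nonconstant entire function makes it tend to infinity;
  constants are handled apart.\<close>

lemma in_P1I:
  assumes f: "f nicely_meromorphic_on UNIV" and per: "\<And>z. f (z + c) = f z"
    and fin: "nonzero_locus_finite (pole_mult f)"
    and up: "eventually (\<lambda>r. nevanlinna_T f r \<le> exp (r powr s)) at_top" "s < 1"
  shows "f \<in> P1 c"
proof -
  have "hyper_order (nevanlinna_T f) < 1"
  proof (cases "\<exists>p. is_pole f p")
    case True
    then obtain p where p: "is_pole f p" by blast
    have neg: "zorder f z < 0" if "is_pole f z" for z
    proof (rule isolated_pole_imp_neg_zorder[OF _ that])
      have "f meromorphic_on UNIV" using f by (simp add: nicely_meromorphic_on_def)
      then show "isolated_singularity_at f z"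
        by (meson meromorphic_on_isolated_singularity meromorphic_on_subset subset_UNIV)
    qed
    have pos: "0 \<le> pole_mult f z" for z using neg[of z] by (auto simp: pole_mult_def)
    have pp: "pole_mult f p \<noteq> 0" using neg[OF p] p by (auto simp: pole_mult_def)
    obtain K where K: "\<And>r. 1 \<le> r \<Longrightarrow> counting (pole_mult f) r = log_count (pole_mult f) r + K"
      using counting_eq_log_count[OF fin] by metis
    have "filterlim (nevanlinna_T f) at_top at_top"
    proof (rule filterlim_at_top_mono[OF log_count_at_top[OF fin pos pp, of K]])
      show "\<forall>\<^sub>F r in at_top. log_count (pole_mult f) r + K \<le> nevanlinna_T f r"
        using eventually_ge_at_top[of 1]
      proof eventually_elim
        case (elim r)
        then show ?case using K[OF elim] circle_mean_log_plus_nonneg[of r f] by (simp add: nevanlinna_T_def)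
      qed
    qed
    then show ?thesis using up by (rule hyper_order_less_1I)
  next
    case False
    then have "f analytic_on UNIV"
      using nicely_meromorphic_on_imp_analytic_at[OF f] analytic_on_analytic_at by blast
    then have h: "f holomorphic_on UNIV" by (rule analytic_imp_holomorphic)
    show ?thesis
    proof (cases "\<exists>p q. f p \<noteq> f q")
      case True
      then obtain p q where "f p \<noteq> f q" by blast
      from entire_log_plus_mean_at_top[OF h this]
      have "filterlim (\<lambda>r. circle_mean (\<lambda>z. ln (max 1 (norm (f z)))) r) at_top at_top" .
      moreover have "nevanlinna_T f = (\<lambda>r. circle_mean (\<lambda>z. ln (max 1 (norm (f z)))) r)"
        by (intro ext nevanlinna_T_entire[OF h])
      ultimately have "filterlim (nevanlinna_T f) at_top at_top" by simp
      then show ?thesis using up by (rule hyper_order_less_1I)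
    next
      case False
      then have "f = (\<lambda>z. f 0)" by blast
      then show ?thesis using const_in_P1[of "f 0" c] unfolding P1_def by simp
    qed
  qed
  then show ?thesis using f per by (simp add: P1_def)
qed

text \<open>Where \<open>B\<close> does not vanish, both 0 and ln |A / B| are at most U - ln |B|.
  The mean of ln |B| is, by Jensen, the log count of the zeros of \<open>B\<close>, which pays for
  the poles of the quotient.\<close>

lemma nevanlinna_T_quotient_le:
  assumes A: "A holomorphic_on UNIV" and B: "nz_entire B" and U: "continuous_on UNIV U"
    and AU: "\<And>z. A z \<noteq> 0 \<Longrightarrow> ln (norm (A z)) \<le> U z" and BU: "\<And>z. B z \<noteq> 0 \<Longrightarrow> ln (norm (B z)) \<le> U z"
  defines "\<phi> \<equiv> remove_sings (\<lambda>z. A z / B z)"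
  shows "\<phi> nicely_meromorphic_on UNIV" "nonzero_locus_finite (pole_mult \<phi>)"
    "\<And>z. B z \<noteq> 0 \<Longrightarrow> \<phi> z = A z / B z"
    "\<exists>K. \<forall>r\<ge>1. nevanlinna_T \<phi> r \<le> circle_mean U r + K"
proof -
  have Aa: "A analytic_on S" for S using A analytic_on_open analytic_on_subset by blast
  have mer: "(\<lambda>z. A z / B z) meromorphic_on S" for S
    by (intro meromorphic_intros analytic_on_imp_meromorphic_on Aa nz_entire_analytic[OF B])
  show "\<phi> nicely_meromorphic_on UNIV" unfolding \<phi>_def by (rule remove_sings_nicely_meromorphic[OF mer])
  have ana: "(\<lambda>z. A z / B z) analytic_on {z}" if "B z \<noteq> 0" for z
    using that by (intro analytic_intros Aa nz_entire_analytic[OF B]) auto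
  show eq: "\<phi> z = A z / B z" if "B z \<noteq> 0" for z
    unfolding \<phi>_def using remove_sings_at_analytic[OF ana[OF that]] .
  have iso: "isolated_singularity_at (\<lambda>z. A z / B z) z" for z
    by (rule meromorphic_on_isolated_singularity[OF mer])
  have pm: "0 \<le> pole_mult \<phi> z \<and> pole_mult \<phi> z \<le> zorder B z" for z
  proof (cases "is_pole \<phi> z")
    case True
    then have p: "is_pole (\<lambda>z. A z / B z) z" unfolding \<phi>_def using is_pole_remove_sings_iff[OF iso] by simp
    have z1: "zorder \<phi> z = zorder (\<lambda>z. A z / B z) z" unfolding \<phi>_def using zorder_remove_sings[OF iso] by simp
    have "\<exists>z. A z \<noteq> 0"
    proof (rule ccontr)
      assume "\<not> ?thesis"
      then have "(\<lambda>z. A z / B z) = (\<lambda>z. 0)" by auto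
      then show False using p by simp
    qed
    then have A': "nz_entire A" using A by (simp add: nz_entire_def)
    have "zorder (\<lambda>z. A z / B z) z = zorder A z - zorder B z"
      by (intro zorder_divide analytic_on_imp_meromorphic_on nz_entire_analytic nz_entire_frequently A' B)
    then show ?thesis using zorder_nonneg[OF A', of z] True z1 isolated_pole_imp_neg_zorder[OF iso p]
      by (simp add: pole_mult_def)
  next
    case False
    then show ?thesis using zorder_nonneg[OF B] by (simp add: pole_mult_def)
  qed
  show fin: "nonzero_locus_finite (pole_mult \<phi>)"
    unfolding nonzero_locus_finite_def
  proof
    fix r
    have "{z. norm z \<le> r \<and> pole_mult \<phi> z \<noteq> 0} \<subseteq> {z. norm z \<le> r \<and> zorder B z \<noteq> 0}"
      using pm zorder_nonneg[OF B] by (smt (verit) Collect_mono)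
    then show "finite {z. norm z \<le> r \<and> pole_mult \<phi> z \<noteq> 0}"
      using zorder_locus_finite[OF B] finite_subset unfolding nonzero_locus_finite_def by blast
  qed
  obtain K where K: "\<And>r. 1 \<le> r \<Longrightarrow> counting (pole_mult \<phi>) r = log_count (pole_mult \<phi>) r + K"
    using counting_eq_log_count[OF fin] by metis
  define J where "J = circle_mean (\<lambda>z. ln (norm (B z))) 1"
  have "nevanlinna_T \<phi> r \<le> circle_mean U r + (K - J)" if r: "1 \<le> r" for r
  proof -
    have Um: "has_circle_mean U r (circle_mean U r)"
      using has_circle_mean_continuous[OF continuous_on_subset[OF U]] r by auto
    have "circle_mean (\<lambda>z. ln (max 1 (norm (\<phi> z)))) r \<le> circle_mean U r - (J + log_count (zorder B) r)"
    proof (rule circle_mean_le_except[OF has_circle_mean_diff[OF Um jensen[OF B r, folded J_def]] _ finite_zeros_cball[OF B, of r]])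
      fix z :: complex assume "norm z = r" "z \<notin> {z. norm z \<le> r \<and> B z = 0}"
      then have b: "B z \<noteq> 0" by auto
      then show n: "0 \<le> U z - ln (norm (B z))" using BU[OF b] by simp
      show "ln (max 1 (norm (\<phi> z))) \<le> U z - ln (norm (B z))"
      proof (cases "norm (\<phi> z) \<le> 1")
        case True then show ?thesis using n by (simp add: max_def)
      next
        case False
        then have "A z \<noteq> 0" using eq[OF b] by auto
        then show ?thesis using False eq[OF b] AU[of z] b by (simp add: norm_divide ln_div)
      qed
    qed (use r in auto)
    moreover have "log_count (pole_mult \<phi>) r \<le> log_count (zorder B) r"
      by (rule log_count_mono[OF fin zorder_locus_finite[OF B] r]) (use pm in auto)
    ultimately show ?thesis using K[OF r] by (simp add: nevanlinna_T_def)
  qed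
  then show "\<exists>K. \<forall>r\<ge>1. nevanlinna_T \<phi> r \<le> circle_mean U r + K" by blast
qed

section \<open>Auxiliary facts on kernels, zero-free radii and growth\<close>

lemma fdet_kernel_trivial:
  assumes "fdet n M \<noteq> 0" "\<And>i. i < n \<Longrightarrow> (\<Sum>k<n. M i k * x k) = 0" "k < n"
  shows "x k = 0"
proof -
  have "0 = (\<Sum>i<n. fadj n M k i * (\<Sum>l<n. M i l * x l))" using assms(2) by simp
  also have "\<dots> = (\<Sum>l<n. (\<Sum>i<n. fadj n M k i * M i l) * x l)"
    unfolding sum_distrib_left sum_distrib_right by (subst sum.swap) (simp add: mult.assoc)
  also have "\<dots> = (\<Sum>l<n. (if k = l then fdet n M else 0) * x l)"
    by (intro sum.cong) (use fadj_left assms(3) in auto)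
  also have "\<dots> = fdet n M * x k"
    using assms(3) by (simp add: if_distrib[of "\<lambda>y. y * _"] sum.delta cong: if_cong)
  finally show ?thesis using assms(1) by simp
qed

lemma zero_free_radius:
  assumes "finite I" "\<And>i. i \<in> I \<Longrightarrow> nz_entire (f i)" "x < y"
  shows "\<exists>R. x < R \<and> R < y \<and> (\<forall>i\<in>I. \<forall>z. norm z = R \<longrightarrow> f i z \<noteq> 0)"
proof -
  define S where "S = (\<Union>i\<in>I. norm ` {z. norm z \<le> y \<and> f i z = 0})"
  have "finite S" unfolding S_def using assms finite_zeros_cball by auto
  then have "infinite ({x<..<y} - S)" using assms(3) by (simp add: infinite_Ioo)
  then obtain R where R: "R \<in> {x<..<y} - S" by (metis ex_in_conv finite.emptyI)
  then have "\<forall>i\<in>I. \<forall>z. norm z = R \<longrightarrow> f i z \<noteq> 0" by (force simp: S_def)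
  then show ?thesis using R by auto
qed

lemma nz_entire_eventually_cosparse: "nz_entire h \<Longrightarrow> eventually (\<lambda>z. h z \<noteq> 0) (cosparse UNIV)"
  by (simp add: eventually_cosparse_open_eq nz_entire_eventually)

lemma continuous_on_Max_image:
  fixes f :: "'i \<Rightarrow> 'a::topological_space \<Rightarrow> real"
  assumes "finite I" "I \<noteq> {}" "\<And>i. i \<in> I \<Longrightarrow> continuous_on A (f i)"
  shows "continuous_on A (\<lambda>z. Max ((\<lambda>i. f i z) ` I))"
  using assms
proof (induction I rule: finite_ne_induct)
  case (insert i I)
  then have "continuous_on A (\<lambda>z. max (f i z) (Max ((\<lambda>i. f i z) ` I)))"
    by (intro continuous_intros) auto
  then show ?case using insert by simp
qed auto

text \<open>A slightly larger exponent absorbs polynomial factors and a bounded shift of the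
  radius.\<close>

lemma poly_exp_powr_absorb:
  fixes s t A C :: real
  assumes "0 < s" "s < t"
  shows "eventually (\<lambda>r. C * (r + A) ^ 2 * exp ((r + A) powr s) \<le> exp (r powr t)) at_top"
proof -
  have "((\<lambda>r. (r + A) powr s / r powr t) \<longlongrightarrow> 0) at_top" using assms by real_asymp
  then have 1: "eventually (\<lambda>r. (r + A) powr s / r powr t < 1 / 2) at_top"
    by (rule order_tendstoD) auto
  have "((\<lambda>r. C * (r + A) ^ 2 / exp (r powr t / 2)) \<longlongrightarrow> 0) at_top" using assms by real_asymp
  then have 2: "eventually (\<lambda>r. C * (r + A) ^ 2 / exp (r powr t / 2) < 1) at_top"
    by (rule order_tendstoD) auto
  show ?thesis using 1 2 eventually_gt_at_top[of 0]
  proof eventually_elim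
    case (elim r)
    have "(r + A) powr s \<le> r powr t / 2" using elim by (simp add: divide_less_eq)
    moreover have "C * (r + A) ^ 2 \<le> exp (r powr t / 2)" using elim by (simp add: divide_less_eq)
    ultimately have "C * (r + A) ^ 2 * exp ((r + A) powr s) \<le> exp (r powr t / 2) * exp (r powr t / 2)"
      by (intro mult_mono) auto
    then show ?case by (simp add: exp_add[symmetric])
  qed
qed

lemma unint_counting_mono:
  assumes "nonzero_locus_finite \<mu>" "\<And>z. 0 \<le> \<mu> z" "r \<le> R"
  shows "unint_counting \<mu> r \<le> unint_counting \<mu> R"
  unfolding unint_counting_def
  by (rule sum_mono2) (use assms in \<open>auto simp: nonzero_locus_finite_def\<close>)

text \<open>The log count one unit further out suffices here, since ln ((r + 1) / r) \<ge> 1 / (r +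
  1); the polynomial loss is harmless for crude growth bounds.\<close>

lemma unint_counting_le:
  assumes "nonzero_locus_finite \<mu>" "\<And>z. 0 \<le> \<mu> z" "1 \<le> r"
  shows "unint_counting \<mu> r \<le> (r + 1) * log_count \<mu> (r + 1)"
proof -
  have "unint_counting \<mu> r * ln ((r + 1) / r) \<le> log_count \<mu> (r + 1)"
    by (rule unint_counting_le_log_count[OF assms(1,2,3)]) simp
  moreover have "1 / (r + 1) \<le> ln ((r + 1) / r)"
  proof -
    have "ln (r / (r + 1)) \<le> r / (r + 1) - 1" using assms(3) by (intro ln_le_minus_one) auto
    moreover have "ln (r / (r + 1)) = - ln ((r + 1) / r)" using assms(3) by (simp add: ln_div)
    moreover have "r / (r + 1) - 1 = - (1 / (r + 1))" using assms(3) by (simp add: field_simps)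
    ultimately show ?thesis by linarith
  qed
  then have "unint_counting \<mu> r * (1 / (r + 1)) \<le> unint_counting \<mu> r * ln ((r + 1) / r)"
    by (intro mult_left_mono unint_counting_nonneg assms)
  ultimately have "unint_counting \<mu> r * (1 / (r + 1)) \<le> log_count \<mu> (r + 1)" by linarith
  then show ?thesis using assms(3) by (simp add: field_simps)
qed

section \<open>Holomorphic curves of hyper-order less than one\<close>

locale slow_curve =
  fixes c :: complex and n :: nat and g :: "nat \<Rightarrow> complex \<Rightarrow> complex"
  assumes n1: "1 \<le> n" and entire: "entire_curve n g"
    and hyper: "hyper_order (cartan_T n g) < 1"
    and indep: "P1_lin_indep c {0..n} g"
begin

abbreviation "u \<equiv> cartan_u n g"
abbreviation "T \<equiv> cartan_T n g"

lemma g_holomorphic: "k \<le> n \<Longrightarrow> g k holomorphic_on S"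
  using entire holomorphic_on_subset unfolding entire_curve_def by blast

lemma
  shows u_ge: "k \<le> n \<Longrightarrow> g k z \<noteq> 0 \<Longrightarrow> ln (norm (g k z)) \<le> u z"
    and u_attained: "\<exists>k\<le>n. g k z \<noteq> 0 \<and> u z = ln (norm (g k z))"
proof -
  define S where "S = (\<lambda>k. ln (norm (g k z))) ` {k. k \<le> n \<and> g k z \<noteq> 0}"
  have S: "finite S" "S \<noteq> {}" using entire unfolding S_def entire_curve_def by auto
  have u: "u z = Max S" by (simp add: cartan_u_def S_def)
  show "k \<le> n \<Longrightarrow> g k z \<noteq> 0 \<Longrightarrow> ln (norm (g k z)) \<le> u z"
    unfolding u by (rule Max_ge[OF S(1)]) (auto simp: S_def)
  show "\<exists>k\<le>n. g k z \<noteq> 0 \<and> u z = ln (norm (g k z))"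
    using Max_in[OF S] unfolding u by (auto simp: S_def)
qed

lemma norm_g_le: "k \<le> n \<Longrightarrow> norm (g k z) \<le> exp (u z)"
proof (cases "g k z = 0")
  case False
  assume "k \<le> n"
  then have "ln (norm (g k z)) \<le> u z" using u_ge False by blast
  then show ?thesis using False by (metis exp_le_cancel_iff exp_ln zero_less_norm_iff)
qed auto

text \<open>The index set of the maximum in \<open>cartan_u\<close> varies with the point. Its
  exponential is the maximum of all |g k|, which is continuous and positive.\<close>

lemma u_continuous: "continuous_on S u"
proof -
  define M where "M = (\<lambda>z. Max ((\<lambda>k. norm (g k z)) ` {..n}))"
  have M: "M z = exp (u z)" for z
    unfolding M_def
  proof (rule Max_eqI)
    obtain k where k: "k \<le> n" "g k z \<noteq> 0" "u z = ln (norm (g k z))" using u_attained by blast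
    then show "exp (u z) \<in> (\<lambda>k. norm (g k z)) ` {..n}" by auto
  qed (use norm_g_le in auto)
  have "continuous_on S M" unfolding M_def
    by (rule continuous_on_Max_image)
       (auto intro!: continuous_on_norm holomorphic_on_imp_continuous_on g_holomorphic)
  then have "continuous_on S (\<lambda>z. ln (M z))" by (intro continuous_on_ln) (auto simp: M)
  then show ?thesis by (simp add: M)
qed

lemma mean_u: "0 \<le> r \<Longrightarrow> has_circle_mean u r (T r + u 0)"
  using has_circle_mean_continuous[OF u_continuous] by (simp add: cartan_T_def)

text \<open>Constants belong to \<open>P1 c\<close>, so independence over \<open>P1 c\<close>
  includes independence over the complex numbers.\<close>

lemma g_combination:
  assumes "k \<le> n" "l \<le> n" "k \<noteq> l" "a \<noteq> 0 \<or> b \<noteq> 0"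
  shows "nz_entire (\<lambda>z. a * g k z + b * g l z)"
proof -
  have "\<exists>z. a * g k z + b * g l z \<noteq> 0"
  proof (rule ccontr)
    assume no: "\<not> ?thesis"
    define \<phi> where "\<phi> = (\<lambda>i (z::complex). if i = k then a else if i = l then b else 0 :: complex)"
    have "(\<Sum>i\<in>{0..n}. \<phi> i z * g i z) = 0" for z
    proof -
      have "(\<Sum>i\<in>{0..n}. \<phi> i z * g i z) = (\<Sum>i\<in>{k, l}. \<phi> i z * g i z)"
        by (rule sum.mono_neutral_right) (use assms in \<open>auto simp: \<phi>_def\<close>)
      also have "\<dots> = a * g k z + b * g l z" using assms by (simp add: \<phi>_def)
      finally show ?thesis using no by auto
    qed
    moreover have "\<forall>i\<in>{0..n}. \<phi> i \<in> P1 c" by (auto simp: \<phi>_def const_in_P1)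
    ultimately have "\<forall>i\<in>{0..n}. \<phi> i = (\<lambda>z. 0)"
      by (intro indep[unfolded P1_lin_indep_def, THEN spec, of \<phi>, THEN mp]) simp
    then have "\<phi> k 0 = 0" "\<phi> l 0 = 0" using assms by (auto simp: fun_eq_iff)
    then show False using assms by (auto simp: \<phi>_def)
  qed
  then show ?thesis unfolding nz_entire_def using assms by (auto intro!: holomorphic_intros g_holomorphic)
qed

lemma g_nz_entire: assumes "k \<le> n" shows "nz_entire (g k)"
proof -
  have "\<exists>l\<le>n. l \<noteq> k" using n1 by (intro exI[of _ "if k = 0 then 1 else 0"]) auto
  then obtain l where "l \<le> n" "l \<noteq> k" by blast
  then show ?thesis using g_combination[of k l 1 0] assms by simp
qed

lemma log_count_le_T:
  assumes h: "nz_entire h" and le: "\<And>z. h z \<noteq> 0 \<Longrightarrow> ln (norm (h z)) \<le> u z + K"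
  obtains K' where "\<And>r. 1 \<le> r \<Longrightarrow> circle_mean (\<lambda>z. ln (norm (h z))) r \<le> T r + u 0 + K"
    "\<And>r. 1 \<le> r \<Longrightarrow> log_count (zorder h) r \<le> T r + K'"
proof
  define J where "J = circle_mean (\<lambda>z. ln (norm (h z))) 1"
  fix r :: real assume r: "1 \<le> r"
  have "J + log_count (zorder h) r \<le> T r + u 0 + K"
  proof (rule has_circle_mean_le_except[OF jensen[OF h r, folded J_def]
        has_circle_mean_add[OF mean_u has_circle_mean_const] _ finite_zeros_cball[OF h, of r]])
  qed (use r le in auto)
  then show "log_count (zorder h) r \<le> T r + (u 0 + K - J)"
    "circle_mean (\<lambda>z. ln (norm (h z))) r \<le> T r + u 0 + K"
    using circle_mean_eq[OF jensen[OF h r, folded J_def]] by linarith+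
qed

text \<open>The combination g 1 p * g 0 - g 0 p * g 1 is nonzero, vanishes at \<open>p\<close> and
  is dominated by a multiple of exp u; by Jensen its zero forces logarithmic growth of
  \<open>T\<close>.\<close>

lemma T_at_top: "filterlim T at_top at_top"
proof -
  obtain p where p: "g 0 p \<noteq> 0" using g_nz_entire[of 0] by (auto simp: nz_entire_def)
  define h where "h = (\<lambda>z. g 1 p * g 0 z + (- g 0 p) * g 1 z)"
  have h: "nz_entire h" unfolding h_def by (rule g_combination) (use n1 p in auto)
  have h0: "h p = 0" by (simp add: h_def)
  define M where "M = norm (g 1 p) + norm (g 0 p)"
  have M: "0 < M" using p by (simp add: M_def add_nonneg_pos)
  have "ln (norm (h z)) \<le> u z + ln M" if "h z \<noteq> 0" for z
  proof -
    have "norm (h z) \<le> norm (g 1 p) * norm (g 0 z) + norm (g 0 p) * norm (g 1 z)"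
      unfolding h_def by (rule order_trans[OF norm_triangle_ineq]) (simp add: norm_mult)
    also have "\<dots> \<le> norm (g 1 p) * exp (u z) + norm (g 0 p) * exp (u z)"
      by (intro add_mono mult_left_mono norm_g_le) (use n1 in auto)
    also have "\<dots> = exp (u z) * M" by (simp add: M_def algebra_simps)
    finally have "ln (norm (h z)) \<le> ln (exp (u z) * M)" using that by (intro ln_mono) auto
    then show ?thesis using M by (simp add: ln_mult)
  qed
  then obtain K where K: "\<And>r. 1 \<le> r \<Longrightarrow> log_count (zorder h) r \<le> T r + K"
    using log_count_le_T[OF h] by metis
  have "filterlim (\<lambda>r. log_count (zorder h) r + (- K)) at_top at_top"
    by (rule log_count_at_top[OF zorder_locus_finite[OF h] zorder_nonneg[OF h], of p])
       (simp add: zorder_nonzero_iff[OF h] h0)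
  then show ?thesis
  proof (rule filterlim_at_top_mono)
    show "\<forall>\<^sub>F r in at_top. log_count (zorder h) r + - K \<le> T r"
      using eventually_ge_at_top[of 1] by eventually_elim (use K in force)
  qed
qed

lemma T_growth: obtains s where "0 < s" "s < 1" "eventually (\<lambda>r. T r \<le> exp (r powr s)) at_top"
  using hyper_order_less_1D[OF T_at_top hyper] by metis

lemma g_counting_bounds:
  assumes "k \<le> n"
  obtains K where "0 \<le> K" "\<And>r. 1 \<le> r \<Longrightarrow> circle_mean (\<lambda>z. ln (norm (g k z))) r \<le> T r + K"
    "\<And>r. 1 \<le> r \<Longrightarrow> - K \<le> circle_mean (\<lambda>z. ln (norm (g k z))) r"
    "\<And>r. 1 \<le> r \<Longrightarrow> log_count (zorder (g k)) r \<le> T r + K"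
proof -
  note h = g_nz_entire[OF assms]
  obtain K' where K': "\<And>r. 1 \<le> r \<Longrightarrow> circle_mean (\<lambda>z. ln (norm (g k z))) r \<le> T r + u 0 + 0"
    "\<And>r. 1 \<le> r \<Longrightarrow> log_count (zorder (g k)) r \<le> T r + K'"
    using log_count_le_T[OF h, of 0] u_ge[OF assms] by (metis add.right_neutral)
  define J where "J = circle_mean (\<lambda>z. ln (norm (g k z))) 1"
  have J: "J \<le> circle_mean (\<lambda>z. ln (norm (g k z))) r" if "1 \<le> r" for r
    using circle_mean_eq[OF jensen[OF h that, folded J_def]] log_count_nonneg[OF that zorder_nonneg[OF h]] by simp
  show ?thesis
  proof (rule that[of "\<bar>u 0\<bar> + \<bar>K'\<bar> + \<bar>J\<bar>"])
    fix r :: real assume r: "1 \<le> r"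
    show "circle_mean (\<lambda>z. ln (norm (g k z))) r \<le> T r + (\<bar>u 0\<bar> + \<bar>K'\<bar> + \<bar>J\<bar>)"
      using K'(1)[OF r] by linarith
    show "log_count (zorder (g k)) r \<le> T r + (\<bar>u 0\<bar> + \<bar>K'\<bar> + \<bar>J\<bar>)" using K'(2)[OF r] by linarith
    show "- (\<bar>u 0\<bar> + \<bar>K'\<bar> + \<bar>J\<bar>) \<le> circle_mean (\<lambda>z. ln (norm (g k z))) r" using J[OF r] by linarith
  qed auto
qed

text \<open>\<open>u\<close> is compared with ln |g 0|, because only the quotients g k / g 0 have
  boundary values controlled by \<open>T\<close>. Poisson-Jensen bounds them pointwise at z + a, and
  the singular logarithms are then averaged over \<open>z\<close>.\<close>

lemma u_shift_mean_le:
  assumes B: "\<And>z. norm z = R \<Longrightarrow> \<forall>k\<le>n. g k z \<noteq> 0" and r: "1 \<le> r" and R: "r + norm a + 1 \<le> R"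
  shows "circle_mean (\<lambda>z. u (z + a)) r \<le> circle_mean (\<lambda>z. ln (norm (g 0 (z + a)))) r
     + (2 * R * circle_mean (\<lambda>z. u z - ln (norm (g 0 z))) R + unint_counting (zorder (g 0)) R * ln (2 * R))"
proof -
  note g0 = g_nz_entire[of 0, simplified]
  define w where "w = (\<lambda>z. u z - ln (norm (g 0 z)))"
  have R0: "0 < R" "1 \<le> R" using r R norm_ge_zero[of a] by linarith+
  have wc: "continuous_on (sphere 0 R) w" unfolding w_def
    using B by (auto intro!: continuous_intros u_continuous nz_entire_continuous g0)
  define Z where "Z = {b. norm b \<le> R \<and> g 0 b = 0}"
  define V where "V = (\<lambda>z. ln (norm (g 0 (z + a))) + (2 * R * circle_mean w R
      + (\<Sum>b\<in>Z. real_of_int (zorder (g 0) b) * (ln (2 * R) - ln (norm (z - (b - a)))))))"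
  have h': "nz_entire (\<lambda>z. g 0 (z + a))" by (rule nz_entire_shift[OF g0])
  have V: "has_circle_mean V r (circle_mean (\<lambda>z. ln (norm (g 0 (z + a)))) r + (2 * R * circle_mean w R
      + (\<Sum>b\<in>Z. real_of_int (zorder (g 0) b) * (ln (2 * R) - ln (max r (norm (b - a)))))))"
    unfolding V_def
    by (intro has_circle_mean_add has_circle_mean_const has_circle_mean_sum has_circle_mean_cmult
         has_circle_mean_diff mean_ln_dist)
       (use r jensen[OF h' r] circle_mean_eq[OF jensen[OF h' r]] in auto)
  have U: "has_circle_mean (\<lambda>z. u (z + a)) r (circle_mean (\<lambda>z. u (z + a)) r)"
    by (rule has_circle_mean_continuous[OF continuous_on_compose2[OF u_continuous[of UNIV]]])
       (use r in \<open>auto intro!: continuous_intros\<close>)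
  have "circle_mean (\<lambda>z. u (z + a)) r \<le> circle_mean (\<lambda>z. ln (norm (g 0 (z + a)))) r + (2 * R * circle_mean w R
      + (\<Sum>b\<in>Z. real_of_int (zorder (g 0) b) * (ln (2 * R) - ln (max r (norm (b - a))))))"
  proof (rule has_circle_mean_le_except[OF U V _ finite_zeros_cball[OF h', of r]])
    fix z :: complex assume z: "norm z = r" "z \<notin> {z. norm z \<le> r \<and> g 0 (z + a) = 0}"
    define y where "y = z + a"
    have y0: "g 0 y \<noteq> 0" using z by (simp add: y_def)
    have ny: "norm y \<le> R - 1" unfolding y_def using z R norm_triangle_ineq[of z a] by linarith
    obtain k where k: "k \<le> n" "g k y \<noteq> 0" "u y = ln (norm (g k y))" using u_attained by blast
    have "ln (norm (g k y)) - ln (norm (g 0 y)) \<le> (R + norm y) / (R - norm y) * circle_mean w R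
      + (\<Sum>b | norm b \<le> R \<and> g 0 b = 0. real_of_int (zorder (g 0) b) * green R y b)"
    proof (rule quotient_le_poisson_mean[OF g_nz_entire[OF k(1)] g0 R0(1) _ k(2) y0 _ wc])
      fix z :: complex assume z: "norm z = R"
      show "0 \<le> w z" unfolding w_def using u_ge[of 0 z] B[OF z] by simp
      show "ln (norm (g k z)) - ln (norm (g 0 z)) \<le> w z" unfolding w_def using u_ge[of k z] B[OF z] k(1) by simp
    qed (use ny B k(1) in auto)
    also have "\<dots> \<le> 2 * R * circle_mean w R
      + (\<Sum>b\<in>Z. real_of_int (zorder (g 0) b) * (ln (2 * R) - ln (norm (z - (b - a)))))"
      unfolding Z_def[symmetric]
    proof (intro add_mono mult_right_mono sum_mono mult_left_mono)
      \<comment> \<open>The margin of 1 between |y| and \<open>R\<close> makes the denominator at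
        least 1.\<close>
      have "(R + norm y) / (R - norm y) \<le> (2 * R) / 1" by (rule frac_le) (use ny R0 in auto)
      then show "(R + norm y) / (R - norm y) \<le> 2 * R" by simp
      show "0 \<le> circle_mean w R"
        by (rule circle_mean_nonneg[OF wc R0(1)]) (use u_ge[of 0] B in \<open>auto simp: w_def\<close>)
      fix b assume b: "b \<in> Z"
      then have yb: "y \<noteq> b" using y0 by (auto simp: Z_def)
      have nz: "of_real (R\<^sup>2) - cnj b * y \<noteq> 0"
        by (rule reflection_nonzero[OF R0(1)]) (use ny b in \<open>auto simp: Z_def\<close>)
      have "norm (of_real (R\<^sup>2) - cnj b * y) \<le> R\<^sup>2 + norm b * norm y"
        by (rule order_trans[OF norm_triangle_ineq4]) (simp add: norm_mult norm_power)
      also have "\<dots> \<le> R\<^sup>2 + R * R" using b ny R0 by (intro add_left_mono mult_mono) (auto simp: Z_def)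
      finally have "norm (of_real (R\<^sup>2) - cnj b * y) / (R * norm (y - b)) \<le> (2 * R * R) / (R * norm (y - b))"
        using R0 by (intro divide_right_mono) (auto simp: power2_eq_square)
      also have "\<dots> = 2 * R / norm (y - b)" using R0 by simp
      finally have "green R y b \<le> ln (2 * R / norm (y - b))"
        unfolding green_def using nz yb R0 by (intro ln_mono) (auto intro!: divide_pos_pos mult_pos_pos)
      also have "\<dots> = ln (2 * R) - ln (norm (y - b))" using yb R0 by (simp add: ln_div)
      also have "y - b = z - (b - a)" by (simp add: y_def)
      finally show "green R y b \<le> ln (2 * R) - ln (norm (z - (b - a)))" .
    qed (use zorder_nonneg[OF g0] in auto)
    finally show "u (z + a) \<le> V z" using k(3) unfolding V_def y_def by linarith
  qed (use r in auto)
  \<comment> \<open>The subtracted terms ln (max r |b - a|) are nonnegative since r \<ge> 1.\<close>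
  also have "\<dots> \<le> circle_mean (\<lambda>z. ln (norm (g 0 (z + a)))) r + (2 * R * circle_mean w R
      + (\<Sum>b\<in>Z. real_of_int (zorder (g 0) b) * ln (2 * R)))"
    using r zorder_nonneg[OF g0] by (intro add_left_mono sum_mono mult_left_mono) auto
  also have "(\<Sum>b\<in>Z. real_of_int (zorder (g 0) b) * ln (2 * R)) = unint_counting (zorder (g 0)) R * ln (2 * R)"
    unfolding unint_counting_zorder[OF g0] Z_def by (simp add: sum_distrib_right)
  finally show ?thesis unfolding w_def .
qed

text \<open>Only a crude bound is needed: it serves to show that quotients of Casoratian minors,
  which involve shifted \<open>g k\<close>, have hyper-order less than one.\<close>

lemma u_shift_growth:
  assumes s: "0 < s" "s < t" and Ts: "eventually (\<lambda>r. T r \<le> exp (r powr s)) at_top"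
  shows "eventually (\<lambda>r. circle_mean (\<lambda>z. u (z + a)) r \<le> exp (r powr t)) at_top"
proof -
  note g0 = g_nz_entire[of 0, simplified]
  obtain r0 where r0: "\<And>r. r0 \<le> r \<Longrightarrow> T r \<le> exp (r powr s)"
    using Ts unfolding eventually_at_top_linorder by auto
  obtain K where K: "0 \<le> K" "\<And>r. 1 \<le> r \<Longrightarrow> circle_mean (\<lambda>z. ln (norm (g 0 z))) r \<le> T r + K"
    "\<And>r. 1 \<le> r \<Longrightarrow> - K \<le> circle_mean (\<lambda>z. ln (norm (g 0 z))) r"
    "\<And>r. 1 \<le> r \<Longrightarrow> log_count (zorder (g 0)) r \<le> T r + K"
    using g_counting_bounds[of 0] by auto
  define s0 where "s0 = norm a"
  obtain K2 where K2: "\<And>r. 2 * (2 * s0 + 2) \<le> r \<Longrightarrow>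
    circle_mean (\<lambda>z. ln (norm (g 0 (z + a)))) r - circle_mean (\<lambda>z. ln (norm (g 0 z))) r
    \<le> K2 + 2 * s0 / (2 * s0 + 2) * unint_counting (zorder (g 0)) (r / 2) + 4 * s0 / r * unint_counting (zorder (g 0)) (r + s0)"
    using jensen_shift[OF g0, of a s0 "2 * s0 + 2"] by (auto simp: s0_def)
  \<comment> \<open>The auxiliary radius \<open>R\<close> stays below r + s0 + 2 and the zero counts
    use R + 1, so r + A dominates every radius that occurs.\<close>
  define A where "A = s0 + 3"
  define C where "C = (1 + K + \<bar>K2\<bar>) + 3 * (1 + K) + 2 * (1 + 2 * K + \<bar>u 0\<bar>) + 2 * (1 + K)"
  have s00: "0 \<le> s0" by (simp add: s0_def)
  show ?thesis
    using poly_exp_powr_absorb[OF s, of C A] eventually_ge_at_top[of r0] eventually_ge_at_top[of 1]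
      eventually_ge_at_top[of "2 * (2 * s0 + 2)"]
  proof eventually_elim
    case (elim r)
    define X where "X = r + A"
    define E where "E = exp (X powr s)"
    have X: "1 \<le> X" "r + s0 + 3 = X" using elim s00 by (auto simp: X_def A_def)
    have E: "1 \<le> E" using X by (simp add: E_def)
    have TE: "T x \<le> E" if "r \<le> x" "x \<le> X" for x
    proof -
      have "T x \<le> exp (x powr s)" using r0[of x] elim that by auto
      also have "\<dots> \<le> E" unfolding E_def using that elim s by (intro iffD2[OF exp_le_cancel_iff] powr_mono2) auto
      finally show ?thesis .
    qed
    have "\<exists>R. r + s0 + 1 < R \<and> R < r + s0 + 2 \<and> (\<forall>k\<in>{..n}. \<forall>z. norm z = R \<longrightarrow> g k z \<noteq> 0)"
      by (rule zero_free_radius) (auto intro: g_nz_entire)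
    then obtain R where R: "r + s0 + 1 < R" "R < r + s0 + 2" "\<And>z. norm z = R \<Longrightarrow> \<forall>k\<le>n. g k z \<noteq> 0" by auto
    have R1: "1 \<le> R" "R \<le> X" "R + 1 \<le> X" "r \<le> R" using R elim s00 X by auto
    have nb: "unint_counting (zorder (g 0)) x \<le> X * (E * (1 + K))" if "x \<le> R" for x
    proof -
      have "unint_counting (zorder (g 0)) x \<le> unint_counting (zorder (g 0)) R"
        by (rule unint_counting_mono[OF zorder_locus_finite[OF g0] zorder_nonneg[OF g0] that])
      also have "\<dots> \<le> (R + 1) * log_count (zorder (g 0)) (R + 1)"
        by (rule unint_counting_le[OF zorder_locus_finite[OF g0] zorder_nonneg[OF g0] R1(1)])
      also have "\<dots> \<le> X * (E * (1 + K))"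
      proof (rule mult_mono)
        have "log_count (zorder (g 0)) (R + 1) \<le> T (R + 1) + K" using K(4)[of "R + 1"] R1 by simp
        also have "\<dots> \<le> E + E * K" using TE[of "R + 1"] R1 mult_right_mono[OF E K(1)] by simp
        finally show "log_count (zorder (g 0)) (R + 1) \<le> E * (1 + K)" by (simp add: algebra_simps)
      qed (use R1 log_count_nonneg[OF _ zorder_nonneg[OF g0]] X in auto)
      finally show ?thesis .
    qed
    have n0: "0 \<le> unint_counting (zorder (g 0)) x" for x by (rule unint_counting_nonneg[OF zorder_nonneg[OF g0]])
    have XX: "X \<le> X\<^sup>2" "1 \<le> X\<^sup>2" using X(1) by (auto intro: self_le_power one_le_power)
    \<comment> \<open>As X and E are at least 1, every error term is a constant times X^2 E;
      \<open>C\<close> adds up these constants.\<close>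
    have one: "k \<le> X\<^sup>2 * E * k" "k * E \<le> X\<^sup>2 * E * k" "X * (E * k) \<le> X\<^sup>2 * E * k" if "0 \<le> k" for k
    proof -
      have "1 \<le> X\<^sup>2 * E" using mult_mono[of 1 "X\<^sup>2" 1 E] XX E by simp
      then show "k \<le> X\<^sup>2 * E * k" using that mult_right_mono[of 1 "X\<^sup>2 * E" k] by simp
      have "1 * (E * k) \<le> X\<^sup>2 * (E * k)" using XX E that by (intro mult_right_mono) auto
      then show "k * E \<le> X\<^sup>2 * E * k" by (simp add: mult_ac)
      have "X * (E * k) \<le> X\<^sup>2 * (E * k)" using XX E that by (intro mult_right_mono) auto
      then show "X * (E * k) \<le> X\<^sup>2 * E * k" by (simp add: mult_ac)
    qed
    have b1: "circle_mean (\<lambda>z. ln (norm (g 0 (z + a)))) r \<le> X\<^sup>2 * E * ((1 + K + \<bar>K2\<bar>) + 3 * (1 + K))"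
    proof -
      have "circle_mean (\<lambda>z. ln (norm (g 0 (z + a)))) r \<le> T r + K + K2
        + 2 * s0 / (2 * s0 + 2) * unint_counting (zorder (g 0)) (r / 2) + 4 * s0 / r * unint_counting (zorder (g 0)) (r + s0)"
        using K2[of r] K(2)[of r] elim by linarith
      also have "\<dots> \<le> E + K + \<bar>K2\<bar> + 1 * (X * (E * (1 + K))) + 2 * (X * (E * (1 + K)))"
      proof (intro add_mono mult_mono nb n0)
        show "T r \<le> E" using TE[of r] R1 by simp
        show "2 * s0 / (2 * s0 + 2) \<le> 1" using s00 by simp
        show "4 * s0 / r \<le> 2" using elim s00 by (simp add: divide_le_eq)
        show "r / 2 \<le> R" using R1 elim by simp
        show "r + s0 \<le> R" using R by simp
      qed (use elim s00 in auto)
      also have "\<dots> = (1 * E + (K + \<bar>K2\<bar>)) + 3 * (X * (E * (1 + K)))" by (simp add: algebra_simps)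
      also have "\<dots> \<le> (X\<^sup>2 * E * 1 + X\<^sup>2 * E * (K + \<bar>K2\<bar>)) + 3 * (X\<^sup>2 * E * (1 + K))"
        using one(1)[of "K + \<bar>K2\<bar>"] one(2)[of 1] one(3)[of "1 + K"] K(1) by (intro add_mono mult_left_mono) auto
      finally show ?thesis by (simp add: algebra_simps)
    qed
    have b2: "2 * R * circle_mean (\<lambda>z. u z - ln (norm (g 0 z))) R \<le> X\<^sup>2 * E * (2 * (1 + 2 * K + \<bar>u 0\<bar>))"
    proof -
      have "has_circle_mean (\<lambda>z. u z - ln (norm (g 0 z))) R ((T R + u 0) - circle_mean (\<lambda>z. ln (norm (g 0 z))) R)"
        by (intro has_circle_mean_diff mean_u)
           (use R1 circle_mean_eq[OF jensen[OF g0 R1(1)]] jensen[OF g0 R1(1)] in auto)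
      then have e: "circle_mean (\<lambda>z. u z - ln (norm (g 0 z))) R = (T R + u 0) - circle_mean (\<lambda>z. ln (norm (g 0 z))) R"
        by (rule circle_mean_eq)
      have "circle_mean (\<lambda>z. u z - ln (norm (g 0 z))) R \<le> E + (\<bar>u 0\<bar> + K)"
        unfolding e using K(3)[OF R1(1)] TE[of R] R1 by simp
      also have "\<dots> \<le> E + E * (\<bar>u 0\<bar> + 2 * K)"
        using mult_right_mono[OF E, of "\<bar>u 0\<bar> + 2 * K"] K(1) by simp
      finally have "circle_mean (\<lambda>z. u z - ln (norm (g 0 z))) R \<le> E * (1 + 2 * K + \<bar>u 0\<bar>)"
        by (simp add: algebra_simps)
      then have "2 * R * circle_mean (\<lambda>z. u z - ln (norm (g 0 z))) R \<le> 2 * R * (E * (1 + 2 * K + \<bar>u 0\<bar>))"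
        using R1 by (intro mult_left_mono) auto
      also have "\<dots> \<le> 2 * X * (E * (1 + 2 * K + \<bar>u 0\<bar>))"
        using R1 E K(1) by (intro mult_right_mono mult_nonneg_nonneg) auto
      also have "\<dots> \<le> 2 * (X\<^sup>2 * E * (1 + 2 * K + \<bar>u 0\<bar>))"
        using one(3)[of "1 + 2 * K + \<bar>u 0\<bar>"] K(1) by simp
      finally show ?thesis by (simp add: algebra_simps)
    qed
    have b3: "unint_counting (zorder (g 0)) R * ln (2 * R) \<le> X\<^sup>2 * E * (2 * (1 + K))"
    proof -
      have "unint_counting (zorder (g 0)) R * ln (2 * R) \<le> X * (E * (1 + K)) * (2 * X)"
      proof (rule mult_mono)
        have "ln (2 * R) \<le> 2 * R - 1" using R1 by (intro ln_le_minus_one) auto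
        then show "ln (2 * R) \<le> 2 * X" using R1 by simp
      qed (use nb X R1 E K(1) in auto)
      then show ?thesis by (simp add: power2_eq_square mult_ac)
    qed
    have "circle_mean (\<lambda>z. u (z + a)) r \<le> circle_mean (\<lambda>z. ln (norm (g 0 (z + a)))) r
     + (2 * R * circle_mean (\<lambda>z. u z - ln (norm (g 0 z))) R + unint_counting (zorder (g 0)) R * ln (2 * R))"
      by (rule u_shift_mean_le[OF R(3)]) (use elim R s0_def in auto)
    also have "\<dots> \<le> X\<^sup>2 * E * ((1 + K + \<bar>K2\<bar>) + 3 * (1 + K)) + (X\<^sup>2 * E * (2 * (1 + 2 * K + \<bar>u 0\<bar>)) + X\<^sup>2 * E * (2 * (1 + K)))"
      by (intro add_mono b1 b2 b3)
    also have "\<dots> = C * (r + A)\<^sup>2 * exp ((r + A) powr s)"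
      by (simp add: C_def X_def E_def algebra_simps)
    finally show ?case using elim by linarith
  qed
qed

end

section \<open>The Casoratian\<close>

context slow_curve begin

definition casoratian :: "nat \<Rightarrow> complex \<Rightarrow> complex" where
  "casoratian m z = fdet m (\<lambda>\<nu> k. g k (z + of_nat \<nu> * c))"

lemma g_shift_holomorphic: "k \<le> n \<Longrightarrow> (\<lambda>z. g k (z + a)) holomorphic_on UNIV"
  using nz_entire_holomorphic[OF nz_entire_shift[OF g_nz_entire]] .

lemma casoratian_holomorphic: "m \<le> n + 1 \<Longrightarrow> casoratian m holomorphic_on UNIV"
  unfolding casoratian_def by (rule fdet_holomorphic) (auto intro: g_shift_holomorphic)

text \<open>If the larger Casoratian vanishes, its last-row minors divided by \<open>M m\<close> are
  coefficients of a relation between g 0, ..., g m. They turn out to be periodic and of hyper-order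
  less than one, contradicting independence because the last coefficient is 1.\<close>

lemma casoratian_dependence:
  assumes m: "m \<le> n" and nz: "nz_entire (casoratian m)" and z: "\<And>z. casoratian (Suc m) z = 0"
  shows False
proof -
  \<comment> \<open>Signed minors obtained by deleting the row of the highest shift \<open>m\<close>
    and column \<open>k\<close>; \<open>M m\<close> is the nonvanishing smaller Casoratian.\<close>
  define M where "M = (\<lambda>k z. fadj (Suc m) (\<lambda>\<nu> k. g k (z + of_nat \<nu> * c)) k m)"
  define U where "U = (\<lambda>z. ln (fact m) + (\<Sum>i<m. u (z + of_nat i * c)))"
  have Mk: "M k z = (-1) ^ (m + k) * fdet m (\<lambda>i j. g (if j < k then j else Suc j) (z + of_nat i * c))" for k z
    unfolding M_def fadj_def by (auto intro!: fdet_cong)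
  have Mm: "M m z = casoratian m z" for z
  proof -
    have "fdet m (\<lambda>i j. g (if j < m then j else Suc j) (z + of_nat i * c)) = casoratian m z"
      unfolding casoratian_def by (rule fdet_cong) auto
    moreover have "(-1::complex) ^ (m + m) = 1" by simp
    ultimately show ?thesis unfolding Mk by simp
  qed
  have Mh: "M k holomorphic_on UNIV" if "k \<le> m" for k
    unfolding Mk by (intro holomorphic_intros fdet_holomorphic g_shift_holomorphic) (use m that in auto)
  have MU: "ln (norm (M k z)) \<le> U z" if "k \<le> m" "M k z \<noteq> 0" for k z
  proof -
    have "norm (M k z) = norm (fdet m (\<lambda>i j. g (if j < k then j else Suc j) (z + of_nat i * c)))"
      unfolding Mk by (simp add: norm_mult norm_power)
    also have "\<dots> \<le> fact m * (\<Prod>i<m. exp (u (z + of_nat i * c)))"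
      by (rule fdet_norm_le) (use m that in \<open>auto intro!: norm_g_le\<close>)
    finally have "ln (norm (M k z)) \<le> ln (fact m * (\<Prod>i<m. exp (u (z + of_nat i * c))))"
      using that by (intro ln_mono) auto
    also have "\<dots> = U z" unfolding U_def by (simp add: ln_mult exp_sum[symmetric] prod_pos)
    finally show ?thesis .
  qed
  have Uc: "continuous_on UNIV U" unfolding U_def
    by (intro continuous_intros continuous_on_compose2[OF u_continuous[of UNIV]]) auto
  define \<phi> where "\<phi> = (\<lambda>k. if k \<le> m then remove_sings (\<lambda>z. M k z / M m z) else (\<lambda>z. 0))"
  have "M m = casoratian m" by (intro ext Mm)
  then have Mmnz: "nz_entire (M m)" using nz by simp
  have U2: "\<And>z. M m z \<noteq> 0 \<Longrightarrow> ln (norm (M m z)) \<le> U z" using MU[of m] by simp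
  note quot = nevanlinna_T_quotient_le[OF Mh Mmnz Uc MU U2]
  have \<phi>eq: "\<phi> k z = M k z / M m z" if "k \<le> m" "M m z \<noteq> 0" for k z
    using quot(3)[of k] that by (simp add: \<phi>_def)
  have ker: "(\<Sum>k<Suc m. g k (z + of_nat \<nu> * c) * M k z) = 0" if "\<nu> < Suc m" for \<nu> z
    using fadj_right[OF that, of m "\<lambda>\<nu> k. g k (z + of_nat \<nu> * c)"] z[of z]
    by (auto simp: M_def casoratian_def)
  \<comment> \<open>Rows \<nu> < m at w + c are rows \<nu> + 1 at \<open>w\<close>, so both ratio
    vectors solve the same m equations. Their difference has last entry 0 and lies in the kernel of
    the nonsingular m by m Casoratian matrix at w + c.\<close>
  have shift: "M k (w + c) / M m (w + c) = M k w / M m w"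
    if "M m w \<noteq> 0" "M m (w + c) \<noteq> 0" "k \<le> m" for k w
  proof (cases "k = m")
    case False
    define x where "x = (\<lambda>k. M k (w + c) / M m (w + c) - M k w / M m w)"
    have "x k = 0"
    proof (rule fdet_kernel_trivial)
      show "fdet m (\<lambda>\<nu> k. g k ((w + c) + of_nat \<nu> * c)) \<noteq> 0"
        using that(2) unfolding Mm casoratian_def .
      show "k < m" using False that by simp
      fix \<nu> assume v: "\<nu> < m"
      have e: "w + c + of_nat \<nu> * c = w + of_nat (Suc \<nu>) * c" by (simp add: algebra_simps)
      have 1: "(\<Sum>k<Suc m. g k (w + c + of_nat \<nu> * c) * (M k (w + c) / M m (w + c))) = 0"
        using ker[of \<nu> "w + c"] v by (simp add: sum_divide_distrib[symmetric] del: sum.lessThan_Suc)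
      have 2: "(\<Sum>k<Suc m. g k (w + c + of_nat \<nu> * c) * (M k w / M m w)) = 0"
        using ker[of "Suc \<nu>" w] v unfolding e by (simp add: sum_divide_distrib[symmetric] del: sum.lessThan_Suc of_nat_Suc)
      have "(\<Sum>k<Suc m. g k (w + c + of_nat \<nu> * c) * x k) = 0"
        using 1 2 by (simp add: x_def right_diff_distrib sum_subtractf del: sum.lessThan_Suc)
      moreover have "x m = 0" using that by (simp add: x_def)
      ultimately show "(\<Sum>k<m. g k (w + c + of_nat \<nu> * c) * x k) = 0" by simp
    qed
    then show ?thesis by (simp add: x_def)
  qed (use that in auto)
  obtain s where s: "0 < s" "s < 1" and Ts: "eventually (\<lambda>r. T r \<le> exp (r powr s)) at_top"
    using T_growth by metis
  \<comment> \<open>Room for two losses below 1: from s to t for shifting \<open>u\<close>, from t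
    to t' for the sum over shifts and the constants.\<close>
  define t where "t = (s + 1) / 2"
  define t' where "t' = (t + 1) / 2"
  have t: "s < t" "t < t'" "t' < 1" "0 < t" using s by (auto simp: t_def t'_def)
  have \<phi>P: "\<phi> k \<in> P1 c" if "k \<le> m" for k
  proof (rule in_P1I)
    show "\<phi> k nicely_meromorphic_on UNIV" "nonzero_locus_finite (pole_mult (\<phi> k))"
      using quot(1,2)[of k] that by (simp_all add: \<phi>_def)
    \<comment> \<open>\<open>shift\<close> holds only off the zeros of the denominator; since
      \<open>remove_sings\<close> depends only on values near a point, periodicity extends to every
      point.\<close>
    show "\<phi> k (z + c) = \<phi> k z" for z
    proof -
      have "\<phi> k (z + c) = remove_sings (\<lambda>w. M k (z + c + w) / M m (z + c + w)) 0"
        using that by (simp add: \<phi>_def remove_sings_shift_0[of _ "z + c"])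
      also have "\<dots> = remove_sings (\<lambda>w. M k (z + w) / M m (z + w)) 0"
      proof (rule remove_sings_cong[OF _ refl])
        have "eventually (\<lambda>w. M m (w + z) \<noteq> 0) (at 0)" "eventually (\<lambda>w. M m (w + (z + c)) \<noteq> 0) (at 0)"
          by (rule nz_entire_eventually[OF nz_entire_shift[OF Mmnz]])+
        then show "eventually (\<lambda>w. M k (z + c + w) / M m (z + c + w) = M k (z + w) / M m (z + w)) (at 0)"
        proof eventually_elim
          case (elim w)
          then show ?case using shift[of "z + w" k] that by (simp add: add_ac)
        qed
      qed
      also have "\<dots> = \<phi> k z" using that by (simp add: \<phi>_def remove_sings_shift_0[of _ z])
      finally show ?thesis .
    qed
    show "t' < 1" by fact
    have "\<exists>K. \<forall>r\<ge>1. nevanlinna_T (\<phi> k) r \<le> circle_mean U r + K"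
      using quot(4)[of k] that by (simp add: \<phi>_def)
    then obtain K where K: "\<And>r. 1 \<le> r \<Longrightarrow> nevanlinna_T (\<phi> k) r \<le> circle_mean U r + K" by blast
    have "eventually (\<lambda>r. \<forall>i\<in>{..<m}. circle_mean (\<lambda>z. u (z + of_nat i * c)) r \<le> exp (r powr t)) at_top"
      by (intro eventually_ball_finite finite_lessThan ballI u_shift_growth[OF s(1) t(1) Ts])
    moreover have "eventually (\<lambda>r. (real m + \<bar>ln (fact m)\<bar> + \<bar>K\<bar>) * (r + 0) ^ 2 * exp ((r + 0) powr t) \<le> exp (r powr t')) at_top"
      by (rule poly_exp_powr_absorb) (use t in auto)
    ultimately show "eventually (\<lambda>r. nevanlinna_T (\<phi> k) r \<le> exp (r powr t')) at_top"
      using eventually_ge_at_top[of 1]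
    proof eventually_elim
      case (elim r)
      define E where "E = exp (r powr t)"
      have E: "1 \<le> E" by (simp add: E_def)
      have Um: "has_circle_mean U r (ln (fact m) + (\<Sum>i<m. circle_mean (\<lambda>z. u (z + of_nat i * c)) r))"
        unfolding U_def
        by (intro has_circle_mean_add has_circle_mean_const has_circle_mean_sum has_circle_mean_continuous
              continuous_on_compose2[OF u_continuous[of UNIV]]) (use elim in \<open>auto intro!: continuous_intros\<close>)
      have "nevanlinna_T (\<phi> k) r \<le> ln (fact m) + (\<Sum>i<m. circle_mean (\<lambda>z. u (z + of_nat i * c)) r) + K"
        using K[of r] elim circle_mean_eq[OF Um] by simp
      also have "\<dots> \<le> \<bar>ln (fact m)\<bar> * E + (\<Sum>i<m. E) + \<bar>K\<bar> * E"
      proof (intro add_mono sum_mono)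
        show "ln (fact m) \<le> \<bar>ln (fact m)\<bar> * E" using mult_left_mono[OF E, of "\<bar>ln (fact m)\<bar>"] by linarith
        show "K \<le> \<bar>K\<bar> * E" using mult_left_mono[OF E, of "\<bar>K\<bar>"] by linarith
      qed (use elim in \<open>auto simp: E_def\<close>)
      also have "\<dots> = (real m + \<bar>ln (fact m)\<bar> + \<bar>K\<bar>) * 1 * E" by (simp add: algebra_simps)
      also have "\<dots> \<le> (real m + \<bar>ln (fact m)\<bar> + \<bar>K\<bar>) * (r + 0) ^ 2 * E"
        using elim E by (intro mult_right_mono mult_left_mono) auto
      finally show ?case using elim by (simp add: E_def)
    qed
  qed
  have "\<forall>i\<in>{0..n}. \<phi> i = (\<lambda>z. 0)"
  proof (rule indep[unfolded P1_lin_indep_def, THEN spec, of \<phi>, THEN mp], intro conjI)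
    show "\<forall>i\<in>{0..n}. \<phi> i \<in> P1 c"
    proof
      fix i show "\<phi> i \<in> P1 c"
        using \<phi>P[of i] const_in_P1[of 0 c] by (cases "i \<le> m") (auto simp: \<phi>_def)
    qed
    show "eventually (\<lambda>z. (\<Sum>i\<in>{0..n}. \<phi> i z * g i z) = 0) (cosparse UNIV)"
      using nz_entire_eventually_cosparse[OF Mmnz]
    proof eventually_elim
      case (elim z)
      have "(\<Sum>i\<in>{0..n}. \<phi> i z * g i z) = (\<Sum>i<Suc m. \<phi> i z * g i z)"
        by (rule sum.mono_neutral_right) (use m in \<open>auto simp: \<phi>_def\<close>)
      also have "\<dots> = (\<Sum>i<Suc m. g i (z + of_nat 0 * c) * M i z / M m z)"
        by (intro sum.cong) (auto simp: \<phi>eq elim)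
      also have "\<dots> = (\<Sum>i<Suc m. g i (z + of_nat 0 * c) * M i z) / M m z"
        by (rule sum_divide_distrib[symmetric])
      finally show ?case using ker[of 0 z] by simp
    qed
  qed
  then have "\<phi> m = (\<lambda>z. 0)" using m by auto
  moreover obtain z where "M m z \<noteq> 0" using Mmnz by (auto simp: nz_entire_def)
  ultimately show False using \<phi>eq[of m z] by (simp add: fun_eq_iff)
qed

text \<open>Induction on the size, starting from the empty determinant, which is 1.\<close>

lemma casoratian_nz_entire: "m \<le> n + 1 \<Longrightarrow> nz_entire (casoratian m)"
proof (induction m)
  case 0
  show ?case unfolding nz_entire_def using casoratian_holomorphic[of 0] by (auto simp: casoratian_def fdet_expand)
next
  case (Suc m)
  then have "\<not> (\<forall>z. casoratian (Suc m) z = 0)" using casoratian_dependence[of m] by auto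
  then show ?case using casoratian_holomorphic[OF Suc.prems] by (auto simp: nz_entire_def)
qed

section \<open>Small periodic entire functions\<close>

text \<open>The coefficient functions and all polynomials in them. For entire functions the
  characteristic is just this logarithmic mean, so no poles need counting, and the set is closed
  under sums and products.\<close>

definition small_periodic :: "(complex \<Rightarrow> complex) set" where
  "small_periodic = {f. f holomorphic_on UNIV \<and> (\<forall>z. f (z + c) = f z) \<and>
     (\<lambda>r. circle_mean (\<lambda>z. ln (max 1 (norm (f z)))) r) \<in> o[at_top](T)}"

lemma const_smallo_T: "(\<lambda>r. k :: real) \<in> o[at_top](T)"
proof -
  have "eventually (\<lambda>r. T r \<noteq> 0) at_top" using T_at_top by (rule filterlim_at_top_dense[THEN iffD1, THEN spec, of _ _ 0, THEN eventually_mono]) auto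
  then show ?thesis using T_at_top
    by (intro smalloI_tendsto tendsto_divide_0[OF tendsto_const] filterlim_at_top_imp_at_infinity) auto
qed

lemma smallo_T_sandwich:
  assumes "eventually (\<lambda>r. 0 \<le> X r \<and> X r \<le> Y r) at_top" "Y \<in> o[at_top](T)"
  shows "X \<in> o[at_top](T)"
proof -
  have "X \<in> O[at_top](Y)"
    by (rule bigoI[of _ 1]) (use assms(1) in eventually_elim, auto)
  then show ?thesis using assms(2) by (rule landau_o.big_small_trans)
qed

text \<open>The hypothesis on \<open>h\<close> is weak enough to cover both the sum and the product
  of \<open>f1\<close> and \<open>f2\<close>.\<close>

lemma log_plus_mean_small:
  assumes "f1 \<in> small_periodic" "f2 \<in> small_periodic" "h holomorphic_on UNIV"
    and le: "\<And>z. norm (h z) \<le> 2 * max 1 (norm (f1 z)) * max 1 (norm (f2 z))"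
  shows "(\<lambda>r. circle_mean (\<lambda>z. ln (max 1 (norm (h z)))) r) \<in> o[at_top](T)"
proof (rule smallo_T_sandwich)
  define Y where "Y = (\<lambda>r. ln 2 + circle_mean (\<lambda>z. ln (max 1 (norm (f1 z)))) r + circle_mean (\<lambda>z. ln (max 1 (norm (f2 z)))) r)"
  show "Y \<in> o[at_top](T)" unfolding Y_def
    using assms(1,2) by (intro sum_in_smallo const_smallo_T) (auto simp: small_periodic_def)
  have cont: "continuous_on S f" if "f holomorphic_on UNIV" for f :: "complex \<Rightarrow> complex" and S
    using that holomorphic_on_imp_continuous_on holomorphic_on_subset by blast
  have f: "f1 holomorphic_on UNIV" "f2 holomorphic_on UNIV" using assms by (auto simp: small_periodic_def)
  show "eventually (\<lambda>r. 0 \<le> circle_mean (\<lambda>z. ln (max 1 (norm (h z)))) r \<and> circle_mean (\<lambda>z. ln (max 1 (norm (h z)))) r \<le> Y r) at_top"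
    using eventually_gt_at_top[of 0]
  proof eventually_elim
    case (elim r)
    have "has_circle_mean (\<lambda>z. ln 2 + ln (max 1 (norm (f1 z))) + ln (max 1 (norm (f2 z)))) r (Y r)"
      unfolding Y_def
      by (intro has_circle_mean_add has_circle_mean_const has_circle_mean_continuous)
         (use elim in \<open>auto intro!: continuous_intros cont f\<close>)
    moreover have "has_circle_mean (\<lambda>z. ln (max 1 (norm (h z)))) r (circle_mean (\<lambda>z. ln (max 1 (norm (h z)))) r)"
      by (rule has_circle_mean_continuous) (use elim in \<open>auto intro!: continuous_intros cont assms(3)\<close>)
    moreover have "ln (max 1 (norm (h z))) \<le> ln 2 + ln (max 1 (norm (f1 z))) + ln (max 1 (norm (f2 z)))" for z
    proof -
      have p: "1 \<le> max 1 (norm (f1 z)) * max 1 (norm (f2 z))"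
        using mult_mono[of 1 "max 1 (norm (f1 z))" 1 "max 1 (norm (f2 z))"] by simp
      have "max 1 (norm (h z)) \<le> 2 * max 1 (norm (f1 z)) * max 1 (norm (f2 z))"
        using le[of z] p by linarith
      then have "ln (max 1 (norm (h z))) \<le> ln (2 * max 1 (norm (f1 z)) * max 1 (norm (f2 z)))"
        by (intro ln_mono) auto
      moreover have "ln (2 * x * y) = ln 2 + ln x + ln y" if "0 < x" "0 < y" for x y :: real
        using that by (simp add: ln_mult_pos)
      moreover have "0 < max 1 (norm (f1 z))" "0 < max 1 (norm (f2 z))" by auto
      ultimately show ?thesis by metis
    qed
    ultimately show ?case using has_circle_mean_le[of _ r] elim circle_mean_log_plus_nonneg[OF elim] by blast
  qed
qed

lemma small_periodic_domain: "function_domain small_periodic"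
  unfolding function_domain_def
proof (intro conjI ballI impI)
  have const: "(\<lambda>z. k) \<in> small_periodic" for k
  proof -
    have "(\<lambda>r. circle_mean (\<lambda>z. ln (max 1 (norm k))) r) = (\<lambda>r. ln (max 1 (norm k)))"
      by (intro ext circle_mean_eq[OF has_circle_mean_const])
    then show ?thesis using const_smallo_T by (auto simp: small_periodic_def)
  qed
  show "(\<lambda>z. 0) \<in> small_periodic" "(\<lambda>z. 1) \<in> small_periodic" by (rule const)+
  fix f h assume f: "f \<in> small_periodic" and h: "h \<in> small_periodic"
  note hol = f[unfolded small_periodic_def] h[unfolded small_periodic_def]
  show "(\<lambda>z. f z + h z) \<in> small_periodic"
  proof -
    have "norm (f z + h z) \<le> 2 * max 1 (norm (f z)) * max 1 (norm (h z))" for z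
    proof -
      have "norm (f z + h z) \<le> max 1 (norm (f z)) + max 1 (norm (h z))"
        using norm_triangle_ineq[of "f z" "h z"] by linarith
      also have "\<dots> \<le> max 1 (norm (f z)) * max 1 (norm (h z)) + max 1 (norm (f z)) * max 1 (norm (h z))"
        using mult_left_mono[of 1 "max 1 (norm (h z))" "max 1 (norm (f z))"]
          mult_right_mono[of 1 "max 1 (norm (f z))" "max 1 (norm (h z))"] by (intro add_mono) auto
      finally show ?thesis by simp
    qed
    then show ?thesis using log_plus_mean_small[OF f h, of "\<lambda>z. f z + h z"] hol
      by (auto simp: small_periodic_def intro!: holomorphic_intros)
  qed
  show "(\<lambda>z. f z * h z) \<in> small_periodic"
  proof -
    have "norm (f z * h z) \<le> 2 * max 1 (norm (f z)) * max 1 (norm (h z))" for z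
    proof -
      have "norm (f z * h z) \<le> max 1 (norm (f z)) * max 1 (norm (h z))"
        unfolding norm_mult by (intro mult_mono) auto
      moreover have "0 \<le> max 1 (norm (f z)) * max 1 (norm (h z))" by (intro mult_nonneg_nonneg) auto
      ultimately show ?thesis by linarith
    qed
    then show ?thesis using log_plus_mean_small[OF f h, of "\<lambda>z. f z * h z"] hol
      by (auto simp: small_periodic_def intro!: holomorphic_intros)
  qed
  show "(\<lambda>z. - f z) \<in> small_periodic" using hol by (auto simp: small_periodic_def intro!: holomorphic_intros)
  assume z: "\<forall>z. f z * h z = 0"
  show "f = (\<lambda>z. 0) \<or> h = (\<lambda>z. 0)"
  proof (rule ccontr)
    assume "\<not> ?thesis"
    then have "nz_entire f" "nz_entire h" using hol by (auto simp: nz_entire_def fun_eq_iff)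
    from nz_entire_mult[OF this] z show False by (simp add: nz_entire_def)
  qed
qed

text \<open>Being o(T), the characteristic is eventually below \<open>T\<close> and inherits its
  bound exp (r^s). Thus determinants over this ring can be tested for independence over
  \<open>P1 c\<close>.\<close>

lemma small_periodic_P1: "small_periodic \<subseteq> P1 c"
proof
  fix f assume f: "f \<in> small_periodic"
  then have h: "f holomorphic_on UNIV" and per: "\<And>z. f (z + c) = f z"
    and o: "(\<lambda>r. circle_mean (\<lambda>z. ln (max 1 (norm (f z)))) r) \<in> o[at_top](T)"
    by (auto simp: small_periodic_def)
  obtain s where s: "0 < s" "s < 1" and Ts: "eventually (\<lambda>r. T r \<le> exp (r powr s)) at_top"
    using T_growth by metis
  have np: "\<not> is_pole f z" for z
    using h by (metis UNIV_I analytic_at analytic_at_imp_isCont is_pole_def isCont_def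
        not_tendsto_and_filterlim_at_infinity open_UNIV trivial_limit_at)
  show "f \<in> P1 c"
  proof (rule in_P1I)
    show "f nicely_meromorphic_on UNIV"
      using h analytic_on_imp_nicely_meromorphic_on analytic_on_open open_UNIV by blast
    show "nonzero_locus_finite (pole_mult f)" using np by (simp add: nonzero_locus_finite_def pole_mult_def)
    have "eventually (\<lambda>r. norm (circle_mean (\<lambda>z. ln (max 1 (norm (f z)))) r) \<le> 1 * norm (T r)) at_top"
      using o by (rule landau_o.smallD) simp
    moreover have "eventually (\<lambda>r. 0 \<le> T r) at_top" using T_at_top by (simp add: filterlim_at_top)
    ultimately show "eventually (\<lambda>r. nevanlinna_T f r \<le> exp (r powr s)) at_top" using Ts
      by eventually_elim (simp add: nevanlinna_T_entire[OF h])
  qed (use per s in auto)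
qed

end

section \<open>Selecting extreme indices; additivity of log counts\<close>

text \<open>Used twice: to pick the n forms smallest in modulus at a point, and the n forms of
  highest vanishing order.\<close>

lemma smallest_subset:
  fixes f :: "'i \<Rightarrow> 'b::linorder"
  assumes "finite A" "m \<le> card A"
  shows "\<exists>I\<subseteq>A. card I = m \<and> (\<forall>i\<in>I. \<forall>j\<in>A - I. f i \<le> f j)"
  using assms(2)
proof (induction m)
  case 0
  then show ?case by (intro exI[of _ "{}"]) auto
next
  case (Suc m)
  then obtain I where I: "I \<subseteq> A" "card I = m" "\<forall>i\<in>I. \<forall>j\<in>A - I. f i \<le> f j" by auto
  have fin: "finite I" "finite (A - I)" using I assms(1) finite_subset by auto
  have "A - I \<noteq> {}"
  proof
    assume "A - I = {}"
    then have "A = I" using I by auto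
    then show False using I Suc.prems by simp
  qed
  then obtain x where x: "x \<in> A - I" "\<And>y. y \<in> A - I \<Longrightarrow> f x \<le> f y"
    using arg_min_if_finite(1)[OF fin(2)] arg_min_least[OF fin(2)] by metis
  show ?case
    by (rule exI[of _ "insert x I"]) (use I x fin in auto)
qed

lemma member_le_prod_real:
  fixes f :: "'i \<Rightarrow> real"
  assumes "finite A" "x \<in> A" "\<And>y. y \<in> A \<Longrightarrow> 1 \<le> f y"
  shows "f x \<le> prod f A"
proof -
  have "f x * 1 \<le> f x * prod f (A - {x})"
    using assms by (intro mult_left_mono prod_ge_1) (auto intro: order_trans[of 0 1])
  then show ?thesis using assms by (simp add: prod.remove)
qed

lemma log_count_add:
  assumes "nonzero_locus_finite \<mu>" "nonzero_locus_finite \<nu>" "1 \<le> r"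
  shows "log_count (\<lambda>z. \<mu> z + \<nu> z) r = log_count \<mu> r + log_count \<nu> r"
  using log_count_sum[of "{True, False}" "\<lambda>b. if b then \<mu> else \<nu>" r] assms by simp

lemma nonzero_locus_finite_add:
  assumes "nonzero_locus_finite \<mu>" "nonzero_locus_finite \<nu>"
  shows "nonzero_locus_finite (\<lambda>z. \<mu> z + \<nu> z)"
  unfolding nonzero_locus_finite_def
proof
  fix r
  have "{z. norm z \<le> r \<and> \<mu> z + \<nu> z \<noteq> 0} \<subseteq> {z. norm z \<le> r \<and> \<mu> z \<noteq> 0} \<union> {z. norm z \<le> r \<and> \<nu> z \<noteq> 0}"
    by auto
  then show "finite {z. norm z \<le> r \<and> \<mu> z + \<nu> z \<noteq> 0}"
    using assms finite_subset unfolding nonzero_locus_finite_def by blast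
qed

lemma nonzero_locus_finite_sum:
  assumes "\<And>i. i \<in> I \<Longrightarrow> nonzero_locus_finite (\<mu> i)"
  shows "nonzero_locus_finite (\<lambda>z. \<Sum>i\<in>I. \<mu> i z)"
  using assms
proof (induction I rule: infinite_finite_induct)
  case (insert i I)
  then show ?case using nonzero_locus_finite_add[of "\<mu> i" "\<lambda>z. \<Sum>i\<in>I. \<mu> i z"] by simp
qed (auto simp: nonzero_locus_finite_def)

lemma nonzero_locus_finite_cmult:
  "nonzero_locus_finite \<mu> \<Longrightarrow> nonzero_locus_finite (\<lambda>z. k * \<mu> z)"
  unfolding nonzero_locus_finite_def by (cases "k = 0") auto

section \<open>Moving hyperplanes in general position\<close>

locale moving_hyperplanes = slow_curve +
  fixes q :: nat and a :: "nat \<Rightarrow> nat \<Rightarrow> complex \<Rightarrow> complex"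
  assumes small: "\<And>j k. j \<le> q \<Longrightarrow> k \<le> n \<Longrightarrow> a j k \<in> small_periodic"
    and position: "general_position c n q a"
begin

abbreviation "L j \<equiv> hyperplane_form n (a j) g"
abbreviation "C \<equiv> casoratian (Suc n)"

definition index_sets :: "nat set set" where
  "index_sets = {J. J \<subseteq> {0..q} \<and> card J = n + 1}"

definition enum :: "nat set \<Rightarrow> nat \<Rightarrow> nat" where
  "enum J = (SOME e. bij_betw e {..<Suc n} J)"

definition coeff_det :: "nat set \<Rightarrow> complex \<Rightarrow> complex" where
  "coeff_det J z = fdet (Suc n) (\<lambda>i k. a (enum J i) k z)"

definition inv_coeff :: "nat set \<Rightarrow> nat \<Rightarrow> nat \<Rightarrow> complex \<Rightarrow> complex" where
  "inv_coeff J k i z = fadj (Suc n) (\<lambda>i k. a (enum J i) k z) k i"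

lemma n_le_q: "n \<le> q"
  using position by (simp add: general_position_def)

lemma finite_index_sets: "finite index_sets"
  unfolding index_sets_def by auto

lemma enum_bij: "J \<in> index_sets \<Longrightarrow> bij_betw (enum J) {..<Suc n} J"
proof -
  assume J: "J \<in> index_sets"
  then have "finite J" using finite_subset by (auto simp: index_sets_def)
  then have "\<exists>e. bij_betw e {..<Suc n} J"
    using J by (intro finite_same_card_bij) (auto simp: index_sets_def)
  then show ?thesis unfolding enum_def by (rule someI_ex)
qed

lemma enum_in: "J \<in> index_sets \<Longrightarrow> i < Suc n \<Longrightarrow> enum J i \<in> J"
  using bij_betwE[OF enum_bij] by auto

lemma enum_le: "J \<in> index_sets \<Longrightarrow> i < Suc n \<Longrightarrow> enum J i \<le> q"
  using enum_in[of J i] by (auto simp: index_sets_def)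

lemma sum_enum: "J \<in> index_sets \<Longrightarrow> (\<Sum>i<Suc n. f (enum J i)) = (\<Sum>j\<in>J. f j)"
  by (rule sum.reindex_bij_betw[OF enum_bij])

lemma a_holomorphic: "j \<le> q \<Longrightarrow> k \<le> n \<Longrightarrow> a j k holomorphic_on S"
  using small[of j k] holomorphic_on_subset by (auto simp: small_periodic_def)

lemma a_periodic: "j \<le> q \<Longrightarrow> k \<le> n \<Longrightarrow> a j k (z + of_nat \<nu> * c) = a j k z"
proof (induction \<nu>)
  case (Suc \<nu>)
  have "a j k (z + of_nat (Suc \<nu>) * c) = a j k ((z + of_nat \<nu> * c) + c)" by (simp add: algebra_simps)
  also have "\<dots> = a j k (z + of_nat \<nu> * c)" using small[OF Suc.prems] by (simp add: small_periodic_def)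
  finally show ?case using Suc by simp
qed auto

lemma coeff_det_small: "J \<in> index_sets \<Longrightarrow> coeff_det J \<in> small_periodic"
  unfolding coeff_det_def
  by (rule function_domain_fdet[OF small_periodic_domain]) (auto intro!: small enum_le)

lemma inv_coeff_small: "J \<in> index_sets \<Longrightarrow> k < Suc n \<Longrightarrow> i < Suc n \<Longrightarrow> inv_coeff J k i \<in> small_periodic"
proof -
  assume J: "J \<in> index_sets" and k: "k < Suc n" "i < Suc n"
  define D where "D = (\<lambda>z. fdet n (\<lambda>i' j'. a (enum J (if i' < i then i' else Suc i')) (if j' < k then j' else Suc j') z))"
  have D: "D \<in> small_periodic" unfolding D_def
    by (rule function_domain_fdet[OF small_periodic_domain]) (use k in \<open>auto intro!: small enum_le J\<close>)
  have "inv_coeff J k i = (\<lambda>z. (-1) ^ (i + k) * D z)"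
    by (intro ext) (simp add: inv_coeff_def fadj_def D_def)
  then show ?thesis
    using D function_domainD(5)[OF small_periodic_domain D] by (cases "even (i + k)") simp_all
qed

lemma coeff_det_nz_entire: "J \<in> index_sets \<Longrightarrow> nz_entire (coeff_det J)"
proof -
  assume J: "J \<in> index_sets"
  have "\<exists>z. fdet (n + 1) (\<lambda>i k. a (enum J i) k z) \<noteq> 0"
  proof (rule independent_vectors_fdet_nonzero[OF small_periodic_domain small_periodic_P1])
    show "finite J" using J finite_subset by (auto simp: index_sets_def)
    show "card J = n + 1" using J by (simp add: index_sets_def)
    show "a j k \<in> small_periodic" if "j \<in> J" "k \<le> n" for j k
      using that J by (intro small) (auto simp: index_sets_def)
    show "P1_lin_indep_vec c n J a"
      using position J by (auto simp: general_position_def index_sets_def)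
    show "bij_betw (enum J) {..<n + 1} J" using enum_bij[OF J] by simp
  qed
  then show ?thesis using coeff_det_small[OF J] by (auto simp: nz_entire_def coeff_det_def small_periodic_def)
qed

lemma L_sum: "L j z = (\<Sum>k<Suc n. a j k z * g k z)"
  by (simp add: hyperplane_form_def lessThan_Suc_atMost)

lemma L_holomorphic: "j \<le> q \<Longrightarrow> L j holomorphic_on S"
  unfolding hyperplane_form_def by (auto intro!: holomorphic_intros a_holomorphic g_holomorphic)

text \<open>Periodic coefficients do not see the shift, so the matrix of shifted forms is the
  Casoratian matrix of \<open>g\<close> times a transposed coefficient matrix.\<close>

lemma casoratian_forms:
  assumes J: "J \<in> index_sets"
  shows "fdet (Suc n) (\<lambda>\<nu> i. L (enum J i) (z + of_nat \<nu> * c)) = C z * coeff_det J z"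
proof -
  have "fdet (Suc n) (\<lambda>\<nu> i. L (enum J i) (z + of_nat \<nu> * c))
     = fdet (Suc n) (\<lambda>\<nu> i. \<Sum>k<Suc n. g k (z + of_nat \<nu> * c) * a (enum J i) k z)"
  proof (rule fdet_cong)
    fix \<nu> i assume "\<nu> < Suc n" "i < Suc n"
    then have "a (enum J i) k (z + of_nat \<nu> * c) * g k (z + of_nat \<nu> * c) = g k (z + of_nat \<nu> * c) * a (enum J i) k z"
      if "k < Suc n" for k
      using a_periodic[OF enum_le[OF J], of i k z \<nu>] that by (metis less_Suc_eq_le mult.commute)
    then show "L (enum J i) (z + of_nat \<nu> * c) = (\<Sum>k<Suc n. g k (z + of_nat \<nu> * c) * a (enum J i) k z)"
      unfolding L_sum by (intro sum.cong refl) simp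
  qed
  also have "\<dots> = C z * fdet (Suc n) (\<lambda>k i. a (enum J i) k z)"
    unfolding fdet_mult casoratian_def ..
  also have "fdet (Suc n) (\<lambda>k i. a (enum J i) k z) = coeff_det J z"
    unfolding coeff_det_def by (rule fdet_transpose)
  finally show ?thesis .
qed

lemma C_nz_entire: "nz_entire C"
  by (rule casoratian_nz_entire) simp

lemma ex_index_set: "j \<le> q \<Longrightarrow> \<exists>J\<in>index_sets. j \<in> J"
proof -
  assume j: "j \<le> q"
  have "n \<le> card ({0..q} - {j})" using j n_le_q by simp
  then obtain I where I: "I \<subseteq> {0..q} - {j}" "card I = n" "finite I"
    using obtain_subset_with_card_n by blast
  then have "card (insert j I) = n + 1" "insert j I \<subseteq> {0..q}" using j by (auto simp: card_insert_if)
  then show ?thesis by (intro bexI[of _ "insert j I"]) (auto simp: index_sets_def)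
qed

text \<open>A vanishing form would be a zero column in \<open>casoratian_forms\<close> for an index
  set containing \<open>j\<close>, although both factors on the right are nonzero.\<close>

lemma L_nz_entire: assumes j: "j \<le> q" shows "nz_entire (L j)"
proof (rule ccontr)
  assume "\<not> nz_entire (L j)"
  then have z: "L j z = 0" for z using L_holomorphic[OF j] by (auto simp: nz_entire_def)
  obtain J where J: "J \<in> index_sets" "j \<in> J" using ex_index_set[OF j] by blast
  then obtain i where i: "i < Suc n" "enum J i = j"
  proof -
    have "j \<in> enum J ` {..<Suc n}" using bij_betw_imp_surj_on[OF enum_bij[OF J(1)]] J(2) by simp
    then show ?thesis using that by blast
  qed
  have "C z * coeff_det J z = 0" for z
    unfolding casoratian_forms[OF J(1), symmetric] by (rule fdet_zero_col[OF i(1)]) (simp add: i z)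
  moreover have "nz_entire (\<lambda>z. C z * coeff_det J z)" by (rule nz_entire_mult[OF C_nz_entire coeff_det_nz_entire[OF J(1)]])
  ultimately show False by (simp add: nz_entire_def)
qed

lemma inversion:
  assumes J: "J \<in> index_sets" and k: "k < Suc n"
  shows "coeff_det J z * g k z = (\<Sum>i<Suc n. inv_coeff J k i z * L (enum J i) z)"
proof -
  have "(\<Sum>i<Suc n. inv_coeff J k i z * L (enum J i) z)
     = (\<Sum>l<Suc n. (\<Sum>i<Suc n. inv_coeff J k i z * a (enum J i) l z) * g l z)"
    unfolding L_sum sum_distrib_left sum_distrib_right by (subst sum.swap) (simp add: mult.assoc)
  also have "\<dots> = (\<Sum>l<Suc n. (if k = l then coeff_det J z else 0) * g l z)"
  proof (intro sum.cong refl)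
    fix l assume "l \<in> {..<Suc n}"
    then have "(\<Sum>i<Suc n. inv_coeff J k i z * a (enum J i) l z) = (if k = l then coeff_det J z else 0)"
      unfolding inv_coeff_def coeff_det_def by (intro fadj_left[OF k]) simp
    then show "(\<Sum>i<Suc n. inv_coeff J k i z * a (enum J i) l z) * g l z = (if k = l then coeff_det J z else 0) * g l z"
      by (rule arg_cong)
  qed
  also have "\<dots> = (\<Sum>l<Suc n. if k = l then coeff_det J z * g l z else 0)"
    by (intro sum.cong) auto
  also have "\<dots> = coeff_det J z * g k z" using k by (simp add: sum.delta)
  finally show ?thesis by simp
qed

text \<open>The logarithmic loss in inverting the forms of \<open>J\<close> by Cramer's rule. Sums
  over all entries replace maxima since circle means are additive and each term has mean
  o(T).\<close>

definition err :: "nat set \<Rightarrow> complex \<Rightarrow> real" where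
  "err J z = ln (real (Suc n)) + (\<Sum>k<Suc n. \<Sum>i<Suc n. ln (max 1 (norm (inv_coeff J k i z)))) + \<bar>ln (norm (coeff_det J z))\<bar>"

lemma err_nonneg: "0 \<le> err J z"
  unfolding err_def by (intro add_nonneg_nonneg sum_nonneg) auto

text \<open>By Cramer's rule every \<open>g k\<close> is a combination of the forms of
  \<open>J\<close> divided by the determinant, hence bounded by the largest form.\<close>

lemma u_le_max_form:
  assumes J: "J \<in> index_sets" and j: "j \<in> J" "\<And>i. i \<in> J \<Longrightarrow> norm (L i z) \<le> norm (L j z)"
    and d: "coeff_det J z \<noteq> 0"
  shows "L j z \<noteq> 0" "u z \<le> ln (norm (L j z)) + err J z"
proof -
  obtain k where k: "k \<le> n" "g k z \<noteq> 0" "u z = ln (norm (g k z))" using u_attained by blast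
  define P where "P = (\<Prod>k<Suc n. \<Prod>i<Suc n. max 1 (norm (inv_coeff J k i z)))"
  have P1: "1 \<le> P" unfolding P_def by (intro prod_ge_1) auto
  have row: "norm (inv_coeff J k i z) \<le> P" if "i < Suc n" for i
  proof -
    have "norm (inv_coeff J k i z) \<le> max 1 (norm (inv_coeff J k i z))" by simp
    also have "\<dots> \<le> (\<Prod>i<Suc n. max 1 (norm (inv_coeff J k i z)))"
      using that by (intro member_le_prod_real) auto
    also have "\<dots> \<le> P"
      unfolding P_def
      by (rule member_le_prod_real[of "{..<Suc n}" k "\<lambda>k. \<Prod>i<Suc n. max 1 (norm (inv_coeff J k i z))"])
         (use k in \<open>auto intro!: prod_ge_1 simp del: prod.lessThan_Suc\<close>)
    finally show ?thesis .
  qed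
  have "norm (coeff_det J z) * norm (g k z) = norm (\<Sum>i<Suc n. inv_coeff J k i z * L (enum J i) z)"
    using inversion[OF J, of k z] k by (metis le_imp_less_Suc norm_mult)
  also have "\<dots> \<le> (\<Sum>i<Suc n. norm (inv_coeff J k i z * L (enum J i) z))" by (rule norm_sum)
  also have "\<dots> \<le> (\<Sum>i<Suc n. P * norm (L j z))"
    unfolding norm_mult using row P1 j(2) enum_in[OF J] by (intro sum_mono mult_mono) auto
  also have "\<dots> = real (Suc n) * P * norm (L j z)" by simp
  finally have le: "norm (coeff_det J z) * norm (g k z) \<le> real (Suc n) * P * norm (L j z)" .
  have pos: "0 < norm (coeff_det J z) * norm (g k z)" using d k by simp
  then show Lj: "L j z \<noteq> 0" using le by auto
  have "ln (norm (coeff_det J z) * norm (g k z)) \<le> ln (real (Suc n) * P * norm (L j z))"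
    by (rule ln_mono[OF le pos])
  then have "ln (norm (coeff_det J z)) + u z \<le> ln (real (Suc n)) + ln P + ln (norm (L j z))"
    using Lj d k P1 by (simp add: ln_mult_pos del: of_nat_Suc)
  moreover have "ln P = (\<Sum>k<Suc n. \<Sum>i<Suc n. ln (max 1 (norm (inv_coeff J k i z))))"
    unfolding P_def by (subst ln_prod, simp, force intro: prod_pos, intro sum.cong refl ln_prod) auto
  ultimately show "u z \<le> ln (norm (L j z)) + err J z" unfolding err_def by linarith
qed

text \<open>If all forms of \<open>J\<close> vanish to order m at \<open>z\<close>, then by
  \<open>inversion\<close> so does \<open>coeff_det J\<close> times each \<open>g k\<close>, and
  some \<open>g k\<close> does not vanish at \<open>z\<close>.\<close>

lemma min_order_le:
  assumes J: "J \<in> index_sets" and j: "j \<in> J" "\<And>i. i \<in> J \<Longrightarrow> zorder (L j) z \<le> zorder (L i) z"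
  shows "zorder (L j) z \<le> zorder (coeff_det J) z"
proof -
  obtain k where k: "k \<le> n" "g k z \<noteq> 0" using u_attained by blast
  have jq: "j \<le> q" using J j by (auto simp: index_sets_def)
  define m where "m = nat (zorder (L j) z)"
  have m: "int m = zorder (L j) z" using zorder_nonneg[OF L_nz_entire[OF jq]] by (simp add: m_def)
  have "\<exists>l. l holomorphic_on UNIV \<and> (\<forall>w. L (enum J i) w = (w - z) ^ m * l w)" if i: "i < Suc n" for i
    by (rule entire_divide_power[OF L_nz_entire]) (use enum_le[OF J i] enum_in[OF J i] j(2) m in auto)
  then obtain l where l: "\<And>i. i < Suc n \<Longrightarrow> l i holomorphic_on UNIV"
    "\<And>i w. i < Suc n \<Longrightarrow> L (enum J i) w = (w - z) ^ m * l i w" by metis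
  define S where "S = (\<lambda>w. \<Sum>i<Suc n. inv_coeff J k i w * l i w)"
  have e: "coeff_det J w * g k w = (w - z) ^ m * S w" for w
    using inversion[OF J, of k w] k l(2) unfolding S_def sum_distrib_left
    by (simp add: mult.left_commute del: sum.lessThan_Suc)
  have nz: "nz_entire (\<lambda>w. coeff_det J w * g k w)" by (rule nz_entire_mult[OF coeff_det_nz_entire[OF J] g_nz_entire[OF k(1)]])
  have Sh: "S holomorphic_on UNIV" unfolding S_def
  proof (intro holomorphic_intros)
    fix i assume i: "i \<in> {..<Suc n}"
    then show "inv_coeff J k i holomorphic_on UNIV" "l i holomorphic_on UNIV"
      using inv_coeff_small[OF J, of k i] k l by (auto simp: small_periodic_def)
  qed
  then have Snz: "nz_entire S" using nz e unfolding nz_entire_def by (metis mult_zero_right)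
  have "zorder (coeff_det J) z + zorder (g k) z = zorder (\<lambda>w. (w - z) ^ m * S w) z"
    unfolding e[symmetric] by (rule zorder_mult_entire[OF coeff_det_nz_entire[OF J] g_nz_entire[OF k(1)], symmetric])
  also have "\<dots> = int m + zorder S z"
    by (subst zorder_mult_entire[OF nz_entire_linear_power Snz]) (simp add: zorder_linear_power)
  moreover have "zorder (g k) z = 0" using zorder_nonzero_iff[OF g_nz_entire[OF k(1)], of z] k(2) by blast
  ultimately show ?thesis using m zorder_nonneg[OF Snz, of z] by linarith
qed

section \<open>Comparison of zero multiplicities with the Casoratian\<close>

text \<open>The full multiplicity at an n-successive zero and 0 elsewhere: the part of the zeros to
  be charged to the Casoratian.\<close>

definition succ_mult :: "nat \<Rightarrow> complex \<Rightarrow> int" where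
  "succ_mult j z = zorder (L j) z - aperiodic_mult n c (L j) z"

lemma succ_mult_bounds:
  assumes j: "j \<le> q"
  shows "0 \<le> succ_mult j z" "succ_mult j z \<le> zorder (L j) z"
    "\<nu> \<le> n \<Longrightarrow> succ_mult j z \<le> zorder (\<lambda>w. L j (w + of_nat \<nu> * c)) z"
    "0 \<le> aperiodic_mult n c (L j) z"
proof -
  note h = L_nz_entire[OF j]
  have p: "0 \<le> zorder (L j) z" by (rule zorder_nonneg[OF h])
  show "0 \<le> succ_mult j z" "0 \<le> aperiodic_mult n c (L j) z" "succ_mult j z \<le> zorder (L j) z"
    using p by (auto simp: succ_mult_def aperiodic_mult_def)
  have p': "0 \<le> zorder (\<lambda>w. L j (w + of_nat \<nu> * c)) z" by (rule zorder_nonneg[OF nz_entire_shift[OF h]])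
  assume v: "\<nu> \<le> n"
  consider "\<nu> = 0" | "\<nu> \<in> {1..n}" using v by force
  then show "succ_mult j z \<le> zorder (\<lambda>w. L j (w + of_nat \<nu> * c)) z"
  proof cases
    case 1
    then show ?thesis using \<open>succ_mult j z \<le> zorder (L j) z\<close> by simp
  next
    case 2
    show ?thesis
    proof (cases "L j z = 0 \<and> successive_separated n c (L j) z")
      case True
      then show ?thesis using 2 by (auto simp: succ_mult_def aperiodic_mult_def successive_separated_def)
    next
      case False
      have "succ_mult j z = 0"
        using False zorder_nonzero_iff[OF h, of z] by (auto simp: succ_mult_def aperiodic_mult_def)
      then show ?thesis using p' by simp
    qed
  qed
qed

text \<open>Local form of the main argument. At \<open>z\<close> only n forms can vanish to an order
  exceeding that of the coefficient determinants; together with one more form they make up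
  \<open>J0\<close>, whose Casoratian is divisible column by column by the successive
  multiplicities. The factor q + 2 counts q + 1 for forms outside \<open>J0\<close> and 1 for the
  determinant of \<open>J0\<close>.\<close>

lemma sum_succ_mult_le:
  "(\<Sum>j\<in>{0..q}. succ_mult j z) \<le> zorder C z + (int q + 2) * (\<Sum>J\<in>index_sets. zorder (coeff_det J) z)"
proof -
  define G where "G = (\<Sum>J\<in>index_sets. zorder (coeff_det J) z)"
  have G: "zorder (coeff_det J) z \<le> G" if "J \<in> index_sets" for J
    unfolding G_def by (rule member_le_sum[OF that]) (auto intro: zorder_nonneg coeff_det_nz_entire finite_index_sets)
  \<comment> \<open>Negated orders make the selected indices those of highest vanishing
    order.\<close>
  obtain I where I: "I \<subseteq> {0..q}" "card I = n" "\<forall>i\<in>I. \<forall>j\<in>{0..q} - I. - zorder (L i) z \<le> - zorder (L j) z"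
    using smallest_subset[of "{0..q}" n "\<lambda>i. - zorder (L i) z"] n_le_q by auto
  have fI: "finite I" using I finite_subset by blast
  have J: "insert j I \<in> index_sets" if "j \<in> {0..q} - I" for j
    using that I fI by (auto simp: index_sets_def)
  have out: "zorder (L j) z \<le> G" if j: "j \<in> {0..q} - I" for j
  proof -
    have "zorder (L j) z \<le> zorder (coeff_det (insert j I)) z"
      by (rule min_order_le[OF J[OF j]]) (use I j in auto)
    then show ?thesis using G[OF J[OF j]] by linarith
  qed
  have "card ({0..q} - I) = q + 1 - n" using I fI by (simp add: card_Diff_subset)
  then have "card ({0..q} - I) \<noteq> 0" using n_le_q by simp
  then have "{0..q} - I \<noteq> {}" by (metis card.empty)
  then obtain j0 where j0: "j0 \<in> {0..q} - I" by blast
  define J0 where "J0 = insert j0 I"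
  have J0: "J0 \<in> index_sets" using J[OF j0] by (simp add: J0_def)
  have "(\<Sum>j\<in>J0. succ_mult j z) \<le> zorder C z + zorder (coeff_det J0) z"
  proof -
    have nzM: "nz_entire (\<lambda>w. L (enum J0 i) (w + of_nat \<nu> * c))" if "i < Suc n" for i \<nu>
      by (rule nz_entire_shift[OF L_nz_entire[OF enum_le[OF J0 that]]])
    have D: "(\<lambda>w. fdet (Suc n) (\<lambda>\<nu> i. L (enum J0 i) (w + of_nat \<nu> * c))) = (\<lambda>w. C w * coeff_det J0 w)"
      by (intro ext casoratian_forms[OF J0])
    have "int (\<Sum>i<Suc n. nat (succ_mult (enum J0 i) z)) \<le> zorder (\<lambda>w. fdet (Suc n) (\<lambda>\<nu> i. L (enum J0 i) (w + of_nat \<nu> * c))) z"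
    proof (rule zorder_fdet_ge[where M = "\<lambda>\<nu> i w. L (enum J0 i) (w + of_nat \<nu> * c)"])
      show "nz_entire (\<lambda>z. fdet (Suc n) (\<lambda>\<nu> i. L (enum J0 i) (z + of_nat \<nu> * c)))"
        unfolding D by (rule nz_entire_mult[OF C_nz_entire coeff_det_nz_entire[OF J0]])
      show "int (nat (succ_mult (enum J0 i) z)) \<le> zorder (\<lambda>w. L (enum J0 i) (w + of_nat \<nu> * c)) z"
        if "\<nu> < Suc n" "i < Suc n" for \<nu> i
        using succ_mult_bounds(1)[OF enum_le[OF J0 that(2)], of z]
          succ_mult_bounds(3)[OF enum_le[OF J0 that(2)], of \<nu> z] that by simp
    qed (use nzM in auto)
    also have "\<dots> = zorder C z + zorder (coeff_det J0) z"
      unfolding D by (rule zorder_mult_entire[OF C_nz_entire coeff_det_nz_entire[OF J0]])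
    finally have "(\<Sum>i<Suc n. int (nat (succ_mult (enum J0 i) z))) \<le> zorder C z + zorder (coeff_det J0) z"
      by (simp only: of_nat_sum)
    moreover have "(\<Sum>i<Suc n. int (nat (succ_mult (enum J0 i) z))) = (\<Sum>i<Suc n. succ_mult (enum J0 i) z)"
      by (intro sum.cong refl) (use succ_mult_bounds(1)[OF enum_le[OF J0]] in auto)
    ultimately show ?thesis using sum_enum[OF J0, of "\<lambda>j. succ_mult j z"] by simp
  qed
  moreover have "(\<Sum>j\<in>{0..q} - J0. succ_mult j z) \<le> (\<Sum>j\<in>{0..q} - J0. G)"
  proof (rule sum_mono)
    fix j assume j: "j \<in> {0..q} - J0"
    then show "succ_mult j z \<le> G"
      using out[of j] succ_mult_bounds(2)[of j z] by (auto simp: J0_def)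
  qed
  moreover have "(\<Sum>j\<in>{0..q} - J0. G) \<le> (int q + 1) * G"
  proof -
    have "card ({0..q} - J0) \<le> card {0..q}" by (rule card_mono) auto
    then have "int (card ({0..q} - J0)) \<le> int q + 1" by simp
    moreover have "0 \<le> G" unfolding G_def by (intro sum_nonneg zorder_nonneg coeff_det_nz_entire)
    ultimately show ?thesis by (simp add: mult_right_mono)
  qed
  moreover have "(\<Sum>j\<in>{0..q}. succ_mult j z) = (\<Sum>j\<in>{0..q} - J0. succ_mult j z) + (\<Sum>j\<in>J0. succ_mult j z)"
    using J0 by (intro sum.subset_diff) (auto simp: index_sets_def)
  moreover have "zorder (coeff_det J0) z \<le> G" by (rule G[OF J0])
  moreover have "(int q + 2) * G = (int q + 1) * G + G" by (simp add: algebra_simps)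
  ultimately show ?thesis unfolding G_def by linarith
qed

section \<open>The fundamental inequality on a circle\<close>

definition test_functions :: "(complex \<Rightarrow> complex) set" where
  "test_functions = (\<lambda>(j, \<nu>) w. L j (w + of_nat \<nu> * c)) ` ({0..q} \<times> {0..n})
     \<union> (\<lambda>\<nu> w. g 0 (w + of_nat \<nu> * c)) ` {0..n} \<union> coeff_det ` index_sets \<union> {C}"

text \<open>On such circles every logarithm that occurs is finite and continuous, as Poisson-Jensen
  requires; only countably many radii are excluded.\<close>

definition good :: "real \<Rightarrow> bool" where
  "good r \<longleftrightarrow> (\<forall>f\<in>test_functions. \<forall>z. norm z = r \<longrightarrow> f z \<noteq> 0)"

lemma good_dense: "x < y \<Longrightarrow> \<exists>R. x < R \<and> R < y \<and> good R"
  unfolding good_def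
proof (rule zero_free_radius)
  show "finite test_functions" unfolding test_functions_def using finite_index_sets by auto
  show "nz_entire f" if "f \<in> test_functions" for f
    using that unfolding test_functions_def
    by (auto intro: nz_entire_shift[OF L_nz_entire] nz_entire_shift[OF g_nz_entire] coeff_det_nz_entire C_nz_entire)
qed

lemma goodD:
  assumes "good r" "norm z = r"
  shows "j \<le> q \<Longrightarrow> \<nu> \<le> n \<Longrightarrow> L j (z + of_nat \<nu> * c) \<noteq> 0" "\<nu> \<le> n \<Longrightarrow> g 0 (z + of_nat \<nu> * c) \<noteq> 0"
    "j \<le> q \<Longrightarrow> L j z \<noteq> 0" "g 0 z \<noteq> 0" "J \<in> index_sets \<Longrightarrow> coeff_det J z \<noteq> 0" "C z \<noteq> 0"
proof -
  show L: "L j (z + of_nat \<nu> * c) \<noteq> 0" if "j \<le> q" "\<nu> \<le> n" for j \<nu>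
  proof -
    have "(\<lambda>w. L j (w + of_nat \<nu> * c)) \<in> test_functions"
      unfolding test_functions_def using that by (intro UnI1 image_eqI[of _ _ "(j, \<nu>)"]) auto
    from assms(1)[unfolded good_def, rule_format, OF this assms(2)] show ?thesis .
  qed
  show G: "g 0 (z + of_nat \<nu> * c) \<noteq> 0" if "\<nu> \<le> n" for \<nu>
  proof -
    have "(\<lambda>w. g 0 (w + of_nat \<nu> * c)) \<in> test_functions"
      unfolding test_functions_def using that by auto
    from assms(1)[unfolded good_def, rule_format, OF this assms(2)] show ?thesis .
  qed
  show "j \<le> q \<Longrightarrow> L j z \<noteq> 0" using L[of j 0] by simp
  show "g 0 z \<noteq> 0" using G[of 0] by simp
  show "coeff_det J z \<noteq> 0" if "J \<in> index_sets"
  proof -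
    have "coeff_det J \<in> test_functions" unfolding test_functions_def using that by blast
    from assms(1)[unfolded good_def, rule_format, OF this assms(2)] show ?thesis .
  qed
  have "C \<in> test_functions" unfolding test_functions_def by blast
  from assms(1)[unfolded good_def, rule_format, OF this assms(2)] show "C z \<noteq> 0" .
qed

text \<open>The positive part of ln |l(z + \<nu> c) / l(z)| for l = L j / g 0.\<close>

definition log_quot :: "nat \<Rightarrow> nat \<Rightarrow> complex \<Rightarrow> real" where
  "log_quot j \<nu> z = max 0 ((ln (norm (L j (z + of_nat \<nu> * c))) - ln (norm (g 0 (z + of_nat \<nu> * c))))
      - (ln (norm (L j z)) - ln (norm (g 0 z))))"

text \<open>With \<open>I\<close> the n smallest forms at \<open>z\<close>, each form outside
  \<open>I\<close> bounds \<open>u\<close>, up to an error. The q - n forms outside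
  \<open>J0\<close> use this bound; those of \<open>J0\<close> are bounded below by the Casoratian.
  As \<open>J0\<close> varies with \<open>z\<close>, the errors are summed over all index sets and
  all forms before averaging.\<close>

lemma pointwise_inequality:
  assumes z: "good r" "norm z = r"
  shows "real (q - n) * u z + ln (norm (C z)) \<le> (\<Sum>j\<in>{0..q}. ln (norm (L j z)))
    + (\<Sum>\<nu><Suc n. ln (norm (g 0 (z + of_nat \<nu> * c))) - ln (norm (g 0 z))) + ln (fact (Suc n))
    + (\<Sum>\<nu><Suc n. \<Sum>j\<in>{0..q}. log_quot j \<nu> z) + (real q + 2) * (\<Sum>J\<in>index_sets. err J z)"
proof -
  note nz = goodD[OF z]
  define E where "E = (\<Sum>J\<in>index_sets. err J z)"
  have E: "err J z \<le> E" if "J \<in> index_sets" for J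
    unfolding E_def by (rule member_le_sum[OF that]) (auto intro: err_nonneg finite_index_sets)
  have E0: "0 \<le> E" unfolding E_def by (intro sum_nonneg err_nonneg)
  obtain I where I: "I \<subseteq> {0..q}" "card I = n" "\<forall>i\<in>I. \<forall>j\<in>{0..q} - I. norm (L i z) \<le> norm (L j z)"
    using smallest_subset[of "{0..q}" n "\<lambda>i. norm (L i z)"] n_le_q by auto
  have fI: "finite I" using I finite_subset by blast
  have J: "insert j I \<in> index_sets" if "j \<in> {0..q} - I" for j
    using that I fI by (auto simp: index_sets_def)
  have out: "u z \<le> ln (norm (L j z)) + E" if j: "j \<in> {0..q} - I" for j
  proof -
    have "u z \<le> ln (norm (L j z)) + err (insert j I) z"
      by (rule u_le_max_form(2)[OF J[OF j] _ _ nz(5)[OF J[OF j]]]) (use I j in auto)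
    then show ?thesis using E[OF J[OF j]] by linarith
  qed
  have "card ({0..q} - I) = q + 1 - n" using I fI by (simp add: card_Diff_subset)
  then have "card ({0..q} - I) \<noteq> 0" using n_le_q by simp
  then have "{0..q} - I \<noteq> {}" by (metis card.empty)
  then obtain j0 where j0: "j0 \<in> {0..q} - I" by blast
  define J0 where "J0 = insert j0 I"
  have J0: "J0 \<in> index_sets" using J[OF j0] by (simp add: J0_def)
  have sub: "J0 \<subseteq> {0..q}" "finite J0" "card J0 = n + 1" using J0 finite_subset by (auto simp: index_sets_def)
  have rest: "real (q - n) * u z \<le> (\<Sum>j\<in>{0..q} - J0. ln (norm (L j z))) + real (q + 1) * E"
  proof -
    have cd: "card ({0..q} - J0) = q - n" using sub by (simp add: card_Diff_subset)
    have "(\<Sum>j\<in>{0..q} - J0. u z) \<le> (\<Sum>j\<in>{0..q} - J0. ln (norm (L j z)) + E)"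
      by (rule sum_mono) (use out in \<open>auto simp: J0_def\<close>)
    then have "real (q - n) * u z \<le> (\<Sum>j\<in>{0..q} - J0. ln (norm (L j z))) + real (q - n) * E"
      by (simp add: cd sum.distrib)
    moreover have "real (q - n) * E \<le> real (q + 1) * E" using E0 by (intro mult_right_mono) auto
    ultimately show ?thesis by linarith
  qed
  \<comment> \<open>Passing from quotients of L j to quotients of L j / g 0 costs a factor depending
    on the row \<nu> alone, so it leaves the determinant once per row.\<close>
  define G where "G = (\<lambda>\<nu>. norm (g 0 (z + of_nat \<nu> * c)) / norm (g 0 z))"
  define X where "X = (\<lambda>\<nu>. exp (\<Sum>j\<in>{0..q}. log_quot j \<nu> z))"
  have cas: "norm (C z * coeff_det J0 z) \<le> (\<Prod>j\<in>J0. norm (L j z)) * (fact (Suc n) * (\<Prod>\<nu><Suc n. G \<nu> * X \<nu>))"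
  proof -
    define Q where "Q = (\<lambda>\<nu> i. L (enum J0 i) (z + of_nat \<nu> * c) / L (enum J0 i) z)"
    have "C z * coeff_det J0 z = fdet (Suc n) (\<lambda>\<nu> i. L (enum J0 i) z * Q \<nu> i)"
      unfolding casoratian_forms[OF J0, symmetric]
      by (rule fdet_cong) (use nz(3) enum_le[OF J0] in \<open>auto simp: Q_def\<close>)
    also have "\<dots> = (\<Prod>i<Suc n. L (enum J0 i) z) * fdet (Suc n) Q" by (rule fdet_scale_cols)
    also have "norm \<dots> = (\<Prod>i<Suc n. norm (L (enum J0 i) z)) * norm (fdet (Suc n) Q)"
      by (simp add: norm_mult prod_norm del: prod.lessThan_Suc)
    also have "(\<Prod>i<Suc n. norm (L (enum J0 i) z)) = (\<Prod>j\<in>J0. norm (L j z))"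
      by (rule prod.reindex_bij_betw[OF enum_bij[OF J0]])
    also have "(\<Prod>j\<in>J0. norm (L j z)) * norm (fdet (Suc n) Q)
        \<le> (\<Prod>j\<in>J0. norm (L j z)) * (fact (Suc n) * (\<Prod>\<nu><Suc n. G \<nu> * X \<nu>))"
    proof (intro mult_left_mono fdet_norm_le)
      fix \<nu> i assume v: "\<nu> < Suc n" "i < Suc n"
      define j where "j = enum J0 i"
      have j: "j \<le> q" using enum_le[OF J0 v(2)] by (simp add: j_def)
      have n1: "L j (z + of_nat \<nu> * c) \<noteq> 0" "g 0 (z + of_nat \<nu> * c) \<noteq> 0" "L j z \<noteq> 0" "g 0 z \<noteq> 0"
        using nz(1)[of j \<nu>] nz(2)[of \<nu>] nz(3)[of j] nz(4) j v by auto
      have "log_quot j \<nu> z \<le> (\<Sum>j\<in>{0..q}. log_quot j \<nu> z)"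
        by (rule member_le_sum) (use j in \<open>auto simp: log_quot_def\<close>)
      then have "(ln (norm (L j (z + of_nat \<nu> * c))) - ln (norm (g 0 (z + of_nat \<nu> * c))))
         - (ln (norm (L j z)) - ln (norm (g 0 z))) \<le> (\<Sum>j\<in>{0..q}. log_quot j \<nu> z)"
        unfolding log_quot_def by linarith
      then have "exp (ln (norm (L j (z + of_nat \<nu> * c))) - ln (norm (L j z))) \<le>
         exp (ln (norm (g 0 (z + of_nat \<nu> * c))) - ln (norm (g 0 z)) + (\<Sum>j\<in>{0..q}. log_quot j \<nu> z))"
        by simp
      then have "norm (L j (z + of_nat \<nu> * c)) / norm (L j z) \<le> G \<nu> * X \<nu>"
        using n1 by (simp add: exp_diff exp_add G_def X_def)
      then show "norm (Q \<nu> i) \<le> G \<nu> * X \<nu>" by (simp add: Q_def j_def norm_divide)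
    qed (auto intro: prod_nonneg)
    finally show ?thesis .
  qed
  have Gp: "0 < G \<nu>" if "\<nu> < Suc n" for \<nu> using nz(2)[of \<nu>] nz(4) that by (simp add: G_def)
  have Xp: "0 < X \<nu>" for \<nu> by (simp add: X_def)
  have Pp: "0 < (\<Prod>j\<in>J0. norm (L j z))" using nz(3) sub by (intro prod_pos) auto
  have P2: "0 < (\<Prod>\<nu><Suc n. G \<nu> * X \<nu>)" using Gp Xp by (intro prod_pos) auto
  have "ln (norm (C z * coeff_det J0 z)) \<le> ln ((\<Prod>j\<in>J0. norm (L j z)) * (fact (Suc n) * (\<Prod>\<nu><Suc n. G \<nu> * X \<nu>)))"
    using cas nz(5)[OF J0] nz(6) by (intro ln_mono) auto
  also have "\<dots> = ln (\<Prod>j\<in>J0. norm (L j z)) + (ln (fact (Suc n)) + ln (\<Prod>\<nu><Suc n. G \<nu> * X \<nu>))"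
    using Pp P2 by (simp add: ln_mult_pos del: fact_Suc prod.lessThan_Suc)
  also have "ln (\<Prod>j\<in>J0. norm (L j z)) = (\<Sum>j\<in>J0. ln (norm (L j z)))"
    by (rule ln_prod) (use sub nz(3) in auto)
  also have "ln (\<Prod>\<nu><Suc n. G \<nu> * X \<nu>) = (\<Sum>\<nu><Suc n. ln (G \<nu> * X \<nu>))"
  proof (rule ln_prod)
    fix \<nu> assume "\<nu> \<in> {..<Suc n}"
    then show "G \<nu> * X \<nu> \<noteq> 0" using Gp[of \<nu>] Xp[of \<nu>] by auto
  qed simp
  also have "\<dots> = (\<Sum>\<nu><Suc n. (ln (norm (g 0 (z + of_nat \<nu> * c))) - ln (norm (g 0 z))) + (\<Sum>j\<in>{0..q}. log_quot j \<nu> z))"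
  proof (intro sum.cong refl)
    fix \<nu> assume "\<nu> \<in> {..<Suc n}"
    then have v: "\<nu> \<le> n" by auto
    have "ln (G \<nu> * X \<nu>) = ln (G \<nu>) + ln (X \<nu>)" using Gp[of \<nu>] Xp[of \<nu>] v by (simp add: ln_mult_pos)
    then show "ln (G \<nu> * X \<nu>) = (ln (norm (g 0 (z + of_nat \<nu> * c))) - ln (norm (g 0 z))) + (\<Sum>j\<in>{0..q}. log_quot j \<nu> z)"
      using nz(2)[OF v] nz(4) by (simp add: G_def X_def ln_div)
  qed
  finally have 1: "ln (norm (C z * coeff_det J0 z)) \<le> (\<Sum>j\<in>J0. ln (norm (L j z))) + (ln (fact (Suc n))
    + ((\<Sum>\<nu><Suc n. ln (norm (g 0 (z + of_nat \<nu> * c))) - ln (norm (g 0 z))) + (\<Sum>\<nu><Suc n. \<Sum>j\<in>{0..q}. log_quot j \<nu> z)))"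
    by (simp only: sum.distrib)
  have 2: "ln (norm (C z * coeff_det J0 z)) = ln (norm (C z)) + ln (norm (coeff_det J0 z))"
    using nz(5)[OF J0] nz(6) by (simp add: norm_mult ln_mult_pos)
  have 3: "- E \<le> ln (norm (coeff_det J0 z))"
  proof -
    have "\<bar>ln (norm (coeff_det J0 z))\<bar> \<le> err J0 z" unfolding err_def by (auto intro!: add_nonneg_nonneg sum_nonneg)
    then show ?thesis using E[OF J0] by linarith
  qed
  have 4: "(\<Sum>j\<in>{0..q}. ln (norm (L j z))) = (\<Sum>j\<in>{0..q} - J0. ln (norm (L j z))) + (\<Sum>j\<in>J0. ln (norm (L j z)))"
    using sub by (intro sum.subset_diff) auto
  \<comment> \<open>q + 1 copies of \<open>E\<close> cover the forms outside \<open>J0\<close>, one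
    covers the logarithm of the coefficient determinant.\<close>
  have 5: "(real q + 2) * E = real (q + 1) * E + E" by (simp add: algebra_simps)
  show ?thesis using 1 2 3 4 5 rest unfolding E_def[symmetric] by linarith
qed

lemma cont: "f holomorphic_on UNIV \<Longrightarrow> continuous_on S f"
  using holomorphic_on_imp_continuous_on holomorphic_on_subset by blast

lemma L_continuous: "j \<le> q \<Longrightarrow> continuous_on S (\<lambda>z. L j (z + b))"
  by (rule nz_entire_continuous[OF nz_entire_shift[OF L_nz_entire]])

lemma g_continuous: "k \<le> n \<Longrightarrow> continuous_on S (\<lambda>z. g k (z + b))"
  by (rule nz_entire_continuous[OF nz_entire_shift[OF g_nz_entire]])

lemma err_continuous:
  assumes J: "J \<in> index_sets" and "\<And>z. norm z = r \<Longrightarrow> coeff_det J z \<noteq> 0"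
  shows "continuous_on (sphere 0 r) (err J)"
proof -
  have "continuous_on S (inv_coeff J k i)" if "k < Suc n" "i < Suc n" for k i S
    using inv_coeff_small[OF J that] by (intro cont) (auto simp: small_periodic_def)
  then show ?thesis unfolding err_def
    using assms(2) by (auto intro!: continuous_intros nz_entire_continuous[OF coeff_det_nz_entire[OF J]])
qed

lemma log_quot_continuous:
  assumes r: "good r" and j: "j \<le> q" "\<nu> \<le> n"
  shows "continuous_on (sphere 0 r) (log_quot j \<nu>)"
  unfolding log_quot_def
  using goodD(1)[OF r _ j] goodD(2)[OF r _ j(2)] goodD(3)[OF r _ j(1)] goodD(4)[OF r]
    L_continuous[OF j(1), of _ 0] g_continuous[of 0 _ 0]
  by (auto intro!: continuous_intros L_continuous j g_continuous)

lemma mean_inequality: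
  assumes r: "good r" "1 \<le> r"
  shows "real (q - n) * (T r + u 0) + circle_mean (\<lambda>z. ln (norm (C z))) r \<le> (\<Sum>j\<in>{0..q}. circle_mean (\<lambda>z. ln (norm (L j z))) r)
    + (\<Sum>\<nu><Suc n. circle_mean (\<lambda>z. ln (norm (g 0 (z + of_nat \<nu> * c)))) r - circle_mean (\<lambda>z. ln (norm (g 0 z))) r) + ln (fact (Suc n))
    + (\<Sum>\<nu><Suc n. \<Sum>j\<in>{0..q}. circle_mean (log_quot j \<nu>) r) + (real q + 2) * (\<Sum>J\<in>index_sets. circle_mean (err J) r)"
proof -
  have m: "has_circle_mean (\<lambda>z. ln (norm (h z))) r (circle_mean (\<lambda>z. ln (norm (h z))) r)" if "nz_entire h" for h
    using jensen[OF that r(2)] circle_mean_eq[OF jensen[OF that r(2)]] by simp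
  have r0: "0 < r" "0 \<le> r" using r by auto
  have lhs: "has_circle_mean (\<lambda>z. real (q - n) * u z + ln (norm (C z))) r
      (real (q - n) * (T r + u 0) + circle_mean (\<lambda>z. ln (norm (C z))) r)"
    by (intro has_circle_mean_add has_circle_mean_cmult mean_u m C_nz_entire r0)
  have rhs: "has_circle_mean (\<lambda>z. (\<Sum>j\<in>{0..q}. ln (norm (L j z)))
    + (\<Sum>\<nu><Suc n. ln (norm (g 0 (z + of_nat \<nu> * c))) - ln (norm (g 0 z))) + ln (fact (Suc n))
    + (\<Sum>\<nu><Suc n. \<Sum>j\<in>{0..q}. log_quot j \<nu> z) + (real q + 2) * (\<Sum>J\<in>index_sets. err J z)) r
    ((\<Sum>j\<in>{0..q}. circle_mean (\<lambda>z. ln (norm (L j z))) r)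
    + (\<Sum>\<nu><Suc n. circle_mean (\<lambda>z. ln (norm (g 0 (z + of_nat \<nu> * c)))) r - circle_mean (\<lambda>z. ln (norm (g 0 z))) r) + ln (fact (Suc n))
    + (\<Sum>\<nu><Suc n. \<Sum>j\<in>{0..q}. circle_mean (log_quot j \<nu>) r) + (real q + 2) * (\<Sum>J\<in>index_sets. circle_mean (err J) r))"
    by (intro has_circle_mean_add has_circle_mean_cmult has_circle_mean_sum has_circle_mean_diff has_circle_mean_const
          m L_nz_entire nz_entire_shift[OF g_nz_entire] g_nz_entire
          has_circle_mean_continuous[OF log_quot_continuous[OF r(1)] r0(2)]
          has_circle_mean_continuous[OF err_continuous r0(2)])
       (use goodD(5)[OF r(1)] in auto)
  show ?thesis
    by (rule has_circle_mean_le[OF lhs rhs r0(1)]) (rule pointwise_inequality[OF r(1)])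
qed

lemma aperiodic_locus_finite: "j \<le> q \<Longrightarrow> nonzero_locus_finite (aperiodic_mult n c (L j))"
  unfolding nonzero_locus_finite_def
proof
  fix r assume j: "j \<le> q"
  have "{z. norm z \<le> r \<and> aperiodic_mult n c (L j) z \<noteq> 0} \<subseteq> {z. norm z \<le> r \<and> L j z = 0}"
    by (auto simp: aperiodic_mult_def)
  then show "finite {z. norm z \<le> r \<and> aperiodic_mult n c (L j) z \<noteq> 0}"
    using finite_zeros_cball[OF L_nz_entire[OF j]] finite_subset by blast
qed

text \<open>The multiplicity inequality \<open>sum_succ_mult_le\<close> holds at every point, so it
  survives weighting by the nonnegative \<open>log_ratio\<close>.\<close>

lemma counting_inequality:
  assumes r: "1 \<le> r"
  shows "(\<Sum>j\<in>{0..q}. log_count (zorder (L j)) r) \<le> (\<Sum>j\<in>{0..q}. log_count (aperiodic_mult n c (L j)) r)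
    + log_count (zorder C) r + (real q + 2) * (\<Sum>J\<in>index_sets. log_count (zorder (coeff_det J)) r)"
proof -
  define \<alpha> where "\<alpha> = (\<lambda>z. \<Sum>j\<in>{0..q}. aperiodic_mult n c (L j) z)"
  define \<gamma> where "\<gamma> = (\<lambda>z. \<Sum>J\<in>index_sets. zorder (coeff_det J) z)"
  have fa: "nonzero_locus_finite \<alpha>" unfolding \<alpha>_def by (intro nonzero_locus_finite_sum aperiodic_locus_finite) auto
  have fg: "nonzero_locus_finite \<gamma>" unfolding \<gamma>_def by (intro nonzero_locus_finite_sum zorder_locus_finite coeff_det_nz_entire)
  have fC: "nonzero_locus_finite (zorder C)" by (rule zorder_locus_finite[OF C_nz_entire])
  have fL: "nonzero_locus_finite (\<lambda>z. \<Sum>j\<in>{0..q}. zorder (L j) z)"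
    by (intro nonzero_locus_finite_sum zorder_locus_finite L_nz_entire) auto
  have fg': "nonzero_locus_finite (\<lambda>z. (int q + 2) * \<gamma> z)" by (rule nonzero_locus_finite_cmult[OF fg])
  have "(\<Sum>j\<in>{0..q}. log_count (zorder (L j)) r) = log_count (\<lambda>z. \<Sum>j\<in>{0..q}. zorder (L j) z) r"
    by (rule log_count_sum[symmetric]) (auto intro: zorder_locus_finite L_nz_entire r)
  also have "\<dots> \<le> log_count (\<lambda>z. \<alpha> z + (zorder C z + (int q + 2) * \<gamma> z)) r"
  proof (rule log_count_mono[OF fL _ r])
    show "nonzero_locus_finite (\<lambda>z. \<alpha> z + (zorder C z + (int q + 2) * \<gamma> z))"
      by (intro nonzero_locus_finite_add fa fC fg')
    fix z
    have "(\<Sum>j\<in>{0..q}. zorder (L j) z) = \<alpha> z + (\<Sum>j\<in>{0..q}. succ_mult j z)"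
      unfolding \<alpha>_def sum.distrib[symmetric] by (simp add: succ_mult_def)
    then show "(\<Sum>j\<in>{0..q}. zorder (L j) z) \<le> \<alpha> z + (zorder C z + (int q + 2) * \<gamma> z)"
      using sum_succ_mult_le[of z] by (simp add: \<gamma>_def)
  qed
  also have "\<dots> = log_count \<alpha> r + (log_count (zorder C) r + log_count (\<lambda>z. (int q + 2) * \<gamma> z) r)"
    using log_count_add[OF fa nonzero_locus_finite_add[OF fC fg'] r] log_count_add[OF fC fg' r] by simp
  also have "log_count (\<lambda>z. (int q + 2) * \<gamma> z) r = (real q + 2) * log_count \<gamma> r"
    by (simp add: log_count_cmult)
  also have "log_count \<gamma> r = (\<Sum>J\<in>index_sets. log_count (zorder (coeff_det J)) r)"
    unfolding \<gamma>_def by (rule log_count_sum[OF finite_index_sets]) (auto intro: zorder_locus_finite coeff_det_nz_entire r)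
  also have "log_count \<alpha> r = (\<Sum>j\<in>{0..q}. log_count (aperiodic_mult n c (L j)) r)"
    unfolding \<alpha>_def by (rule log_count_sum) (auto intro: aperiodic_locus_finite r)
  finally show ?thesis by simp
qed

lemma log_plus_mean_smallo: "f \<in> small_periodic \<Longrightarrow> (\<lambda>r. circle_mean (\<lambda>z. ln (max 1 (norm (f z)))) r) \<in> o[at_top](T)"
  by (simp add: small_periodic_def)

lemma coeff_det_log_mean:
  assumes J: "J \<in> index_sets" and r: "1 \<le> r"
  shows "circle_mean (\<lambda>z. ln (norm (coeff_det J z))) 1 + log_count (zorder (coeff_det J)) r \<le> circle_mean (\<lambda>z. ln (max 1 (norm (coeff_det J z)))) r"
proof (rule has_circle_mean_le_except[OF jensen[OF coeff_det_nz_entire[OF J] r] has_circle_mean_continuous _ finite_zeros_cball[OF coeff_det_nz_entire[OF J], of r]])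
  show "continuous_on (sphere 0 r) (\<lambda>z. ln (max 1 (norm (coeff_det J z))))"
    using nz_entire_continuous[OF coeff_det_nz_entire[OF J]] by (auto intro!: continuous_intros)
  show "ln (norm (coeff_det J z)) \<le> ln (max 1 (norm (coeff_det J z)))" if "norm z = r" "z \<notin> {z. norm z \<le> r \<and> coeff_det J z = 0}" for z
    using that by (intro ln_mono) auto
qed (use r in auto)

lemma coeff_det_log_count_small:
  assumes J: "J \<in> index_sets"
  shows "(\<lambda>r. log_count (zorder (coeff_det J)) r) \<in> o[at_top](T)"
proof (rule smallo_T_sandwich)
  define K where "K = circle_mean (\<lambda>z. ln (norm (coeff_det J z))) 1"
  show "(\<lambda>r. circle_mean (\<lambda>z. ln (max 1 (norm (coeff_det J z)))) r + (- K)) \<in> o[at_top](T)"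
    by (intro sum_in_smallo const_smallo_T log_plus_mean_smallo coeff_det_small J)
  show "\<forall>\<^sub>F r in at_top. 0 \<le> log_count (zorder (coeff_det J)) r \<and> log_count (zorder (coeff_det J)) r \<le> circle_mean (\<lambda>z. ln (max 1 (norm (coeff_det J z)))) r + (- K)"
    using eventually_ge_at_top[of 1]
    by eventually_elim (use log_count_nonneg[OF _ zorder_nonneg[OF coeff_det_nz_entire[OF J]]] coeff_det_log_mean[OF J] in \<open>force simp: K_def\<close>)
qed

text \<open>The identity |ln x| = 2 ln (max 1 x) - ln x reduces the absolute value to a small mean
  and to the mean of ln |coeff_det J|, which Jensen's formula bounds below by a constant.\<close>

lemma err_mean_small:
  assumes J: "J \<in> index_sets"
  obtains Y where "Y \<in> o[at_top](T)" "\<And>r. good r \<Longrightarrow> 1 \<le> r \<Longrightarrow> circle_mean (err J) r \<le> Y r"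
proof
  define K where "K = circle_mean (\<lambda>z. ln (norm (coeff_det J z))) 1"
  define Y where "Y = (\<lambda>r. ln (real (Suc n)) + (\<Sum>k<Suc n. \<Sum>i<Suc n. circle_mean (\<lambda>z. ln (max 1 (norm (inv_coeff J k i z)))) r)
     + (2 * circle_mean (\<lambda>z. ln (max 1 (norm (coeff_det J z)))) r + (- K)))"
  show "Y \<in> o[at_top](T)" unfolding Y_def
    by (intro sum_in_smallo const_smallo_T big_sum_in_smallo landau_o.small.cmult_in_iff[THEN iffD2]
         log_plus_mean_smallo coeff_det_small inv_coeff_small J) auto
  fix r assume r: "good r" "1 \<le> r"
  note d = coeff_det_nz_entire[OF J]
  have c1: "continuous_on S (inv_coeff J k i)" if "k < Suc n" "i < Suc n" for k i S
    using inv_coeff_small[OF J that] by (intro cont) (auto simp: small_periodic_def)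
  have "has_circle_mean (\<lambda>z. ln (real (Suc n)) + (\<Sum>k<Suc n. \<Sum>i<Suc n. ln (max 1 (norm (inv_coeff J k i z))))
     + (2 * ln (max 1 (norm (coeff_det J z))) - ln (norm (coeff_det J z)))) r
     (ln (real (Suc n)) + (\<Sum>k<Suc n. \<Sum>i<Suc n. circle_mean (\<lambda>z. ln (max 1 (norm (inv_coeff J k i z)))) r)
     + (2 * circle_mean (\<lambda>z. ln (max 1 (norm (coeff_det J z)))) r - (K + log_count (zorder (coeff_det J)) r)))"
    unfolding K_def
    by (intro has_circle_mean_add has_circle_mean_const has_circle_mean_sum has_circle_mean_diff has_circle_mean_cmult
         jensen[OF d r(2)] has_circle_mean_continuous)
       (use r(2) in \<open>auto intro!: continuous_intros c1 nz_entire_continuous[OF d]\<close>)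
  then have "has_circle_mean (err J) r
     (ln (real (Suc n)) + (\<Sum>k<Suc n. \<Sum>i<Suc n. circle_mean (\<lambda>z. ln (max 1 (norm (inv_coeff J k i z)))) r)
     + (2 * circle_mean (\<lambda>z. ln (max 1 (norm (coeff_det J z)))) r - (K + log_count (zorder (coeff_det J)) r)))"
  proof (rule has_circle_mean_cong)
    fix z :: complex assume "norm z = r"
    then have "coeff_det J z \<noteq> 0" using goodD(5)[OF r(1) _ J] by blast
    then have "2 * ln (max 1 (norm (coeff_det J z))) - ln (norm (coeff_det J z)) = \<bar>ln (norm (coeff_det J z))\<bar>"
      by (cases "norm (coeff_det J z) \<le> 1") (auto simp: max_def)
    then show "ln (real (Suc n)) + (\<Sum>k<Suc n. \<Sum>i<Suc n. ln (max 1 (norm (inv_coeff J k i z))))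
     + (2 * ln (max 1 (norm (coeff_det J z))) - ln (norm (coeff_det J z))) = err J z" unfolding err_def by simp
  qed (use r in auto)
  moreover have "0 \<le> log_count (zorder (coeff_det J)) r"
    by (rule log_count_nonneg[OF r(2)]) (rule zorder_nonneg[OF d])
  ultimately show "circle_mean (err J) r \<le> Y r"
    unfolding Y_def using circle_mean_eq by fastforce
qed

section \<open>Estimates on good radii\<close>

text \<open>The logarithmic loss in bounding \<open>L j\<close> by exp u, again a sum so that its
  mean is visibly o(T).\<close>

definition coeff_bound :: "nat \<Rightarrow> complex \<Rightarrow> real" where
  "coeff_bound j z = ln (real (Suc n)) + (\<Sum>k<Suc n. ln (max 1 (norm (a j k z))))"

lemma coeff_bound_nonneg: "0 \<le> coeff_bound j z"
  unfolding coeff_bound_def by (intro add_nonneg_nonneg sum_nonneg) auto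

lemma coeff_bound_mean:
  assumes j: "j \<le> q" and r: "0 \<le> r"
  shows "has_circle_mean (coeff_bound j) r (circle_mean (coeff_bound j) r)"
  by (rule has_circle_mean_continuous[OF _ r])
     (use j in \<open>auto simp: coeff_bound_def intro!: continuous_intros cont a_holomorphic\<close>)

lemma coeff_bound_small:
  assumes j: "j \<le> q"
  shows "(\<lambda>r. circle_mean (coeff_bound j) r) \<in> o[at_top](T)"
proof (rule landau_o.small.in_cong[THEN iffD1])
  define Y where "Y = (\<lambda>r. ln (real (Suc n)) + (\<Sum>k<Suc n. circle_mean (\<lambda>z. ln (max 1 (norm (a j k z)))) r))"
  show "Y \<in> o[at_top](T)" unfolding Y_def
    by (intro sum_in_smallo const_smallo_T big_sum_in_smallo log_plus_mean_smallo small j) auto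
  show "\<forall>\<^sub>F r in at_top. Y r = circle_mean (coeff_bound j) r"
    using eventually_ge_at_top[of 0]
  proof eventually_elim
    case (elim r)
    have "has_circle_mean (coeff_bound j) r (Y r)" unfolding coeff_bound_def Y_def
      by (intro has_circle_mean_add has_circle_mean_const has_circle_mean_sum has_circle_mean_continuous)
         (use elim j in \<open>auto intro!: continuous_intros cont a_holomorphic\<close>)
    then show ?case by (simp add: circle_mean_eq)
  qed
qed

lemma ln_form_le:
  assumes j: "j \<le> q" and nz: "L j z \<noteq> 0"
  shows "ln (norm (L j z)) \<le> u z + coeff_bound j z"
proof -
  define P where "P = (\<Prod>k<Suc n. max 1 (norm (a j k z)))"
  have P1: "1 \<le> P" unfolding P_def by (intro prod_ge_1) auto
  have "norm (a j k z) \<le> P" if "k < Suc n" for k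
  proof -
    have "max 1 (norm (a j k z)) \<le> P" unfolding P_def using that by (intro member_le_prod_real) auto
    then show ?thesis by linarith
  qed
  then have "(\<Sum>k<Suc n. norm (a j k z * g k z)) \<le> (\<Sum>k<Suc n. P * exp (u z))"
    unfolding norm_mult using P1 by (intro sum_mono mult_mono norm_g_le) auto
  moreover have "norm (L j z) \<le> (\<Sum>k<Suc n. norm (a j k z * g k z))" unfolding L_sum by (rule norm_sum)
  ultimately have "norm (L j z) \<le> real (Suc n) * P * exp (u z)" by simp
  then have "ln (norm (L j z)) \<le> ln (real (Suc n) * P * exp (u z))" using nz by (intro ln_mono) auto
  also have "\<dots> = ln (real (Suc n)) + ln P + u z" using P1 by (simp add: ln_mult_pos del: of_nat_Suc)
  also have "ln P = (\<Sum>k<Suc n. ln (max 1 (norm (a j k z))))"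
    unfolding P_def by (rule ln_prod) auto
  finally show ?thesis unfolding coeff_bound_def by linarith
qed

lemma form_mean_le:
  assumes j: "j \<le> q" and r: "1 \<le> r"
  shows "circle_mean (\<lambda>z. ln (norm (L j z))) r \<le> T r + u 0 + circle_mean (coeff_bound j) r"
proof (rule has_circle_mean_le_except[OF _ has_circle_mean_add[OF mean_u coeff_bound_mean[OF j]] _
    finite_zeros_cball[OF L_nz_entire[OF j], of r]])
  show "has_circle_mean (\<lambda>z. ln (norm (L j z))) r (circle_mean (\<lambda>z. ln (norm (L j z))) r)"
    using jensen[OF L_nz_entire[OF j] r] circle_mean_eq[OF jensen[OF L_nz_entire[OF j] r]] by simp
qed (use r ln_form_le[OF j] in auto)

lemma smallo_le_T: "X \<in> o[at_top](T) \<Longrightarrow> 0 < e \<Longrightarrow> eventually (\<lambda>r. X r \<le> e * T r) at_top"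
proof -
  assume X: "X \<in> o[at_top](T)" "0 < e"
  have "eventually (\<lambda>r. norm (X r) \<le> e * norm (T r)) at_top" using landau_o.smallD[OF X] .
  moreover have "eventually (\<lambda>r. 0 \<le> T r) at_top" using T_at_top by (simp add: filterlim_at_top)
  ultimately show ?thesis by eventually_elim auto
qed

lemma form_log_count_le:
  assumes j: "j \<le> q"
  shows "eventually (\<lambda>r. log_count (zorder (L j)) r \<le> 2 * T r) at_top"
proof -
  define J where "J = circle_mean (\<lambda>z. ln (norm (L j z))) 1"
  have X: "(\<lambda>r. circle_mean (coeff_bound j) r + (u 0 - J)) \<in> o[at_top](T)"
    by (intro sum_in_smallo const_smallo_T coeff_bound_small j)
  have one_pos: "0 < (1::real)" by simp
  from smallo_le_T[OF X one_pos] eventually_ge_at_top[of 1] show ?thesis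
  proof eventually_elim
    case (elim r)
    then show ?case
      using form_mean_le[OF j, of r] circle_mean_eq[OF jensen[OF L_nz_entire[OF j], of r]]
      unfolding J_def by linarith
  qed
qed

lemma g0_log_count_le: "eventually (\<lambda>r. log_count (zorder (g 0)) r \<le> 2 * T r) at_top"
proof -
  obtain K where K: "0 \<le> K" "\<And>r. 1 \<le> r \<Longrightarrow> circle_mean (\<lambda>z. ln (norm (g 0 z))) r \<le> T r + K"
    "\<And>r. 1 \<le> r \<Longrightarrow> - K \<le> circle_mean (\<lambda>z. ln (norm (g 0 z))) r"
    "\<And>r. 1 \<le> r \<Longrightarrow> log_count (zorder (g 0)) r \<le> T r + K"
    using g_counting_bounds[of 0] by auto
  have one_pos: "0 < (1::real)" by simp
  from smallo_le_T[OF const_smallo_T[of K] one_pos] eventually_ge_at_top[of 1] show ?thesis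
  proof eventually_elim
    case (elim r)
    then show ?case using K(4)[of r] by linarith
  qed
qed

text \<open>|y| is bounded by 2 v - y whenever v \<ge> 0 and v \<ge> y; here y is the logarithm of
  the quotient and v is u - ln |g 0| plus the coefficient loss. By Jensen the mean of 2 v - y is at
  most 2 T plus o(T), because the log counts enter with negative sign.\<close>

lemma quotient_abs_mean_le:
  assumes j: "j \<le> q"
  shows "eventually (\<lambda>R. good R \<longrightarrow> circle_mean (\<lambda>z. \<bar>ln (norm (L j z)) - ln (norm (g 0 z))\<bar>) R \<le> 4 * T R) at_top"
proof -
  define JL where "JL = circle_mean (\<lambda>z. ln (norm (L j z))) 1"
  define Jg where "Jg = circle_mean (\<lambda>z. ln (norm (g 0 z))) 1"
  note h = L_nz_entire[OF j] g_nz_entire[of 0, simplified]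
  have "(\<lambda>r. 2 * circle_mean (coeff_bound j) r + (2 * u 0 - Jg - JL)) \<in> o[at_top](T)"
    by (intro sum_in_smallo const_smallo_T landau_o.small.cmult_in_iff[THEN iffD2] coeff_bound_small j) auto
  from smallo_le_T[OF this zero_less_two] eventually_ge_at_top[of 1] show ?thesis
  proof eventually_elim
    case (elim R)
    show ?case
    proof
      assume good: "good R"
      have R: "0 < R" "0 \<le> R" using elim by auto
      have mL: "has_circle_mean (\<lambda>z. ln (norm (L j z))) R (JL + log_count (zorder (L j)) R)"
        unfolding JL_def by (rule jensen[OF h(1) elim(2)])
      have mg: "has_circle_mean (\<lambda>z. ln (norm (g 0 z))) R (Jg + log_count (zorder (g 0)) R)"
        unfolding Jg_def by (rule jensen[OF h(2) elim(2)])
      have V: "has_circle_mean (\<lambda>z. 2 * ((u z - ln (norm (g 0 z))) + coeff_bound j z) - (ln (norm (L j z)) - ln (norm (g 0 z)))) R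
        (2 * (((T R + u 0) - (Jg + log_count (zorder (g 0)) R)) + circle_mean (coeff_bound j) R)
           - ((JL + log_count (zorder (L j)) R) - (Jg + log_count (zorder (g 0)) R)))"
        by (intro has_circle_mean_add has_circle_mean_diff has_circle_mean_cmult mL mg mean_u coeff_bound_mean j R)
      have "circle_mean (\<lambda>z. \<bar>ln (norm (L j z)) - ln (norm (g 0 z))\<bar>) R \<le>
        2 * (((T R + u 0) - (Jg + log_count (zorder (g 0)) R)) + circle_mean (coeff_bound j) R)
           - ((JL + log_count (zorder (L j)) R) - (Jg + log_count (zorder (g 0)) R))"
      proof (rule circle_mean_le_except[OF V R(1), of "{}"])
        have aux: "\<bar>x - y\<bar> \<le> 2 * ((v - y) + l) - (x - y)" if "0 \<le> v - y" "x \<le> v + l" "0 \<le> l" for x y v l :: real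
          using that by (cases "x \<le> y") (simp_all add: abs_if algebra_simps)
        fix z :: complex assume z: "norm z = R"
        have "0 \<le> u z - ln (norm (g 0 z))" using u_ge[of 0 z] goodD(4)[OF good z] by simp
        then show b: "\<bar>ln (norm (L j z)) - ln (norm (g 0 z))\<bar> \<le>
          2 * ((u z - ln (norm (g 0 z))) + coeff_bound j z) - (ln (norm (L j z)) - ln (norm (g 0 z)))"
          by (rule aux[OF _ ln_form_le[OF j goodD(3)[OF good z j]] coeff_bound_nonneg])
        then show "0 \<le> 2 * ((u z - ln (norm (g 0 z))) + coeff_bound j z) - (ln (norm (L j z)) - ln (norm (g 0 z)))"
          by linarith
      qed simp
      moreover have "0 \<le> log_count (zorder (g 0)) R" "0 \<le> log_count (zorder (L j)) R"
        by (rule log_count_nonneg[OF elim(2)], rule zorder_nonneg[OF h(2)],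
            rule log_count_nonneg[OF elim(2)], rule zorder_nonneg[OF h(1)])
      ultimately show "circle_mean (\<lambda>z. \<bar>ln (norm (L j z)) - ln (norm (g 0 z))\<bar>) R \<le> 4 * T R"
        using elim(1) by (simp add: algebra_simps)
    qed
  qed
qed

lemma eventually_powr_small:
  assumes "b < 0" "0 < e"
  shows "eventually (\<lambda>r::real. k * r powr b \<le> e) at_top"
proof -
  have "((\<lambda>r. k * r powr b) \<longlongrightarrow> k * 0) at_top"
    by (intro tendsto_mult tendsto_const tendsto_neg_powr filterlim_ident assms)
  then have "eventually (\<lambda>r. k * r powr b < e) at_top" using assms(2) by (intro order_tendstoD) auto
  then show ?thesis by eventually_elim simp
qed

text \<open>At a radius where \<open>T\<close> at most doubles on a window of length \<rho> =
  r^(1-t), the boundary term costs a factor of order 1/\<rho>, and zeros number O(r^t T(r)). Both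
  error sources are then a negative power of \<open>r\<close> times \<open>T r\<close>.\<close>

lemma good_radius_estimates:
  assumes e: "0 < e"
  shows "\<exists>r\<ge>r0. good r \<and>
    (\<forall>\<nu>\<le>n. circle_mean (\<lambda>z. ln (norm (g 0 (z + of_nat \<nu> * c)))) r - circle_mean (\<lambda>z. ln (norm (g 0 z))) r \<le> e * T r) \<and>
    (\<forall>\<nu>\<le>n. \<forall>j\<le>q. circle_mean (log_quot j \<nu>) r \<le> e * T r)"
proof -
  obtain s where s: "0 < s" "s < 1" and Ts: "eventually (\<lambda>r. T r \<le> exp (r powr s)) at_top"
    using T_growth by metis
  define t where "t = (s + 1) / 2"
  \<comment> \<open>d > t lets r^(-d) beat the zero count r^t; d < 1 is needed for
    \<open>log_difference_mean\<close>.\<close>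
  define d where "d = (t + 1) / 2"
  have td: "s < t" "t < d" "d < 1" "0 < t" "t < 1" "0 < d" using s by (auto simp: t_def d_def intro!: add_pos_pos)
  obtain K where K: "K > 0" and diff: "\<And>A B a s r R. nz_entire A \<Longrightarrow> nz_entire B \<Longrightarrow> norm a \<le> s \<Longrightarrow> 0 < r \<Longrightarrow> s \<le> r \<Longrightarrow>
     r + s < R \<Longrightarrow> (\<And>z. norm z = R \<Longrightarrow> A z \<noteq> 0 \<and> B z \<noteq> 0) \<Longrightarrow>
     (\<And>z. norm z = r \<Longrightarrow> A z \<noteq> 0 \<and> B z \<noteq> 0 \<and> A (z + a) \<noteq> 0 \<and> B (z + a) \<noteq> 0) \<Longrightarrow>
     circle_mean (\<lambda>z. max 0 ((ln (norm (A (z + a))) - ln (norm (B (z + a)))) - (ln (norm (A z)) - ln (norm (B z))))) r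
     \<le> 2 * s / (R - s - r) * circle_mean (\<lambda>z. \<bar>ln (norm (A z)) - ln (norm (B z))\<bar>) R
        + K * s powr d * r powr (- d) * (unint_counting (zorder A) R + unint_counting (zorder B) R)"
    using log_difference_mean[OF td(6,3)] by blast
  \<comment> \<open>A common bound for all shifts up to n c; the summand 1 keeps it
    positive.\<close>
  define S where "S = real n * norm c + 1"
  have S: "0 < S" by (simp add: S_def add_nonneg_pos)
  have nS: "norm (of_nat \<nu> * c) \<le> S" if "\<nu> \<le> n" for \<nu>
  proof -
    have "norm (of_nat \<nu> * c) = real \<nu> * norm c" by (simp add: norm_mult)
    also have "\<dots> \<le> real n * norm c" using that by (intro mult_right_mono) auto
    finally show ?thesis by (simp add: S_def)
  qed
  \<comment> \<open>The zeros up to r/2 number at most 4 T(r) and carry weight 2 S / M; the choice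
    32 S / e makes their total at most a quarter of e T(r).\<close>
  define M where "M = max (2 * S + 2) (32 * S / e)"
  have M: "2 * S + 2 \<le> M" "32 * S / e \<le> M" "0 < M" using S by (auto simp: M_def)
  have M8: "8 * S / M \<le> e / 4" using M e by (simp add: field_simps)
  note g0 = g_nz_entire[of 0, simplified]
  have "\<exists>K. \<forall>r. 2 * M \<le> r \<longrightarrow> circle_mean (\<lambda>z. ln (norm (g 0 (z + of_nat \<nu> * c)))) r - circle_mean (\<lambda>z. ln (norm (g 0 z))) r
    \<le> K + 2 * S / M * unint_counting (zorder (g 0)) (r / 2) + 4 * S / r * unint_counting (zorder (g 0)) (r + S)" if "\<nu> \<le> n" for \<nu>
    using jensen_shift[OF g0 nS[OF that] M(1)] by metis
  then obtain K2 where K2: "\<And>\<nu> r. \<nu> \<le> n \<Longrightarrow> 2 * M \<le> r \<Longrightarrow> circle_mean (\<lambda>z. ln (norm (g 0 (z + of_nat \<nu> * c)))) r - circle_mean (\<lambda>z. ln (norm (g 0 z))) r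
    \<le> K2 \<nu> + 2 * S / M * unint_counting (zorder (g 0)) (r / 2) + 4 * S / r * unint_counting (zorder (g 0)) (r + S)" by metis
  have "eventually (\<lambda>r. \<forall>\<nu>\<in>{..n}. K2 \<nu> \<le> e / 4 * T r) at_top"
    using e by (intro eventually_ball_finite ballI smallo_le_T const_smallo_T) auto
  moreover have "eventually (\<lambda>r. \<forall>j\<in>{..q}. log_count (zorder (L j)) r \<le> 2 * T r) at_top"
    by (intro eventually_ball_finite ballI form_log_count_le) auto
  moreover have "eventually (\<lambda>r. \<forall>j\<in>{..q}. good r \<longrightarrow> circle_mean (\<lambda>z. \<bar>ln (norm (L j z)) - ln (norm (g 0 z))\<bar>) r \<le> 4 * T r) at_top"
    by (intro eventually_ball_finite ballI quotient_abs_mean_le) auto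
  moreover have "eventually (\<lambda>r. 64 * S * r powr (t - 1) \<le> e / 2) at_top"
    "eventually (\<lambda>r. 128 * S * r powr (t - 1) \<le> e / 2) at_top"
    "eventually (\<lambda>r. 64 * K * S powr d * r powr (t - d) \<le> e / 2) at_top"
    "eventually (\<lambda>r. 4 * S * r powr (t - 1) \<le> 1) at_top"
    by (rule eventually_powr_small; use td e in simp)+
  moreover have T1: "eventually (\<lambda>r. 1 \<le> T r) at_top" using T_at_top by (simp add: filterlim_at_top)
  ultimately have "eventually (\<lambda>r. (\<forall>\<nu>\<in>{..n}. K2 \<nu> \<le> e / 4 * T r) \<and> (\<forall>j\<in>{..q}. log_count (zorder (L j)) r \<le> 2 * T r)
     \<and> (\<forall>j\<in>{..q}. good r \<longrightarrow> circle_mean (\<lambda>z. \<bar>ln (norm (L j z)) - ln (norm (g 0 z))\<bar>) r \<le> 4 * T r)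
     \<and> 64 * S * r powr (t - 1) \<le> e / 2 \<and> 128 * S * r powr (t - 1) \<le> e / 2 \<and> 64 * K * S powr d * r powr (t - d) \<le> e / 2
     \<and> 4 * S * r powr (t - 1) \<le> 1 \<and> 1 \<le> T r \<and> log_count (zorder (g 0)) r \<le> 2 * T r) at_top"
    using g0_log_count_le by eventually_elim auto
  then obtain r1 where r1: "\<And>r. r1 \<le> r \<Longrightarrow> (\<forall>\<nu>\<in>{..n}. K2 \<nu> \<le> e / 4 * T r) \<and> (\<forall>j\<in>{..q}. log_count (zorder (L j)) r \<le> 2 * T r)
     \<and> (\<forall>j\<in>{..q}. good r \<longrightarrow> circle_mean (\<lambda>z. \<bar>ln (norm (L j z)) - ln (norm (g 0 z))\<bar>) r \<le> 4 * T r)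
     \<and> 64 * S * r powr (t - 1) \<le> e / 2 \<and> 128 * S * r powr (t - 1) \<le> e / 2 \<and> 64 * K * S powr d * r powr (t - d) \<le> e / 2
     \<and> 4 * S * r powr (t - 1) \<le> 1 \<and> 1 \<le> T r \<and> log_count (zorder (g 0)) r \<le> 2 * T r"
    unfolding eventually_at_top_linorder by blast
  have "\<exists>r'\<ge>r. good r'" for r using good_dense[of r "r + 1"] by (auto intro: less_imp_le)
  from growth_lemma[OF s(1) td(1,5) Ts T1 this, of "max (max r0 r1) (max (2 * M) 2)"]
  obtain r where r: "max (max r0 r1) (max (2 * M) 2) \<le> r" "good r" and
    grow: "\<And>R. good R \<Longrightarrow> r + r powr (1 - t) / 2 \<le> R \<Longrightarrow> R \<le> r + r powr (1 - t) \<Longrightarrow> T R \<le> 2 * T r" by blast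
  have rr: "r0 \<le> r" "r1 \<le> r" "2 * M \<le> r" "2 \<le> r" using r(1) by auto
  note c1 = r1[OF rr(2)]
  define \<rho> where "\<rho> = r powr (1 - t)"
  have \<rho>0: "0 < \<rho>" using rr by (simp add: \<rho>_def)
  have \<rho>r: "\<rho> * r powr (t - 1) = 1" unfolding \<rho>_def using rr by (simp add: powr_add[symmetric])
  have S\<rho>: "4 * S \<le> \<rho>"
  proof -
    have "\<rho> * (4 * S * r powr (t - 1)) \<le> \<rho> * 1" using c1 \<rho>0 by (intro mult_left_mono) auto
    moreover have "\<rho> * (4 * S * r powr (t - 1)) = 4 * S * (\<rho> * r powr (t - 1))" by (simp only: mult_ac)
    ultimately show ?thesis using \<rho>r by simp
  qed
  have \<rho>le: "\<rho> \<le> r"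
  proof -
    have "r powr (1 - t) \<le> r powr 1" using rr td by (intro powr_mono) auto
    then show ?thesis using rr by (simp add: \<rho>_def)
  qed
  have rt: "r = \<rho> * r powr t" unfolding \<rho>_def using rr by (simp add: powr_add[symmetric])
  \<comment> \<open>Both radii lie in the window where \<open>T\<close> at most doubles. As 4 S
    \<le> \<rho>, \<open>R\<close> is at least \<rho>/4 beyond r + S; and R' exceeds R by at least
    \<rho>/4, which bounds the zero count at \<open>R\<close> by the log count at R'.\<close>
  obtain R where R: "r + \<rho> / 2 < R" "R < r + 5 * \<rho> / 8" "good R"
    using good_dense[of "r + \<rho> / 2" "r + 5 * \<rho> / 8"] \<rho>0 by auto
  obtain R' where R': "r + 7 * \<rho> / 8 < R'" "R' < r + \<rho>" "good R'"
    using good_dense[of "r + 7 * \<rho> / 8" "r + \<rho>"] \<rho>0 by auto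
  have TR: "T R \<le> 2 * T r" "T R' \<le> 2 * T r"
    using grow[OF R(3)] grow[OF R'(3)] R R' \<rho>0 unfolding \<rho>_def by auto
  have Rr: "r1 \<le> R" "r1 \<le> R'" "1 \<le> R" "R < R'" using rr R R' \<rho>0 by auto
  have Tr: "0 < T r" using c1 by auto
  \<comment> \<open>From R' \<le> 2 r, ln (R' / R) is at least (\<rho>/4) / (2 r) = 1 / (8 r^t), and
    the log count at R' is at most 2 T(R') \<le> 4 T(r); hence the factor 32.\<close>
  have n_bound: "unint_counting (zorder h) R \<le> 32 * r powr t * T r"
    if h: "nz_entire h" and le: "log_count (zorder h) R' \<le> 2 * T R'" for h
  proof -
    have n0: "0 \<le> unint_counting (zorder h) R" by (rule unint_counting_nonneg) (rule zorder_nonneg[OF h])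
    have "unint_counting (zorder h) R * ln (R' / R) \<le> log_count (zorder h) R'"
      by (rule unint_counting_le_log_count[OF zorder_locus_finite[OF h] _ Rr(3,4)]) (rule zorder_nonneg[OF h])
    moreover have "1 / (8 * r powr t) \<le> ln (R' / R)"
    proof -
      have "ln (R / R') \<le> R / R' - 1" using Rr by (intro ln_le_minus_one) auto
      moreover have "ln (R / R') = - ln (R' / R)" using Rr by (simp add: ln_div)
      moreover have "1 / (8 * r powr t) \<le> 1 - R / R'"
      proof -
        have "r powr t = r / \<rho>" using \<rho>0 arg_cong[OF rt, of "\<lambda>x. x / \<rho>"] by simp
        then have "1 / (8 * r powr t) = (\<rho> / 4) / (2 * r)" by simp
        also have "\<dots> \<le> (R' - R) / R'" by (rule frac_le) (use R R' \<rho>0 \<rho>le rr in auto)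
        also have "\<dots> = 1 - R / R'" using Rr by (simp add: diff_divide_distrib)
        finally show ?thesis .
      qed
      ultimately show ?thesis by linarith
    qed
    then have "unint_counting (zorder h) R * (1 / (8 * r powr t)) \<le> unint_counting (zorder h) R * ln (R' / R)"
      using n0 by (intro mult_left_mono)
    ultimately have "unint_counting (zorder h) R * (1 / (8 * r powr t)) \<le> 4 * T r" using le TR by linarith
    then show ?thesis using rr by (simp add: field_simps)
  qed
  have ng: "unint_counting (zorder (g 0)) R \<le> 32 * r powr t * T r"
    by (rule n_bound[OF g0]) (use r1[OF Rr(2)] in auto)
  have shift: "circle_mean (\<lambda>z. ln (norm (g 0 (z + of_nat \<nu> * c)))) r - circle_mean (\<lambda>z. ln (norm (g 0 z))) r \<le> e * T r"
    if v: "\<nu> \<le> n" for \<nu>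
  proof -
    have n0: "0 \<le> unint_counting (zorder (g 0)) x" for x by (rule unint_counting_nonneg) (rule zorder_nonneg[OF g0])
    have "unint_counting (zorder (g 0)) (r / 2) * ln (r / (r / 2)) \<le> log_count (zorder (g 0)) r"
      by (rule unint_counting_le_log_count[OF zorder_locus_finite[OF g0]]) (use rr zorder_nonneg[OF g0] in auto)
    then have "unint_counting (zorder (g 0)) (r / 2) * ln 2 \<le> 2 * T r" using c1 rr by simp
    moreover have "unint_counting (zorder (g 0)) (r / 2) * (1 / 2) \<le> unint_counting (zorder (g 0)) (r / 2) * ln 2"
      using n0 ln2_ge_two_thirds by (intro mult_left_mono) auto
    ultimately have n1: "unint_counting (zorder (g 0)) (r / 2) \<le> 4 * T r" by simp
    have "unint_counting (zorder (g 0)) (r + S) \<le> unint_counting (zorder (g 0)) R"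
      by (rule unint_counting_mono[OF zorder_locus_finite[OF g0]]) (use zorder_nonneg[OF g0] R S\<rho> S in auto)
    then have n2: "unint_counting (zorder (g 0)) (r + S) \<le> 32 * r powr t * T r" using ng by linarith
    have "circle_mean (\<lambda>z. ln (norm (g 0 (z + of_nat \<nu> * c)))) r - circle_mean (\<lambda>z. ln (norm (g 0 z))) r
      \<le> e / 4 * T r + 2 * S / M * (4 * T r) + 4 * S / r * (32 * r powr t * T r)"
      using K2[OF v rr(3)] c1 v mult_left_mono[OF n1, of "2 * S / M"] mult_left_mono[OF n2, of "4 * S / r"] S M rr
      by (smt (verit) atMost_iff divide_nonneg_pos)
    also have "2 * S / M * (4 * T r) = 8 * S / M * T r" by simp
    also have "4 * S / r * (32 * r powr t * T r) = 128 * S * r powr (t - 1) * T r"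
      using rr by (simp add: powr_diff)
    also have "e / 4 * T r + 8 * S / M * T r + 128 * S * r powr (t - 1) * T r
       \<le> e / 4 * T r + e / 4 * T r + e / 2 * T r"
      using M8 c1 Tr by (intro add_mono mult_right_mono) auto
    finally show ?thesis by simp
  qed
  have quot: "circle_mean (log_quot j \<nu>) r \<le> e * T r" if v: "\<nu> \<le> n" and j: "j \<le> q" for \<nu> j
  proof -
    have nL: "unint_counting (zorder (L j)) R \<le> 32 * r powr t * T r"
      by (rule n_bound[OF L_nz_entire[OF j]]) (use r1[OF Rr(2)] j in auto)
    have mR: "circle_mean (\<lambda>z. \<bar>ln (norm (L j z)) - ln (norm (g 0 z))\<bar>) R \<le> 8 * T r"
    proof -
      have "\<forall>j\<in>{..q}. good R \<longrightarrow> circle_mean (\<lambda>z. \<bar>ln (norm (L j z)) - ln (norm (g 0 z))\<bar>) R \<le> 4 * T R"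
        using r1[OF Rr(1)] by (elim conjE)
      then have "circle_mean (\<lambda>z. \<bar>ln (norm (L j z)) - ln (norm (g 0 z))\<bar>) R \<le> 4 * T R"
        using j R(3) by simp
      then show ?thesis using TR(1) by linarith
    qed
    have "circle_mean (log_quot j \<nu>) r \<le> 2 * S / (R - S - r) * circle_mean (\<lambda>z. \<bar>ln (norm (L j z)) - ln (norm (g 0 z))\<bar>) R
        + K * S powr d * r powr (- d) * (unint_counting (zorder (L j)) R + unint_counting (zorder (g 0)) R)"
      unfolding log_quot_def
    proof (rule diff[OF L_nz_entire[OF j] g0 nS[OF v]])
      show "0 < r" "S \<le> r" "r + S < R" using rr R S\<rho> \<rho>le S by auto
      show "\<And>z. norm z = R \<Longrightarrow> L j z \<noteq> 0 \<and> g 0 z \<noteq> 0" using goodD(3,4)[OF R(3)] j by blast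
      show "\<And>z. norm z = r \<Longrightarrow> L j z \<noteq> 0 \<and> g 0 z \<noteq> 0 \<and> L j (z + of_nat \<nu> * c) \<noteq> 0 \<and> g 0 (z + of_nat \<nu> * c) \<noteq> 0"
        using goodD(1,2,3,4)[OF r(2)] j v by blast
    qed
    also have "\<dots> \<le> 2 * S / (\<rho> / 4) * (8 * T r) + K * S powr d * r powr (- d) * (32 * r powr t * T r + 32 * r powr t * T r)"
    proof (intro add_mono mult_mono mR nL ng)
      show "2 * S / (R - S - r) \<le> 2 * S / (\<rho> / 4)" by (rule divide_left_mono) (use R S\<rho> S \<rho>0 in auto)
      have "0 \<le> unint_counting (zorder (L j)) R" by (rule unint_counting_nonneg) (rule zorder_nonneg[OF L_nz_entire[OF j]])
      moreover have "0 \<le> unint_counting (zorder (g 0)) R" by (rule unint_counting_nonneg) (rule zorder_nonneg[OF g0])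
      ultimately show "0 \<le> unint_counting (zorder (L j)) R + unint_counting (zorder (g 0)) R" by simp
      show "0 \<le> circle_mean (\<lambda>z. \<bar>ln (norm (L j z)) - ln (norm (g 0 z))\<bar>) R"
      proof (rule circle_mean_nonneg)
        show "continuous_on (sphere 0 R) (\<lambda>z. \<bar>ln (norm (L j z)) - ln (norm (g 0 z))\<bar>)"
          using goodD(3)[OF R(3) _ j] goodD(4)[OF R(3)]
          by (auto intro!: continuous_intros nz_entire_continuous L_nz_entire[OF j] g0)
      qed (use Rr in auto)
    qed (use S \<rho>0 K in auto)
    also have "2 * S / (\<rho> / 4) * (8 * T r) = 64 * S * r powr (t - 1) * T r"
    proof -
      have "1 / \<rho> = r powr (t - 1)" using \<rho>r \<rho>0 by (simp add: field_simps)
      then have "64 * S * (1 / \<rho>) * T r = 64 * S * r powr (t - 1) * T r" by simp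
      then show ?thesis by simp
    qed
    also have "K * S powr d * r powr (- d) * (32 * r powr t * T r + 32 * r powr t * T r)
        = 64 * K * S powr d * (r powr t * r powr (- d)) * T r" by (simp add: algebra_simps)
    also have "r powr t * r powr (- d) = r powr (t - d)" by (simp add: powr_add[symmetric])
    also have "64 * S * r powr (t - 1) * T r + 64 * K * S powr d * r powr (t - d) * T r \<le> e / 2 * T r + e / 2 * T r"
      using c1 Tr by (intro add_mono mult_right_mono) auto
    finally show ?thesis by simp
  qed
  show ?thesis using rr(1) r(2) shift quot by blast
qed

section \<open>The second main theorem on an unbounded set of radii\<close>

lemma second_main_theorem:
  assumes e: "0 < e"
  shows "\<exists>r\<ge>r0. real (q - n) * T r \<le> (\<Sum>j\<in>{0..q}. aperiodic_N n c g (a j) r) + e * T r"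
proof -
  \<comment> \<open>The number of error terms of size e' T(r): n + 1 shifts of \<open>g 0\<close>,
    (n + 1)(q + 1) logarithmic quotients, and one for everything that is o(T).\<close>
  define m where "m = real (Suc n) + real (Suc n) * real (q + 1) + 1"
  have m: "0 < m" by (simp add: m_def add_nonneg_pos)
  define e' where "e' = e / m"
  have e': "0 < e'" using e m by (simp add: e'_def)
  have "\<forall>J\<in>index_sets. \<exists>Y. Y \<in> o[at_top](T) \<and> (\<forall>r. good r \<longrightarrow> 1 \<le> r \<longrightarrow> circle_mean (err J) r \<le> Y r)"
    using err_mean_small by metis
  from bchoice[OF this] obtain Y where Y: "\<And>J. J \<in> index_sets \<Longrightarrow> Y J \<in> o[at_top](T)"
    "\<And>J r. J \<in> index_sets \<Longrightarrow> good r \<Longrightarrow> 1 \<le> r \<Longrightarrow> circle_mean (err J) r \<le> Y J r" by blast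
  have "\<forall>j\<in>{0..q}. \<exists>K. \<forall>r\<ge>1. aperiodic_N n c g (a j) r = log_count (aperiodic_mult n c (L j)) r + K"
    unfolding aperiodic_N_def using counting_eq_log_count[OF aperiodic_locus_finite] by (metis atLeastAtMost_iff)
  from bchoice[OF this] obtain K where K: "\<And>j r. j \<in> {0..q} \<Longrightarrow> 1 \<le> r \<Longrightarrow>
    aperiodic_N n c g (a j) r = log_count (aperiodic_mult n c (L j)) r + K j" by blast
  define JL where "JL = (\<lambda>j. circle_mean (\<lambda>z. ln (norm (L j z))) 1)"
  define JC where "JC = circle_mean (\<lambda>z. ln (norm (C z))) 1"
  define k where "k = (\<Sum>j\<in>{0..q}. JL j) - JC - (\<Sum>j\<in>{0..q}. K j) + ln (fact (Suc n)) - real (q - n) * u 0"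
  have "(\<lambda>r. k + ((real q + 2) * (\<Sum>J\<in>index_sets. log_count (zorder (coeff_det J)) r) + (real q + 2) * (\<Sum>J\<in>index_sets. Y J r))) \<in> o[at_top](T)"
    by (intro sum_in_smallo const_smallo_T landau_o.small.cmult_in_iff[THEN iffD2] big_sum_in_smallo coeff_det_log_count_small Y) auto
  from smallo_le_T[OF this e'] obtain r1 where r1: "\<And>r. r1 \<le> r \<Longrightarrow>
    k + ((real q + 2) * (\<Sum>J\<in>index_sets. log_count (zorder (coeff_det J)) r) + (real q + 2) * (\<Sum>J\<in>index_sets. Y J r)) \<le> e' * T r"
    unfolding eventually_at_top_linorder by blast
  from good_radius_estimates[OF e', of "max r0 (max r1 1)"]
  obtain r where r: "max r0 (max r1 1) \<le> r" "good r" and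
    sh: "\<And>\<nu>. \<nu> \<le> n \<Longrightarrow> circle_mean (\<lambda>z. ln (norm (g 0 (z + of_nat \<nu> * c)))) r - circle_mean (\<lambda>z. ln (norm (g 0 z))) r \<le> e' * T r"
    and qu: "\<And>\<nu> j. \<nu> \<le> n \<Longrightarrow> j \<le> q \<Longrightarrow> circle_mean (log_quot j \<nu>) r \<le> e' * T r" by blast
  have rr: "r0 \<le> r" "r1 \<le> r" "1 \<le> r" using r(1) by auto
  have A1: "(\<Sum>\<nu><Suc n. circle_mean (\<lambda>z. ln (norm (g 0 (z + of_nat \<nu> * c)))) r - circle_mean (\<lambda>z. ln (norm (g 0 z))) r)
      \<le> real (Suc n) * (e' * T r)"
    using sum_bounded_above[of "{..<Suc n}" "\<lambda>\<nu>. circle_mean (\<lambda>z. ln (norm (g 0 (z + of_nat \<nu> * c)))) r - circle_mean (\<lambda>z. ln (norm (g 0 z))) r" "e' * T r"] sh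
    by (simp del: sum.lessThan_Suc of_nat_Suc)
  have A2: "(\<Sum>\<nu><Suc n. \<Sum>j\<in>{0..q}. circle_mean (log_quot j \<nu>) r) \<le> real (Suc n) * (real (q + 1) * (e' * T r))"
  proof -
    have "(\<Sum>j\<in>{0..q}. circle_mean (log_quot j \<nu>) r) \<le> real (q + 1) * (e' * T r)" if "\<nu> < Suc n" for \<nu>
      using sum_bounded_above[of "{0..q}" "\<lambda>j. circle_mean (log_quot j \<nu>) r" "e' * T r"] qu[of \<nu>] that by simp
    then show ?thesis
      using sum_bounded_above[of "{..<Suc n}" "\<lambda>\<nu>. \<Sum>j\<in>{0..q}. circle_mean (log_quot j \<nu>) r" "real (q + 1) * (e' * T r)"]
      by (simp del: sum.lessThan_Suc of_nat_Suc of_nat_add)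
  qed
  have A3: "(real q + 2) * (\<Sum>J\<in>index_sets. circle_mean (err J) r) \<le> (real q + 2) * (\<Sum>J\<in>index_sets. Y J r)"
    by (intro mult_left_mono sum_mono Y r rr) auto
  have A4: "(\<Sum>j\<in>{0..q}. circle_mean (\<lambda>z. ln (norm (L j z))) r) = (\<Sum>j\<in>{0..q}. JL j) + (\<Sum>j\<in>{0..q}. log_count (zorder (L j)) r)"
    unfolding sum.distrib[symmetric] JL_def
    by (intro sum.cong refl circle_mean_eq jensen L_nz_entire rr) auto
  have A5: "circle_mean (\<lambda>z. ln (norm (C z))) r = JC + log_count (zorder C) r"
    unfolding JC_def by (intro circle_mean_eq jensen C_nz_entire rr)
  have A6: "(\<Sum>j\<in>{0..q}. aperiodic_N n c g (a j) r) = (\<Sum>j\<in>{0..q}. log_count (aperiodic_mult n c (L j)) r) + (\<Sum>j\<in>{0..q}. K j)"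
    unfolding sum.distrib[symmetric] by (intro sum.cong refl K rr)
  have A7: "real (Suc n) * (e' * T r) + real (Suc n) * (real (q + 1) * (e' * T r)) + e' * T r = e * T r"
  proof -
    have "real (Suc n) * (e' * T r) + real (Suc n) * (real (q + 1) * (e' * T r)) + e' * T r = m * e' * T r"
      unfolding m_def by (simp add: algebra_simps)
    then show ?thesis using m by (simp add: e'_def)
  qed
  have A8: "real (q - n) * (T r + u 0) = real (q - n) * T r + real (q - n) * u 0" by (rule distrib_left)
  have "real (q - n) * T r \<le> (\<Sum>j\<in>{0..q}. aperiodic_N n c g (a j) r) + e * T r"
    using mean_inequality[OF r(2) rr(3)] counting_inequality[OF rr(3)] r1[OF rr(2)] A1 A2 A3 A4 A5 A6 A7 A8
    unfolding k_def by linarith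
  then show ?thesis using rr(1) by blast
qed

text \<open>Makes the limsup finite, so that the defects are real numbers and can be added and
  rearranged. The lower bound is -1 rather than 0 because \<open>counting\<close> may differ from
  the nonnegative log count by a negative constant.\<close>

lemma aperiodic_N_ratio_bounds:
  assumes j: "j \<le> q"
  shows "eventually (\<lambda>r. -1 \<le> aperiodic_N n c g (a j) r / T r) at_top"
    "eventually (\<lambda>r. aperiodic_N n c g (a j) r / T r \<le> 3) at_top"
proof -
  obtain K where K: "\<And>r. 1 \<le> r \<Longrightarrow> aperiodic_N n c g (a j) r = log_count (aperiodic_mult n c (L j)) r + K"
    unfolding aperiodic_N_def using counting_eq_log_count[OF aperiodic_locus_finite[OF j]] by metis
  have T1: "eventually (\<lambda>r. 1 \<le> T r) at_top" using T_at_top by (simp add: filterlim_at_top)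
  have k1: "eventually (\<lambda>r. K \<le> 1 * T r) at_top" "eventually (\<lambda>r. - K \<le> 1 * T r) at_top"
    by (intro smallo_le_T const_smallo_T; simp)+
  show "eventually (\<lambda>r. -1 \<le> aperiodic_N n c g (a j) r / T r) at_top"
    using k1(2) T1 eventually_ge_at_top[of 1]
  proof eventually_elim
    case (elim r)
    have "0 \<le> log_count (aperiodic_mult n c (L j)) r"
      by (rule log_count_nonneg[OF elim(3)]) (rule succ_mult_bounds(4)[OF j])
    then show ?case using K[OF elim(3)] elim by (simp add: le_divide_eq)
  qed
  show "eventually (\<lambda>r. aperiodic_N n c g (a j) r / T r \<le> 3) at_top"
    using k1(1) T1 eventually_ge_at_top[of 1] form_log_count_le[OF j]
  proof eventually_elim
    case (elim r)
    have "log_count (aperiodic_mult n c (L j)) r \<le> log_count (zorder (L j)) r"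
    proof (rule log_count_mono[OF aperiodic_locus_finite[OF j] zorder_locus_finite[OF L_nz_entire[OF j]] elim(3)])
      fix z show "aperiodic_mult n c (L j) z \<le> zorder (L j) z"
        using succ_mult_bounds(1)[OF j, of z] by (simp add: succ_mult_def)
    qed
    then show ?case using K[OF elim(3)] elim by (simp add: divide_le_eq)
  qed
qed

theorem defect_relation: "(\<Sum>j=0..q. aperiodic_defect n c g (a j)) \<le> ereal (real n + 1)"
proof -
  define X where "X = (\<lambda>j. Limsup at_top (\<lambda>r. ereal (aperiodic_N n c g (a j) r / T r)))"
  have Xf: "\<bar>X j\<bar> \<noteq> \<infinity>" if j: "j \<le> q" for j
  proof -
    have "X j \<le> ereal 3" unfolding X_def
      by (rule Limsup_bounded) (use aperiodic_N_ratio_bounds(2)[OF j] in simp)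
    moreover have "ereal (-1) \<le> X j" unfolding X_def
      by (rule le_Limsup) (use aperiodic_N_ratio_bounds(1)[OF j] in auto)
    ultimately show ?thesis by (cases "X j") auto
  qed
  define x where "x = (\<lambda>j. real_of_ereal (X j))"
  have Xx: "X j = ereal (x j)" if "j \<le> q" for j using Xf[OF that] by (simp add: x_def ereal_real)
  have "(\<Sum>j=0..q. aperiodic_defect n c g (a j)) = (\<Sum>j=0..q. ereal (1 - x j))"
  proof (intro sum.cong refl)
    fix j assume "j \<in> {0..q}"
    then have "X j = ereal (x j)" by (intro Xx) auto
    then show "aperiodic_defect n c g (a j) = ereal (1 - x j)"
      unfolding aperiodic_defect_def X_def by (simp add: one_ereal_def)
  qed
  also have "\<dots> = ereal (\<Sum>j=0..q. 1 - x j)" by simp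
  also have "(\<Sum>j=0..q. 1 - x j) \<le> real n + 1"
  proof (rule field_le_epsilon)
    fix e :: real assume e: "0 < e"
    \<comment> \<open>One share for each of the q + 1 limsups and one for the second main theorem.
      The former hold for all large radii, the latter for some large radius, which is
      enough.\<close>
    define d where "d = e / (real q + 2)"
    have d: "0 < d" using e by (simp add: d_def)
    have "eventually (\<lambda>r. \<forall>j\<in>{0..q}. aperiodic_N n c g (a j) r / T r < x j + d) at_top"
    proof (intro eventually_ball_finite ballI)
      fix j assume "j \<in> {0..q}"
      then have "X j < ereal (x j + d)" using Xx[of j] d by simp
      from Limsup_lessD[OF this[unfolded X_def]]
      show "eventually (\<lambda>r. aperiodic_N n c g (a j) r / T r < x j + d) at_top" by simp
    qed simp
    moreover have "eventually (\<lambda>r. 1 \<le> T r) at_top" using T_at_top by (simp add: filterlim_at_top)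
    ultimately have "eventually (\<lambda>r. (\<forall>j\<in>{0..q}. aperiodic_N n c g (a j) r / T r < x j + d) \<and> 1 \<le> T r) at_top"
      by (rule eventually_conj)
    then obtain r0 where r0: "\<And>r. r0 \<le> r \<Longrightarrow> (\<forall>j\<in>{0..q}. aperiodic_N n c g (a j) r / T r < x j + d) \<and> 1 \<le> T r"
      unfolding eventually_at_top_linorder by blast
    obtain r where r: "r0 \<le> r" "real (q - n) * T r \<le> (\<Sum>j\<in>{0..q}. aperiodic_N n c g (a j) r) + d * T r"
      using second_main_theorem[OF d] by blast
    have Tr: "0 < T r" using r0[OF r(1)] by auto
    have "(\<Sum>j\<in>{0..q}. aperiodic_N n c g (a j) r) \<le> (\<Sum>j\<in>{0..q}. (x j + d) * T r)"
    proof (rule sum_mono)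
      fix j assume "j \<in> {0..q}"
      then have "aperiodic_N n c g (a j) r / T r < x j + d" using r0[OF r(1)] by blast
      then show "aperiodic_N n c g (a j) r \<le> (x j + d) * T r" using Tr by (simp add: divide_less_eq)
    qed
    then have "real (q - n) * T r \<le> ((\<Sum>j\<in>{0..q}. x j + d) + d) * T r"
      using r(2) by (simp add: sum_distrib_right distrib_right)
    then have "real (q - n) \<le> (\<Sum>j\<in>{0..q}. x j + d) + d" using Tr by simp
    also have "\<dots> = (\<Sum>j\<in>{0..q}. x j) + (real q + 2) * d" by (simp add: sum.distrib algebra_simps)
    also have "(real q + 2) * d = e" by (simp add: d_def)
    finally show "(\<Sum>j=0..q. 1 - x j) \<le> real n + 1 + e"
      using n_le_q by (simp add: sum_subtractf of_nat_diff)
  qed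
  finally show ?thesis by simp
qed

end

theorem corollary4p4:
  fixes c :: complex and n q :: nat
    and g :: "nat \<Rightarrow> complex \<Rightarrow> complex"
    and a :: "nat \<Rightarrow> nat \<Rightarrow> complex \<Rightarrow> complex"
  assumes "c \<noteq> 0" and "n \<ge> 1"
    and "entire_curve n g"
    and "hyper_order (cartan_T n g) < 1"
    and "P1_lin_indep c {0..n} g"
    and "\<And>j k. j \<le> q \<Longrightarrow> k \<le> n \<Longrightarrow> a j k holomorphic_on UNIV"
    and "\<And>j k z. j \<le> q \<Longrightarrow> k \<le> n \<Longrightarrow> a j k (z + c) = a j k z"
    and "\<And>j k. j \<le> q \<Longrightarrow> k \<le> n \<Longrightarrow> nevanlinna_T (a j k) \<in> o[at_top](cartan_T n g)"
    and "general_position c n q a"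
  shows "(\<Sum>j=0..q. aperiodic_defect n c g (a j)) \<le> ereal (real n + 1)"
proof -
  interpret slow_curve c n g by unfold_locales (use assms in auto)
  have "a j k \<in> small_periodic" if "j \<le> q" "k \<le> n" for j k
  proof -
    have "nevanlinna_T (a j k) = (\<lambda>r. circle_mean (\<lambda>z. ln (max 1 (norm (a j k z)))) r)"
      by (intro ext nevanlinna_T_entire assms(6) that)
    then show ?thesis using assms(6,7,8)[OF that] by (simp add: small_periodic_def)
  qed
  then interpret moving_hyperplanes c n g q a by unfold_locales (use assms in auto)
  show ?thesis by (rule defect_relation)
qed

end
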